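(* Let $\mathsf k$ be a field and let $Q$ be a graded Gorenstein Artin $\mathsf k$-algebra with $\ell\ell(Q)\geq 3$. Then the decomposition of $Q$ into graded components which are indecomposable as connected sums over $\mathsf k$ is unique up to isomorphism. That is, if $R_1,\ldots,R_p$ and $S_1,\ldots,S_q$ are graded Gorenstein Artin $\mathsf k$-algebras, each indecomposable as a connected sum over $\mathsf k$, with $\ell\ell(R_i)\ge3$ and $\ell\ell(S_j)\geq 3$ for all $i,j$, and if $$Q\simeq R_1\#_{\mathsf k}\cdots\#_{\mathsf k}R_p\simeq S_1\#_{\mathsf k}\cdots\#_{\mathsf k}S_q$$ as graded rings, then $p=q$ and there is a permutation $\sigma$ of $\{1,\ldots,p\}$ such that $S_i\simeq R_{\sigma(i)}$ for $1\le i\le p$.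
   Context: A graded $\mathsf k$-algebra is a graded ring $G=\bigoplus_{i\ge0}G_i$ with $G_0=\mathsf k$; its maximal ideal is $\bigoplus_{i\ge1}G_i$, and when Artinian it is local with residue field $\mathsf k$. $\ell\ell(T)=\max\{n:\mathfrak m_T^n\neq 0\}$ is the Loewy length of an Artinian local ring $T$. Fibre product: for local rings $R_1,\ldots,R_p$ with common residue field $\mathsf k$, $R_1\times_{\mathsf k}\cdots\times_{\mathsf k}R_p$ is the subring of $\prod R_i$ of tuples whose entries have the same image in $\mathsf k$. Connected sum: if the $R_i$ are Gorenstein Artin local rings with residue field $\mathsf k$, different from $\mathsf k$, and $\operatorname{soc}(R_i)=\langle\delta_{R_i}\rangle$, then $R_1\#_{\mathsf k}\cdots\#_{\mathsf k}R_p$ is the quotient of $R_1\times_{\mathsf k}\cdots\times_{\mathsf k}R_p$ by the ideal generated by the differences $\delta_{R_i}-\delta_{R_j}$, where $\delta_{R_i}$ is identified with the tuple having $\delta_{R_i}$ in position $i$ and $0$ elsewhere (this is the iterated two-fold connected sum). It depends on the chosen socle generators; an isomorphism involving a connected sum is asserted for some choice. In the graded situation the socle generators are homogeneous of a common degree so that the connected sum inherits a grading. A Gorenstein Artin local ring $(Q,\mathfrak m_Q,\mathsf k)$ decomposes as a connected sum over $\mathsf k$ if there are Gorenstein Artin local rings $R,S$ with residue field $\mathsf k$ and $\ell\ell(R),\ell\ell(S)\ge2$ such that $Q\simeq R\#_{\mathsf k}S$ and $R\not\simeq Q\not\simeq S$ (the last condition is automatic by length); otherwise $Q$ is indecomposable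 as a connected sum over $\mathsf k$. *)

theory Defs
  imports "HOL-Combinatorics.Permutations" "HOL-Algebra.Module" "HOL-Algebra.Ideal_Product"
    "HOL-Algebra.QuotRing"
begin

section \<open>Artinian local rings\<close>

locale artinian_local_ring = cring R for R (structure) +
  assumes local: "\<exists>!M. maximalideal M R"
    and descending_chain:
      "\<And>C :: nat \<Rightarrow> 'a set. (\<And>n. ideal (C n) R) \<Longrightarrow> (\<And>n. C (Suc n) \<subseteq> C n) \<Longrightarrow>
        \<exists>n. \<forall>m\<ge>n. C m = C n"

definition max_ideal :: "('a, 'm) ring_scheme \<Rightarrow> 'a set"
  where "max_ideal R = (THE M. maximalideal M R)"

definition loewy_length :: "('a, 'm) ring_scheme \<Rightarrow> nat"
  where "loewy_length R =
    Max {n. max_ideal R [^]\<^bsub>ideals_set R\<^esub> (n::nat) \<noteq> {\<zero>\<^bsub>R\<^esub>}}"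

definition socle :: "('a, 'm) ring_scheme \<Rightarrow> 'a set"
  where "socle R = {x \<in> carrier R. \<forall>y \<in> max_ideal R. x \<otimes>\<^bsub>R\<^esub> y = \<zero>\<^bsub>R\<^esub>}"

definition socle_generator :: "('a, 'm) ring_scheme \<Rightarrow> 'a \<Rightarrow> bool"
  where "socle_generator R \<delta> \<longleftrightarrow>
    \<delta> \<in> carrier R \<and> \<delta> \<noteq> \<zero>\<^bsub>R\<^esub> \<and> socle R = PIdl\<^bsub>R\<^esub> \<delta>"

text \<open>An Artinian local ring is Gorenstein iff its socle is one-dimensional over the residue
  field. The maximal ideal annihilates the socle, so the \<open>R\<close>-submodule generated by an element
  of the socle is its span over the residue field, and one-dimensionality says that the socle is
  generated by a single nonzero element.\<close>

locale gorenstein_artinian_local_ring = artinian_local_ring +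
  assumes gorenstein: "\<exists>\<delta>. socle_generator R \<delta>"

text \<open>The identification of the residue field of a local ring with \<open>K\<close>, given as a surjection
  onto \<open>K\<close>; its kernel is necessarily the maximal ideal.\<close>

definition residue_map ::
    "('k, 'l) ring_scheme \<Rightarrow> ('a, 'm) ring_scheme \<Rightarrow> ('a \<Rightarrow> 'k) \<Rightarrow> bool"
  where "residue_map K R \<pi> \<longleftrightarrow> \<pi> \<in> ring_hom R K \<and> \<pi> ` carrier R = carrier K"


section \<open>Fibre products and connected sums\<close>

definition fibre_product ::
    "'i set \<Rightarrow> ('i \<Rightarrow> ('a, 'm) ring_scheme) \<Rightarrow> ('i \<Rightarrow> 'a \<Rightarrow> 'k) \<Rightarrow> ('i \<Rightarrow> 'a) ring"
  where "fibre_product I R \<pi> =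
    \<lparr>carrier = {x \<in> \<Pi>\<^sub>E i\<in>I. carrier (R i). \<forall>i\<in>I. \<forall>j\<in>I. \<pi> i (x i) = \<pi> j (x j)},
     mult = (\<lambda>x y. \<lambda>i\<in>I. x i \<otimes>\<^bsub>R i\<^esub> y i),
     one = (\<lambda>i\<in>I. \<one>\<^bsub>R i\<^esub>),
     zero = (\<lambda>i\<in>I. \<zero>\<^bsub>R i\<^esub>),
     add = (\<lambda>x y. \<lambda>i\<in>I. x i \<oplus>\<^bsub>R i\<^esub> y i)\<rparr>"

definition single_entry ::
    "'i set \<Rightarrow> ('i \<Rightarrow> ('a, 'm) ring_scheme) \<Rightarrow> 'i \<Rightarrow> 'a \<Rightarrow> ('i \<Rightarrow> 'a)"
  where "single_entry I R i a = (\<lambda>j\<in>I. if j = i then a else \<zero>\<^bsub>R j\<^esub>)"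

definition connected_sum_ideal ::
    "'i set \<Rightarrow> ('i \<Rightarrow> ('a, 'm) ring_scheme) \<Rightarrow> ('i \<Rightarrow> 'a \<Rightarrow> 'k) \<Rightarrow> ('i \<Rightarrow> 'a) \<Rightarrow> ('i \<Rightarrow> 'a) set"
  where "connected_sum_ideal I R \<pi> \<delta> =
    Idl\<^bsub>fibre_product I R \<pi>\<^esub>
      {single_entry I R i (\<delta> i) \<ominus>\<^bsub>fibre_product I R \<pi>\<^esub> single_entry I R j (\<delta> j) | i j.
        i \<in> I \<and> j \<in> I}"

definition connected_sum ::
    "'i set \<Rightarrow> ('i \<Rightarrow> ('a, 'm) ring_scheme) \<Rightarrow> ('i \<Rightarrow> 'a \<Rightarrow> 'k) \<Rightarrow> ('i \<Rightarrow> 'a) \<Rightarrow> ('i \<Rightarrow> 'a) set ring"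
  where "connected_sum I R \<pi> \<delta> = fibre_product I R \<pi> Quot connected_sum_ideal I R \<pi> \<delta>"

text \<open>The two summands are sought among the rings carried by subsets of the carrier type of \<open>Q\<close>.
  This is no restriction: if \<open>Q\<close> is a connected sum of \<open>R 1\<close> and \<open>R 2\<close> over \<open>K\<close>, both of Loewy
  length at least 2, then \<open>length Q = length (R 1) + length (R 2) - 2 > length (R i)\<close>, and a ring
  of length \<open>n\<close> with residue field \<open>K\<close> has cardinality \<open>card K ^ n\<close> (also for infinite \<open>K\<close>), so
  each \<open>R i\<close> is isomorphic to a ring whose carrier is a subset of the carrier of \<open>Q\<close>.\<close>

definition decomposes_as_connected_sum ::
    "('k, 'l) ring_scheme \<Rightarrow> ('a, 'm) ring_scheme \<Rightarrow> bool"
  where "decomposes_as_connected_sum K Q \<longleftrightarrow>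
    (\<exists>(R :: nat \<Rightarrow> 'a ring) (\<pi> :: nat \<Rightarrow> 'a \<Rightarrow> 'k) (\<delta> :: nat \<Rightarrow> 'a).
      (\<forall>i\<in>{1, 2}. gorenstein_artinian_local_ring (R i) \<and> residue_map K (R i) (\<pi> i) \<and>
        loewy_length (R i) \<ge> 2 \<and> socle_generator (R i) (\<delta> i) \<and> \<not> R i \<simeq> Q) \<and>
      Q \<simeq> connected_sum {1, 2} R \<pi> \<delta>)"


section \<open>Graded algebras\<close>

text \<open>The condition on \<open>A 0\<close> says that the structure map identifies \<open>K\<close> with the degree-zero
  component.\<close>

locale graded_algebra = algebra K G for K and G (structure) +
  fixes A :: "nat \<Rightarrow> 'c set"
  assumes base_field: "field K"
    and component_subgroup: "additive_subgroup (A n) G"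
    and component_mult: "\<lbrakk>x \<in> A m; y \<in> A n\<rbrakk> \<Longrightarrow> x \<otimes>\<^bsub>G\<^esub> y \<in> A (m + n)"
    and direct_sum: "x \<in> carrier G \<Longrightarrow>
      \<exists>!f. (\<forall>n. f n \<in> A n) \<and> finite {n. f n \<noteq> \<zero>\<^bsub>G\<^esub>} \<and>
        x = finsum G f {n. f n \<noteq> \<zero>\<^bsub>G\<^esub>}"
    and component_zero: "bij_betw (\<lambda>c. c \<odot>\<^bsub>G\<^esub> \<one>\<^bsub>G\<^esub>) (carrier K) (A 0)"

definition graded_gorenstein_artinian_algebra ::
    "('k, 'l) ring_scheme \<Rightarrow> ('k, 'a, 'm) module_scheme \<Rightarrow> (nat \<Rightarrow> 'a set) \<Rightarrow> bool"
  where "graded_gorenstein_artinian_algebra K G A \<longleftrightarrow>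
    graded_algebra K G A \<and> gorenstein_artinian_local_ring G"

text \<open>The residue map of a local \<open>K\<close>-algebra with residue field \<open>K\<close> that is compatible with the
  algebra structure. For a graded algebra, whose maximal ideal is the sum of the components of
  positive degree, it is the projection to degree zero.\<close>

definition algebra_residue ::
    "('k, 'l) ring_scheme \<Rightarrow> ('k, 'a, 'm) module_scheme \<Rightarrow> 'a \<Rightarrow> 'k"
  where "algebra_residue K G x =
    (THE c. c \<in> carrier K \<and> x \<ominus>\<^bsub>G\<^esub> (c \<odot>\<^bsub>G\<^esub> \<one>\<^bsub>G\<^esub>) \<in> max_ideal G)"

definition connected_sum_component ::
    "'i set \<Rightarrow> ('i \<Rightarrow> ('a, 'm) ring_scheme) \<Rightarrow> ('i \<Rightarrow> nat \<Rightarrow> 'a set) \<Rightarrow> ('i \<Rightarrow> 'a \<Rightarrow> 'k) \<Rightarrow>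
      ('i \<Rightarrow> 'a) \<Rightarrow> nat \<Rightarrow> ('i \<Rightarrow> 'a) set set"
  where "connected_sum_component I R A \<pi> \<delta> n =
    (\<lambda>x. connected_sum_ideal I R \<pi> \<delta> +>\<^bsub>fibre_product I R \<pi>\<^esub> x) `
      {x \<in> carrier (fibre_product I R \<pi>). \<forall>i\<in>I. x i \<in> A i n}"

definition graded_ring_isomorphic ::
    "('a, 'm) ring_scheme \<Rightarrow> (nat \<Rightarrow> 'a set) \<Rightarrow> ('b, 'n) ring_scheme \<Rightarrow> (nat \<Rightarrow> 'b set) \<Rightarrow> bool"
  where "graded_ring_isomorphic R A S B \<longleftrightarrow> (\<exists>h \<in> ring_iso R S. \<forall>n. h ` A n = B n)"

text \<open>The socle generators are existentially quantified because the connected sum depends on them;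
  they share one degree so that the ideal divided out is homogeneous.\<close>

definition isomorphic_to_graded_connected_sum ::
    "('k, 'l) ring_scheme \<Rightarrow> ('b, 'n) ring_scheme \<Rightarrow> (nat \<Rightarrow> 'b set) \<Rightarrow>
      'i set \<Rightarrow> ('i \<Rightarrow> ('k, 'a, 'm) module_scheme) \<Rightarrow> ('i \<Rightarrow> nat \<Rightarrow> 'a set) \<Rightarrow> bool"
  where "isomorphic_to_graded_connected_sum K Q B I R A \<longleftrightarrow>
    (let \<pi> = (\<lambda>i. algebra_residue K (R i)) in
      \<exists>\<delta> d. (\<forall>i\<in>I. socle_generator (R i) (\<delta> i) \<and> \<delta> i \<in> A i d) \<and>
        graded_ring_isomorphic Q B
          (connected_sum I R \<pi> \<delta>) (connected_sum_component I R A \<pi> \<delta>))"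

end

theory Submission
  imports Defs
begin

text \<open>
Let \<open>m\<close> be the maximal ideal of \<open>Q\<close>, which is the part of positive degree, and let \<open>Z\<close> be the
annihilator of \<open>m\<close> in \<open>m\<close>, which is the socle. A connected sum decomposition of \<open>Q\<close> is a family of
ideals \<open>M i\<close> with sum \<open>m\<close> and with \<open>M i M j = 0\<close> for \<open>i \<noteq> j\<close>, each containing \<open>Z\<close>: the ideal \<open>M i\<close>
is the image of the maximal ideal of the summand \<open>R i\<close> (\<open>graded_connected_sum.decomposition\<close>).
If the maximal ideal of a summand were a sum of two orthogonal ideals \<open>U\<close> and \<open>V\<close>, neither of
them inside the socle, then the summand would be the connected sum of its subrings \<open>k + U\<close> and
\<open>k + V\<close> (\<open>orthogonal_splitting.decomposes\<close>). So each \<open>M i\<close> is indecomposable as an orthogonal sum,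
and the theorem is a Krull-Schmidt statement about \<open>m\<close> with the form \<open>m \<times> m \<rightarrow> Q\<close> given by
multiplication, whose radical is \<open>Z\<close>.

Let \<open>L j\<close> be the ideals of a second decomposition. The projections \<open>e\<close> to \<open>M i\<close> and \<open>f\<close> to \<open>L j\<close> are
well defined and \<open>Q\<close>-linear modulo \<open>Z\<close>, and they are self-adjoint: \<open>e(x) y = x e(y)\<close>. On products they
commute modulo \<open>Z\<close>, because \<open>e(f(xy)) = f(x) e(y) = f(e(xy))\<close>. Length at least 3 means that the cube of \<open>M i\<close> is
not zero, and it enters as follows.

\<^item> Two elements \<open>u\<close> and \<open>v\<close> of \<open>M i\<close> that annihilate the square of \<open>M i\<close> satisfy \<open>u v = 0\<close>. Otherwise
  \<open>Q u\<close> or \<open>Q u + Q v\<close> would split off as an orthogonal summand, and this summand is too small to be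
  all of \<open>M i\<close> because its cube is zero (\<open>square_annihilator_products\<close>).

\<^item> The self-adjoint map \<open>a = e f e\<close> on \<open>M i\<close> is idempotent on products. Hence the values of \<open>a\<^sup>2 - a\<close>
  annihilate the square of \<open>M i\<close>, so they have pairwise product zero. Then \<open>3a\<^sup>2 - 2a\<^sup>3\<close> is a
  self-adjoint idempotent, which splits \<open>M i\<close>. By indecomposability it is 0 or 1, so \<open>f\<close> is 0 or 1
  on the square of \<open>M i\<close> (\<open>square_dichotomy\<close>).

\<^item> As the cube of \<open>M i\<close> is not zero, it is 1 for exactly one \<open>j\<close>, and by symmetry this gives a
  bijection of the two index sets. For the other indices \<open>k\<close> the components in \<open>L k\<close> of elements of
  \<open>M i\<close> annihilate the square of \<open>L k\<close>, so the first item makes their products zero. What remains is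
  \<open>x y = f(x) f(y)\<close> for \<open>x\<close> and \<open>y\<close> in \<open>M i\<close> (\<open>linked_isometry\<close>, \<open>matching\<close>).

The map \<open>f\<close> from \<open>M i\<close> to \<open>L j\<close> is now a bijection modulo \<open>Z\<close> that preserves products exactly. Since \<open>Z\<close> is
the component of top degree, the grading selects a lift of \<open>f\<close> to a ring isomorphism of
\<open>k + M i\<close> with \<open>k + L j\<close>: it is the identity in degree zero and in top degree, and \<open>f\<close> in between
(\<open>matched_factors_isomorphic\<close>).
\<close>

section \<open>Orthogonal sums of ideals\<close>

lemma (in abelian_group) diff_eq_zero_iff:
  assumes "a \<in> carrier G" "b \<in> carrier G"
  shows "a \<ominus> b = \<zero> \<longleftrightarrow> a = b"
  using assms by (metis a_minus_def a_inv_closed minus_equality r_neg minus_minus)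

lemma (in cring) commutative_idealI:
  assumes "H \<subseteq> carrier R" "\<zero> \<in> H"
    and "\<And>x y. x \<in> H \<Longrightarrow> y \<in> H \<Longrightarrow> x \<oplus> y \<in> H"
    and "\<And>r x. r \<in> carrier R \<Longrightarrow> x \<in> H \<Longrightarrow> r \<otimes> x \<in> H"
  shows "ideal H R"
proof (rule idealI)
  show "ring R" by (rule ring_axioms)
  have "\<ominus> x \<in> H" if "x \<in> H" for x
  proof -
    have "(\<ominus> \<one>) \<otimes> x = \<ominus> x" using that assms(1) by (auto simp: l_minus)
    then show ?thesis using assms(4)[of "\<ominus> \<one>" x] that by simp
  qed
  then show "subgroup H (add_monoid R)"
    using assms by (auto intro!: add.subgroupI)
  show "x \<otimes> a \<in> H" if "a \<in> H" "x \<in> carrier R" for a x using that assms by auto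
  show "a \<otimes> x \<in> H" if "a \<in> H" "x \<in> carrier R" for a x
    using that assms by (metis m_comm subsetD)
qed

lemma (in ideal) diff_closed: "x \<in> I \<Longrightarrow> y \<in> I \<Longrightarrow> x \<ominus> y \<in> I"
  by (simp add: a_minus_def)

lemma (in cring) annihilated_ideal:
  assumes "ideal H R" "\<And>z. z \<in> T \<Longrightarrow> g z \<in> carrier R"
  shows "ideal {x \<in> H. \<forall>z\<in>T. x \<otimes> g z = \<zero>} R"
proof -
  interpret H: ideal H R by fact
  show ?thesis
    by (rule commutative_idealI)
      (use assms(2) H.Icarr in \<open>auto simp: l_distr m_assoc intro: H.I_l_closed\<close>)
qed

text \<open>For the maximal ideal \<open>N\<close> of a local ring that is not a field this is the socle; it is also the radical
of the bilinear form on \<open>N\<close> given by multiplication.\<close>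

definition self_annihilator :: "('a, 'm) ring_scheme \<Rightarrow> 'a set \<Rightarrow> 'a set"
  where "self_annihilator R N = {x \<in> N. \<forall>y\<in>N. x \<otimes>\<^bsub>R\<^esub> y = \<zero>\<^bsub>R\<^esub>}"

text \<open>The ideal \<open>X\<close> is regarded inside the form on \<open>N\<close>: a splitting of \<open>X\<close> counts as trivial when one of
its parts lies in the radical.\<close>

definition orthogonally_indecomposable :: "('a, 'm) ring_scheme \<Rightarrow> 'a set \<Rightarrow> 'a set \<Rightarrow> bool"
  where "orthogonally_indecomposable R N X \<longleftrightarrow>
    (\<forall>U V. ideal U R \<longrightarrow> ideal V R \<longrightarrow> U \<subseteq> X \<longrightarrow> V \<subseteq> X \<longrightarrow>
      (\<forall>u\<in>U. \<forall>v\<in>V. u \<otimes>\<^bsub>R\<^esub> v = \<zero>\<^bsub>R\<^esub>) \<longrightarrow>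
      (\<forall>x\<in>X. \<exists>u\<in>U. \<exists>v\<in>V. x = u \<oplus>\<^bsub>R\<^esub> v) \<longrightarrow>
      U \<subseteq> self_annihilator R N \<or> V \<subseteq> self_annihilator R N)"

lemma orthogonally_indecomposableD:
  assumes "orthogonally_indecomposable R N X" "ideal U R" "ideal V R" "U \<subseteq> X" "V \<subseteq> X"
    and "\<And>u v. u \<in> U \<Longrightarrow> v \<in> V \<Longrightarrow> u \<otimes>\<^bsub>R\<^esub> v = \<zero>\<^bsub>R\<^esub>"
    and "\<And>x. x \<in> X \<Longrightarrow> \<exists>u\<in>U. \<exists>v\<in>V. x = u \<oplus>\<^bsub>R\<^esub> v"
  shows "U \<subseteq> self_annihilator R N \<or> V \<subseteq> self_annihilator R N"
  using assms unfolding orthogonally_indecomposable_def by blast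

text \<open>A self-adjoint idempotent splits an ideal into two orthogonal ideals, its kernel and its image. When
the values of \<open>a\<^sup>2 - a\<close> have pairwise product zero, \<open>a\<close> can be replaced by the idempotent
\<open>3a\<^sup>2 - 2a\<^sup>3\<close>, whose kernel and image are the kernels of \<open>a\<^sup>2\<close> and of \<open>(1 - a)\<^sup>2\<close>. Self-adjointness moves
\<open>a\<close> to the other factor and turns these two kernels into annihilators, \<open>U\<close> and \<open>V\<close> below. In this
form they are ideals at once, also for a map \<open>a\<close> composed of chosen components, which is additive only
modulo the radical.\<close>

lemma (in cring) almost_idempotent_splitting:
  assumes N: "ideal N R" and M: "ideal M R" and MN: "M \<subseteq> N"
    and aM: "\<And>x. x \<in> N \<Longrightarrow> a x \<in> M"
    and adj: "\<And>x y. x \<in> N \<Longrightarrow> y \<in> N \<Longrightarrow> a x \<otimes> y = x \<otimes> a y"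
    and nil: "\<And>x y. x \<in> N \<Longrightarrow> y \<in> N \<Longrightarrow> (a (a x) \<ominus> a x) \<otimes> (a (a y) \<ominus> a y) = \<zero>"
    and ind: "orthogonally_indecomposable R N M"
  shows "(\<forall>x\<in>M. \<forall>z\<in>N. x \<otimes> a (a z) = \<zero>) \<or>
    (\<forall>x\<in>M. \<forall>z\<in>N. x \<otimes> (z \<ominus> a z \<ominus> a z \<oplus> a (a z)) = \<zero>)"
proof -
  interpret N: ideal N R by fact
  interpret M: ideal M R by fact
  have aN[simp, intro]: "a x \<in> N" if "x \<in> N" for x using aM MN that by auto
  have aC[simp, intro]: "a x \<in> carrier R" if "x \<in> N" for x using aN that by (simp add: N.Icarr)
  have NC[simp, intro]: "x \<in> carrier R" if "x \<in> N" for x using that by (rule N.Icarr)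
  have MC: "x \<in> carrier R" if "x \<in> M" for x using that by (rule M.Icarr)
  define U where "U = {x \<in> M. \<forall>z\<in>N. x \<otimes> a (a z) = \<zero>}"
  define V where "V = {x \<in> M. \<forall>z\<in>N. x \<otimes> (z \<ominus> a z \<ominus> a z \<oplus> a (a z)) = \<zero>}"
  have idU: "ideal U R" unfolding U_def by (rule annihilated_ideal) (use M in auto)
  have idV: "ideal V R" unfolding V_def by (rule annihilated_ideal) (use M in auto)
  have cs: "z \<in> carrier R" "a z \<in> carrier R" "a (a z) \<in> carrier R" "a (a (a z)) \<in> carrier R"
    "a (a (a (a z))) \<in> carrier R" "a (a (a (a (a z)))) \<in> carrier R" if "z \<in> N" for z
    using that by auto
  (* D x z is x times a^2(1 - a) z. The hypothesis on a^2 - a says that D x z does not change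
     when a is applied once more to z; the computations below use only this. *)
  define D where "D x z = x \<otimes> a (a z) \<ominus> x \<otimes> a (a (a z))" for x z
  have DC[simp]: "D x z \<in> carrier R" if "x \<in> N" "z \<in> N" for x z using that by (simp add: D_def)
  have D_shift: "D x (a z) = D x z" if x: "x \<in> N" and z: "z \<in> N" for x z
  proof -
    note c = cs[OF x] cs[OF z]
    have "\<zero> = (a (a x) \<ominus> a x) \<otimes> (a (a z) \<ominus> a z)" using nil x z by simp
    also have "\<dots> = a (a x) \<otimes> a (a z) \<ominus> a (a x) \<otimes> a z \<ominus> a x \<otimes> a (a z) \<oplus> a x \<otimes> a z"
      using c by algebra
    also have "\<dots> = x \<otimes> a (a (a (a z))) \<ominus> x \<otimes> a (a (a z)) \<ominus> x \<otimes> a (a (a z)) \<oplus> x \<otimes> a (a z)"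
      using x z by (simp add: adj)
    also have "\<dots> = D x z \<ominus> D x (a z)" unfolding D_def using c by algebra
    finally have "D x z \<ominus> D x (a z) = \<zero>" by simp
    then show ?thesis using x z by (metis DC aN diff_eq_zero_iff)
  qed
  have step: "x \<otimes> a (a z) = x \<otimes> a (a (a z)) \<oplus> D x z" if x: "x \<in> N" and z: "z \<in> N" for x z
    unfolding D_def using cs[OF x] cs[OF z] by algebra
  have orth: "x \<otimes> y = \<zero>" if x: "x \<in> U" and y: "y \<in> V" for x y
  proof -
    have xM: "x \<in> M" "x \<in> N" and yM: "y \<in> M" "y \<in> N" using x y MN by (auto simp: U_def V_def)
    have u: "x \<otimes> a (a z) = \<zero>" if "z \<in> N" for z using x that by (simp add: U_def)
    have v: "y \<otimes> (z \<ominus> a z \<ominus> a z \<oplus> a (a z)) = \<zero>" if "z \<in> N" for z using y that by (simp add: V_def)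
    (* Here x annihilates a^2 y and a^3 y. The condition on y, taken at z = a x, then leaves
       y (a x) = 0, and taken at z = x it leaves y x = 0. *)
    have 0: "y \<otimes> x \<ominus> y \<otimes> a x \<ominus> y \<otimes> a x \<oplus> y \<otimes> a (a x) = \<zero>"
      using v[OF xM(2)] cs[OF xM(2)] cs[OF yM(2)] by algebra
    have 1: "y \<otimes> a x \<ominus> y \<otimes> a (a x) \<ominus> y \<otimes> a (a x) \<oplus> y \<otimes> a (a (a x)) = \<zero>"
      using v[of "a x"] cs[OF xM(2)] cs[OF yM(2)] xM by (simp add: r_distr r_minus minus_eq a_ac)
    have 2: "y \<otimes> a (a x) = \<zero>" "y \<otimes> a (a (a x)) = \<zero>"
      using u[OF yM(2)] u[of "a y"] xM yM by (auto simp: adj m_comm[of y])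
    have 3: "y \<otimes> a x = \<zero>" using 1 2 xM yM by (simp add: minus_eq)
    have "y \<otimes> x = \<zero>" using 0 2 3 xM yM by (simp add: minus_eq)
    then show ?thesis using xM yM by (simp add: m_comm)
  qed
  have sum: "\<exists>u\<in>U. \<exists>v\<in>V. x = u \<oplus> v" if x: "x \<in> M" for x
  proof -
    have xN: "x \<in> N" using x MN by auto
    (* v is (3a^2 - 2a^3) x, the component of x in V. *)
    define v where "v = a (a x) \<oplus> (a (a x) \<ominus> a (a (a x))) \<oplus> (a (a x) \<ominus> a (a (a x)))"
    have vM: "v \<in> M" unfolding v_def using xN by (auto intro!: M.diff_closed aM)
    have vN: "v \<in> N" using vM MN by auto
    have av: "v \<otimes> z = x \<otimes> a (a z) \<oplus> D x z \<oplus> D x z" if z: "z \<in> N" for z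
    proof -
      have "v \<otimes> z = a (a x) \<otimes> z \<oplus> (a (a x) \<otimes> z \<ominus> a (a (a x)) \<otimes> z)
          \<oplus> (a (a x) \<otimes> z \<ominus> a (a (a x)) \<otimes> z)"
        unfolding v_def using cs[OF xN] cs[OF z] by algebra
      then show ?thesis using xN z by (simp add: adj D_def)
    qed
    have 1: "x \<ominus> v \<in> U"
    proof -
      have "(x \<ominus> v) \<otimes> a (a z) = \<zero>" if z: "z \<in> N" for z
      proof -
        have "(x \<ominus> v) \<otimes> a (a z) = x \<otimes> a (a z) \<ominus> v \<otimes> a (a z)"
          using cs[OF xN] cs[OF vN] cs[OF z] by algebra
        also have "v \<otimes> a (a z) = x \<otimes> a (a z)"
          using xN z by (simp add: av D_shift step[of x z] step[of x "a z"] a_assoc)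
        finally show ?thesis using xN z by (simp add: minus_eq r_neg)
      qed
      then show ?thesis using x vM by (auto simp: U_def intro: M.diff_closed)
    qed
    have 2: "v \<in> V"
    proof -
      have "v \<otimes> (z \<ominus> a z \<ominus> a z \<oplus> a (a z)) = \<zero>" if z: "z \<in> N" for z
      proof -
        have d: "D x z \<in> carrier R" using xN z by simp
        have "v \<otimes> (z \<ominus> a z \<ominus> a z \<oplus> a (a z)) = v \<otimes> z \<ominus> v \<otimes> a z \<ominus> v \<otimes> a z \<oplus> v \<otimes> a (a z)"
          using cs[OF vN] cs[OF z] by algebra
        also have "\<dots> = (x \<otimes> a (a z) \<oplus> D x z \<oplus> D x z) \<ominus> (x \<otimes> a (a (a z)) \<oplus> D x z \<oplus> D x z)
            \<ominus> (x \<otimes> a (a (a z)) \<oplus> D x z \<oplus> D x z) \<oplus> (x \<otimes> a (a (a (a z))) \<oplus> D x z \<oplus> D x z)"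
          using xN z by (simp add: av D_shift)
        also have "\<dots> = (x \<otimes> a (a z) \<ominus> x \<otimes> a (a (a z))) \<ominus> (x \<otimes> a (a (a z)) \<ominus> x \<otimes> a (a (a (a z))))"
          using cs[OF xN] cs[OF z] d by algebra
        also have "\<dots> = D x z \<ominus> D x (a z)" by (simp add: D_def)
        also have "\<dots> = \<zero>" using D_shift[OF xN z] d by (simp add: minus_eq r_neg)
        finally show ?thesis .
      qed
      then show ?thesis using vM by (auto simp: V_def)
    qed
    have "x = (x \<ominus> v) \<oplus> v" using cs[OF xN] cs[OF vN] by algebra
    then show ?thesis using 1 2 by blast
  qed
  have "U \<subseteq> self_annihilator R N \<or> V \<subseteq> self_annihilator R N"
    using ind idU idV
  proof (rule orthogonally_indecomposableD)
    show "U \<subseteq> M" "V \<subseteq> M" by (auto simp: U_def V_def)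
  qed (use orth sum in auto)
  then show ?thesis
  proof
    assume a: "U \<subseteq> self_annihilator R N"
    have "x \<otimes> (z \<ominus> a z \<ominus> a z \<oplus> a (a z)) = \<zero>" if x: "x \<in> M" and z: "z \<in> N" for x z
    proof -
      obtain u v where uv: "u \<in> U" "v \<in> V" "x = u \<oplus> v" using sum x by blast
      have c: "u \<in> carrier R" "v \<in> carrier R" using uv MC by (auto simp: U_def V_def)
      have "z \<ominus> a z \<ominus> a z \<oplus> a (a z) \<in> N" using z by (auto intro!: N.diff_closed)
      then have "u \<otimes> (z \<ominus> a z \<ominus> a z \<oplus> a (a z)) = \<zero>"
        using a uv(1) unfolding self_annihilator_def by blast
      moreover have "v \<otimes> (z \<ominus> a z \<ominus> a z \<oplus> a (a z)) = \<zero>" using uv(2) z by (simp add: V_def)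
      ultimately show ?thesis using uv(3) c z by (simp add: l_distr)
    qed
    then show ?thesis by blast
  next
    assume a: "V \<subseteq> self_annihilator R N"
    have "x \<otimes> a (a z) = \<zero>" if x: "x \<in> M" and z: "z \<in> N" for x z
    proof -
      obtain u v where uv: "u \<in> U" "v \<in> V" "x = u \<oplus> v" using sum x by blast
      have c: "u \<in> carrier R" "v \<in> carrier R" using uv MC by (auto simp: U_def V_def)
      have "v \<otimes> a (a z) = \<zero>" using a uv(2) z unfolding self_annihilator_def by blast
      moreover have "u \<otimes> a (a z) = \<zero>" using uv(1) z by (simp add: U_def)
      ultimately show ?thesis using uv(3) c z by (simp add: l_distr)
    qed
    then show ?thesis by blast
  qed
qed


text \<open>The sum is direct only modulo the radical of \<open>N\<close>, which may lie in every part. So the components of an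
element are not unique, and \<open>part\<close> chooses one family of them; only their products with elements of
\<open>N\<close> matter.\<close>

locale orthogonal_sum = cring Q for Q (structure) +
  fixes N :: "'q set" and I :: "'i set" and M :: "'i \<Rightarrow> 'q set"
  assumes total_ideal: "ideal N Q"
    and finite_index: "finite I"
    and part_ideal: "i \<in> I \<Longrightarrow> ideal (M i) Q"
    and part_le: "i \<in> I \<Longrightarrow> M i \<subseteq> N"
    and part_orthogonal:
      "\<lbrakk>i \<in> I; j \<in> I; i \<noteq> j; x \<in> M i; y \<in> M j\<rbrakk> \<Longrightarrow> x \<otimes> y = \<zero>"
    and part_span: "x \<in> N \<Longrightarrow> \<exists>m. (\<forall>i\<in>I. m i \<in> M i) \<and> x = finsum Q m I"
begin

definition part :: "'i \<Rightarrow> 'q \<Rightarrow> 'q"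
  where "part i x = (SOME m. (\<forall>i\<in>I. m i \<in> M i) \<and> x = finsum Q m I) i"

lemma total_carrier: "x \<in> N \<Longrightarrow> x \<in> carrier Q"
  using total_ideal by (rule ideal.Icarr)

lemma part_carrier: "\<lbrakk>i \<in> I; x \<in> M i\<rbrakk> \<Longrightarrow> x \<in> carrier Q"
  using part_ideal ideal.Icarr by metis

lemma part_sum: "x \<in> N \<Longrightarrow> x = finsum Q (\<lambda>i. part i x) I"
  and part_mem: "\<lbrakk>x \<in> N; i \<in> I\<rbrakk> \<Longrightarrow> part i x \<in> M i"
  using someI_ex[OF part_span, of x] unfolding part_def by simp_all

lemma part_mem_total: "\<lbrakk>x \<in> N; i \<in> I\<rbrakk> \<Longrightarrow> part i x \<in> N"
  using part_mem part_le by blast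

lemma part_closed [simp]: "\<lbrakk>x \<in> N; i \<in> I\<rbrakk> \<Longrightarrow> part i x \<in> carrier Q"
  using part_mem_total total_carrier by blast

lemma total_mult: "\<lbrakk>x \<in> N; y \<in> carrier Q\<rbrakk> \<Longrightarrow> x \<otimes> y \<in> N"
  using total_ideal by (simp add: ideal.I_r_closed)

text \<open>The other components of \<open>x\<close> are orthogonal to \<open>M i\<close>.\<close>

lemma part_mult:
  assumes x: "x \<in> N" and i: "i \<in> I" and y: "y \<in> M i"
  shows "part i x \<otimes> y = x \<otimes> y"
proof -
  have yc: "y \<in> carrier Q" using part_carrier i y .
  have "x \<otimes> y = finsum Q (\<lambda>j. part j x) I \<otimes> y" using part_sum[OF x] by simp
  also have "\<dots> = finsum Q (\<lambda>j. part j x \<otimes> y) I"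
    by (rule finsum_ldistr[OF finite_index yc]) (use x in auto)
  also have "\<dots> = finsum Q (\<lambda>j. if i = j then part j x \<otimes> y else \<zero>) I"
    by (rule finsum_cong) (use x y i yc in \<open>auto intro: part_orthogonal part_mem simp: simp_implies_def\<close>)
  also have "\<dots> = part i x \<otimes> y"
    by (rule finsum_singleton) (use x i yc finite_index in auto)
  finally show ?thesis by simp
qed

text \<open>Both sides equal \<open>part i x \<otimes> part i y\<close>.\<close>

lemma part_adjoint:
  assumes "x \<in> N" "y \<in> N" "i \<in> I"
  shows "part i x \<otimes> y = x \<otimes> part i y"
  using part_mult[of x i "part i y"] part_mult[of y i "part i x"] assms
  by (simp add: part_mem m_comm total_carrier)

lemma part_mult_self:
  assumes "x \<in> M i" "y \<in> N" "i \<in> I"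
  shows "part i x \<otimes> y = x \<otimes> y"
proof -
  have xN: "x \<in> N" using assms part_le by blast
  have "part i x \<otimes> y = x \<otimes> part i y" using part_adjoint xN assms by simp
  also have "\<dots> = part i y \<otimes> x" using assms xN by (simp add: m_comm total_carrier)
  also have "\<dots> = y \<otimes> x" using part_mult assms by simp
  finally show ?thesis using assms xN by (simp add: m_comm total_carrier)
qed

lemma self_annihilatorI:
  assumes "x \<in> N" "\<And>i y. i \<in> I \<Longrightarrow> y \<in> M i \<Longrightarrow> x \<otimes> y = \<zero>"
  shows "x \<in> self_annihilator Q N"
proof -
  have "x \<otimes> y = \<zero>" if y: "y \<in> N" for y
  proof -
    have "x \<otimes> y = x \<otimes> finsum Q (\<lambda>i. part i y) I" using part_sum[OF y] by simp
    also have "\<dots> = finsum Q (\<lambda>i. x \<otimes> part i y) I"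
      by (rule finsum_rdistr[OF finite_index]) (use assms y total_carrier in auto)
    also have "\<dots> = finsum Q (\<lambda>i. \<zero>) I"
      by (rule finsum_cong) (use assms y part_mem in \<open>auto simp: simp_implies_def\<close>)
    finally show ?thesis by simp
  qed
  then show ?thesis using assms(1) by (simp add: self_annihilator_def)
qed

end

text \<open>The properties of the ideals that come from indecomposable Gorenstein summands of Loewy length at
least 3. The last condition says that the radical is one-dimensional.\<close>

locale rigid_orthogonal_sum = orthogonal_sum +
  assumes part_indecomposable: "i \<in> I \<Longrightarrow> orthogonally_indecomposable Q N (M i)"
    and part_cube: "i \<in> I \<Longrightarrow> \<exists>x\<in>M i. \<exists>y\<in>M i. \<exists>z\<in>M i. x \<otimes> y \<otimes> z \<noteq> \<zero>"
    and annihilator_le: "i \<in> I \<Longrightarrow> self_annihilator Q N \<subseteq> M i"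
    and annihilator_line:
      "\<lbrakk>z \<in> self_annihilator Q N; z \<noteq> \<zero>; w \<in> self_annihilator Q N\<rbrakk> \<Longrightarrow> \<exists>r\<in>carrier Q. w = r \<otimes> z"
begin

text \<open>The condition \<open>split\<close> provides an orthogonal complement of \<open>U\<close> in \<open>M i\<close>, namely the annihilator \<open>V\<close> of
\<open>U\<close>. If \<open>V\<close> were in the radical, then \<open>M i\<close> would differ from \<open>U\<close> only by the radical and its cube
would be zero, like that of \<open>U\<close>. So \<open>U\<close> is in the radical.\<close>

lemma no_split_ideal:
  assumes i: "i \<in> I" and U: "ideal U Q" "U \<subseteq> M i"
    and U3: "\<And>u y z. u \<in> U \<Longrightarrow> y \<in> N \<Longrightarrow> z \<in> N \<Longrightarrow> u \<otimes> y \<otimes> z = \<zero>"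
    and split: "\<And>x. x \<in> M i \<Longrightarrow> \<exists>u\<in>U. \<forall>t\<in>U. (x \<ominus> u) \<otimes> t = \<zero>"
    and u: "u \<in> U" "v \<in> U"
  shows "u \<otimes> v = \<zero>"
proof -
  interpret Mi: ideal "M i" Q using part_ideal i .
  define V where "V = {x \<in> M i. \<forall>z\<in>U. x \<otimes> z = \<zero>}"
  have idV: "ideal V Q"
    unfolding V_def by (rule annihilated_ideal[where g = "\<lambda>x. x"]) (use U in \<open>auto intro: part_ideal[OF i] ideal.Icarr\<close>)
  have sum: "\<exists>u\<in>U. \<exists>v\<in>V. x = u \<oplus> v" if x: "x \<in> M i" for x
  proof -
    obtain t where t: "t \<in> U" "\<forall>s\<in>U. (x \<ominus> t) \<otimes> s = \<zero>" using split[OF x] by blast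
    have c: "x \<in> carrier Q" "t \<in> carrier Q" using x t U by auto
    have "x = t \<oplus> (x \<ominus> t)" using c by algebra
    moreover have "x \<ominus> t \<in> V" unfolding V_def using x t U by (auto intro: Mi.diff_closed)
    ultimately show ?thesis using t by blast
  qed
  have "U \<subseteq> self_annihilator Q N \<or> V \<subseteq> self_annihilator Q N"
    using part_indecomposable[OF i] U(1) idV U(2)
  proof (rule orthogonally_indecomposableD)
    show "V \<subseteq> M i" by (auto simp: V_def)
    show "t \<otimes> s = \<zero>" if "t \<in> U" "s \<in> V" for t s
      using that U Mi.Icarr m_comm[of t s] by (auto simp: V_def)
  qed (use sum in auto)
  then consider "U \<subseteq> self_annihilator Q N" | "V \<subseteq> self_annihilator Q N" by blast
  then show ?thesis
  proof cases
    case 1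
    then show ?thesis using u U part_le[OF i] by (auto simp: self_annihilator_def)
  next
    case 2
    have "x \<otimes> y \<otimes> z = \<zero>" if xyz: "x \<in> M i" "y \<in> M i" "z \<in> M i" for x y z
    proof -
      obtain t s where ts: "t \<in> U" "s \<in> V" "x = t \<oplus> s" using sum xyz(1) by blast
      have N: "y \<in> N" "z \<in> N" using xyz part_le[OF i] by auto
      have c: "t \<in> carrier Q" "s \<in> carrier Q" "y \<in> carrier Q" "z \<in> carrier Q"
        using ts U xyz by (auto simp: V_def)
      have "s \<otimes> y = \<zero>" using 2 ts N by (auto simp: self_annihilator_def)
      then show ?thesis using ts(3) c U3[OF ts(1) N] by (simp add: l_distr)
    qed
    then show ?thesis using part_cube[OF i] by blast
  qed
qed

text \<open>The products of such elements with \<open>M i\<close> lie in the radical, which is one-dimensional. So a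
nonzero square \<open>u u\<close>, or a nonzero product \<open>u v\<close> with \<open>u u = v v = 0\<close>, allows orthogonal
projection onto \<open>Q u\<close>, or onto \<open>Q u + Q v\<close>, as for a vector that is not isotropic, or for a
hyperbolic plane. The resulting complement contradicts \<open>no_split_ideal\<close>. Treating squares separately
makes the argument work in characteristic 2.\<close>

lemma square_annihilator_products:
  assumes i: "i \<in> I"
    and u: "u \<in> M i" "\<And>y z. y \<in> M i \<Longrightarrow> z \<in> M i \<Longrightarrow> u \<otimes> y \<otimes> z = \<zero>"
    and v: "v \<in> M i" "\<And>y z. y \<in> M i \<Longrightarrow> z \<in> M i \<Longrightarrow> v \<otimes> y \<otimes> z = \<zero>"
  shows "u \<otimes> v = \<zero>"
proof -
  interpret Mi: ideal "M i" Q using part_ideal i .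
  interpret N: ideal N Q using total_ideal .
  let ?W = "{u \<in> M i. \<forall>y\<in>M i. \<forall>z\<in>M i. u \<otimes> y \<otimes> z = \<zero>}"
  have MN: "x \<in> N" if "x \<in> M i" for x using that part_le[OF i] by blast
  have W3: "u \<otimes> y \<otimes> z = \<zero>" if "u \<in> ?W" "y \<in> N" "z \<in> N" for u y z
  proof -
    have c: "u \<in> carrier Q" "y \<in> carrier Q" "z \<in> carrier Q" "part i y \<in> carrier Q"
      using that i by (auto intro: N.Icarr)
    have "u \<otimes> y \<otimes> z = (u \<otimes> part i y) \<otimes> z"
      using part_mult[of y i u] that i c by (simp add: m_comm)
    also have "\<dots> = z \<otimes> (u \<otimes> part i y)" using c by (simp add: m_comm)
    also have "\<dots> = part i z \<otimes> (u \<otimes> part i y)"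
      using part_mult[of z i "u \<otimes> part i y"] that i c by (simp add: Mi.I_r_closed)
    also have "\<dots> = (u \<otimes> part i y) \<otimes> part i z" using that c i by (simp add: m_comm)
    also have "\<dots> = \<zero>" using that i part_mem[of y i] part_mem[of z i] by blast
    finally show ?thesis .
  qed
  have WZ: "x \<otimes> w \<in> self_annihilator Q N" if "x \<in> M i" "w \<in> ?W" for x w
  proof -
    have c: "x \<in> carrier Q" "w \<in> carrier Q" using that by auto
    have "x \<otimes> w \<otimes> z = \<zero>" if "z \<in> N" for z
      using W3[of w x z] \<open>x \<in> M i\<close> \<open>w \<in> ?W\<close> that MN c by (simp add: m_comm)
    moreover have "x \<otimes> w \<in> N" using that c MN by (simp add: N.I_r_closed)
    ultimately show ?thesis by (simp add: self_annihilator_def)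
  qed
  have W0: "w \<otimes> s \<otimes> y \<otimes> z = \<zero>" if "w \<in> ?W" "s \<in> carrier Q" "y \<in> N" "z \<in> N" for w s y z
  proof -
    have c: "w \<in> carrier Q" "y \<in> carrier Q" "z \<in> carrier Q" using that by (auto intro: N.Icarr)
    have "w \<otimes> s \<otimes> y \<otimes> z = s \<otimes> (w \<otimes> y \<otimes> z)" using c that(2) by (simp add: m_ac)
    then show ?thesis using W3[of w y z] that by simp
  qed
  have square: "w \<otimes> w = \<zero>" if w: "w \<in> ?W" for w
  proof (rule ccontr)
    assume nz: "w \<otimes> w \<noteq> \<zero>"
    let ?U = "{a \<otimes> w | a. a \<in> carrier Q}"
    have wc: "w \<in> carrier Q" using w by auto
    have idU: "ideal ?U Q"
    proof (rule commutative_idealI)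
      show "?U \<subseteq> carrier Q" using wc by auto
      show "\<zero> \<in> ?U" using wc by (auto intro!: exI[of _ \<zero>])
      show "x \<oplus> y \<in> ?U" if "x \<in> ?U" "y \<in> ?U" for x y
        using that wc by (auto simp: l_distr[symmetric])
      show "r \<otimes> x \<in> ?U" if "r \<in> carrier Q" "x \<in> ?U" for r x
        using that wc by (auto simp: m_assoc[symmetric])
    qed
    have "w \<otimes> w = \<zero>"
    proof (rule no_split_ideal[OF i idU])
      show "?U \<subseteq> M i" using w by (auto intro: Mi.I_l_closed)
      show "x \<otimes> y \<otimes> z = \<zero>" if "x \<in> ?U" "y \<in> N" "z \<in> N" for x y z
        using that W0[OF w] wc by (auto simp: m_comm[of _ w])
      show "\<exists>s\<in>?U. \<forall>t\<in>?U. (x \<ominus> s) \<otimes> t = \<zero>" if x: "x \<in> M i" for x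
      proof -
        (* r w is the orthogonal projection of x to Q w. *)
        obtain r where r: "r \<in> carrier Q" "x \<otimes> w = r \<otimes> (w \<otimes> w)"
          using annihilator_line[OF WZ[OF _ w] nz WZ[OF x w], of] w by blast
        have xc: "x \<in> carrier Q" using x by auto
        have "(x \<ominus> r \<otimes> w) \<otimes> (a \<otimes> w) = \<zero>" if a: "a \<in> carrier Q" for a
        proof -
          have "(x \<ominus> r \<otimes> w) \<otimes> (a \<otimes> w) = a \<otimes> (x \<otimes> w \<ominus> r \<otimes> (w \<otimes> w))"
            using r(1) a wc xc by algebra
          then show ?thesis using r a wc by (simp add: r_neg minus_eq)
        qed
        then show ?thesis using r(1) by blast
      qed
      show "w \<in> ?U" "w \<in> ?U" using wc by (auto intro!: exI[of _ \<one>])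
    qed
    then show False using nz by simp
  qed
  have uW: "u \<in> ?W" and vW: "v \<in> ?W" using u v by auto
  have uc: "u \<in> carrier Q" and vc: "v \<in> carrier Q" using u v by auto
  show ?thesis
  proof (rule ccontr)
    assume nz: "u \<otimes> v \<noteq> \<zero>"
    let ?U = "{a \<otimes> u \<oplus> b \<otimes> v | a b. a \<in> carrier Q \<and> b \<in> carrier Q}"
    have idU: "ideal ?U Q"
    proof (rule commutative_idealI)
      show "?U \<subseteq> carrier Q" using uc vc by auto
      show "\<zero> \<in> ?U" using uc vc by (auto intro!: exI[of _ \<zero>])
      show "x \<oplus> y \<in> ?U" if xy: "x \<in> ?U" "y \<in> ?U" for x y
      proof -
        obtain a b a' b' where ab: "a \<in> carrier Q" "b \<in> carrier Q" "a' \<in> carrier Q" "b' \<in> carrier Q"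
          "x = a \<otimes> u \<oplus> b \<otimes> v" "y = a' \<otimes> u \<oplus> b' \<otimes> v" using xy by blast
        then have "x \<oplus> y = (a \<oplus> a') \<otimes> u \<oplus> (b \<oplus> b') \<otimes> v" using uc vc by algebra
        then show ?thesis using ab by blast
      qed
      show "r \<otimes> x \<in> ?U" if rx: "r \<in> carrier Q" "x \<in> ?U" for r x
      proof -
        obtain a b where ab: "a \<in> carrier Q" "b \<in> carrier Q" "x = a \<otimes> u \<oplus> b \<otimes> v" using rx by blast
        then have "r \<otimes> x = (r \<otimes> a) \<otimes> u \<oplus> (r \<otimes> b) \<otimes> v" using uc vc rx(1) by algebra
        then show ?thesis using ab rx by blast
      qed
    qed
    have "u \<otimes> v = \<zero>"
    proof (rule no_split_ideal[OF i idU])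
      show "?U \<subseteq> M i" using u v by (auto intro!: Mi.a_closed Mi.I_l_closed)
      show "x \<otimes> y \<otimes> z = \<zero>" if xyz: "x \<in> ?U" "y \<in> N" "z \<in> N" for x y z
      proof -
        obtain a b where ab: "a \<in> carrier Q" "b \<in> carrier Q" "x = a \<otimes> u \<oplus> b \<otimes> v" using xyz by blast
        have yz: "y \<in> carrier Q" "z \<in> carrier Q" using xyz by (auto intro: N.Icarr)
        have "x \<otimes> y \<otimes> z = a \<otimes> (u \<otimes> y \<otimes> z) \<oplus> b \<otimes> (v \<otimes> y \<otimes> z)"
          unfolding ab(3) using ab(1,2) yz uc vc by algebra
        then show ?thesis using W3[OF uW] W3[OF vW] xyz ab by simp
      qed
      show "\<exists>s\<in>?U. \<forall>t\<in>?U. (x \<ominus> s) \<otimes> t = \<zero>" if x: "x \<in> M i" for x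
      proof -
        (* Because u u = v v = 0, the coefficient of u is read off from x v and that of v from x u. *)
        have uvZ: "u \<otimes> v \<in> self_annihilator Q N" using WZ u(1) vW by blast
        obtain r where r: "r \<in> carrier Q" "x \<otimes> u = r \<otimes> (u \<otimes> v)"
          using annihilator_line[OF uvZ nz WZ[OF x uW]] by blast
        obtain s where s: "s \<in> carrier Q" "x \<otimes> v = s \<otimes> (u \<otimes> v)"
          using annihilator_line[OF uvZ nz WZ[OF x vW]] by blast
        have xc: "x \<in> carrier Q" using x by auto
        have uu: "u \<otimes> u = \<zero>" and vv: "v \<otimes> v = \<zero>" using square uW vW by blast+
        have "(x \<ominus> (s \<otimes> u \<oplus> r \<otimes> v)) \<otimes> (a \<otimes> u \<oplus> b \<otimes> v) = \<zero>"
          if ab: "a \<in> carrier Q" "b \<in> carrier Q" for a b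
        proof -
          have "(x \<ominus> (s \<otimes> u \<oplus> r \<otimes> v)) \<otimes> (a \<otimes> u \<oplus> b \<otimes> v) =
              a \<otimes> (x \<otimes> u \<ominus> r \<otimes> (u \<otimes> v)) \<oplus> b \<otimes> (x \<otimes> v \<ominus> s \<otimes> (u \<otimes> v))
              \<ominus> a \<otimes> s \<otimes> (u \<otimes> u) \<ominus> b \<otimes> r \<otimes> (v \<otimes> v)"
            using r(1) s(1) ab uc vc xc by algebra
          then show ?thesis using r s ab uc vc uu vv by (simp add: r_neg minus_eq)
        qed
        then show ?thesis using r(1) s(1) by blast
      qed
      have "u = \<one> \<otimes> u \<oplus> \<zero> \<otimes> v" "v = \<zero> \<otimes> u \<oplus> \<one> \<otimes> v" using uc vc by simp_all
      then show "u \<in> ?U" "v \<in> ?U" by blast+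
    qed
    then show False using nz by simp
  qed
qed

end

section \<open>Matching two orthogonal sums\<close>

locale two_orthogonal_sums =
  A: rigid_orthogonal_sum Q N I M + B: rigid_orthogonal_sum Q N J L
  for Q (structure) and N :: "'q set" and I :: "'i set" and M :: "'i \<Rightarrow> 'q set"
    and J :: "'j set" and L :: "'j \<Rightarrow> 'q set"
begin

lemma swapped: "two_orthogonal_sums Q N J L I M"
  by unfold_locales

text \<open>Let \<open>e\<close> and \<open>f\<close> be the projections to \<open>M i\<close> and \<open>L j\<close>, and let \<open>a = e f e\<close>. Moving the projections
between the factors of a product shows that both \<open>a\<close> and \<open>a\<^sup>2\<close> act on triple products from \<open>M i\<close> by
applying \<open>f\<close> to one factor (\<open>shift\<close>, \<open>shift2\<close>). So the values \<open>c\<close> of \<open>a\<^sup>2 - a\<close> annihilate the square of \<open>M i\<close> and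
have products zero, and \<open>almost_idempotent_splitting\<close> leaves the two cases \<open>a\<^sup>2 = 0\<close> and
\<open>(1 - a)\<^sup>2 = 0\<close>.\<close>

lemma square_dichotomy:
  assumes i: "i \<in> I" and j: "j \<in> J"
  shows "(\<forall>x\<in>M i. \<forall>y\<in>M i. \<forall>z\<in>N. x \<otimes> y \<otimes> B.part j z = \<zero>) \<or>
    (\<forall>x\<in>M i. \<forall>y\<in>M i. \<forall>z\<in>N. x \<otimes> y \<otimes> z = x \<otimes> y \<otimes> B.part j z)"
proof -
  interpret N: ideal N Q using A.total_ideal .
  interpret Mi: ideal "M i" Q using A.part_ideal i .
  define e where "e = A.part i"
  define f where "f = B.part j"
  define a where "a = (\<lambda>x. e (f (e x)))"
  have eM: "e x \<in> M i" and fL: "f x \<in> L j" and eN: "e x \<in> N" and fN: "f x \<in> N" if "x \<in> N" for x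
    using that i j A.part_mem B.part_mem A.part_mem_total B.part_mem_total by (auto simp: e_def f_def)
  have aN: "a x \<in> N" and aM: "a x \<in> M i" if "x \<in> N" for x using that eN fN eM by (auto simp: a_def)
  have NC: "x \<in> carrier Q" if "x \<in> N" for x using that by (rule N.Icarr)
  have MN: "x \<in> N" if "x \<in> M i" for x using that A.part_le[OF i] by auto
  have Nm: "x \<otimes> y \<in> N" if "x \<in> N" "y \<in> N" for x y using that NC by (simp add: N.I_r_closed)
  have eadj: "e x \<otimes> y = x \<otimes> e y" if "x \<in> N" "y \<in> N" for x y
    using that i by (simp add: e_def A.part_adjoint)
  have fadj: "f x \<otimes> y = x \<otimes> f y" if "x \<in> N" "y \<in> N" for x y
    using that j by (simp add: f_def B.part_adjoint)
  have adj: "a x \<otimes> y = x \<otimes> a y" if "x \<in> N" "y \<in> N" for x y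
    using that by (simp add: a_def eadj fadj eN fN)
  have eself: "e y \<otimes> z = y \<otimes> z" if "y \<in> M i" "z \<in> N" for y z
    using that i by (simp add: e_def A.part_mult_self)
  have fself: "f (f y) \<otimes> z = f y \<otimes> z" if "y \<in> N" "z \<in> N" for y z
    using that j B.part_mult_self[of "f y" j z] fL by (simp add: f_def)
  have shift: "a x \<otimes> y \<otimes> z = x \<otimes> y \<otimes> f z" if x: "x \<in> N" and y: "y \<in> M i" and z: "z \<in> N" for x y z
  proof -
    have yN: "y \<in> N" using y MN by simp
    note c = NC[OF x] NC[OF yN] NC[OF z] NC[OF eN[OF x]] NC[OF fN[OF eN[OF x]]] NC[OF fN[OF z]]
      NC[OF eN[OF yN]]
    have "a x \<otimes> y = f (e x) \<otimes> e y" unfolding a_def using eadj x yN eN fN by simp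
    also have "\<dots> = f (e x) \<otimes> y" using eself[OF y fN[OF eN[OF x]]] c by (simp add: A.m_comm)
    finally have "a x \<otimes> y \<otimes> z = (f (e x) \<otimes> z) \<otimes> y" using c by (simp add: A.m_ac)
    also have "\<dots> = (e x \<otimes> f z) \<otimes> y" using fadj x z eN by simp
    also have "\<dots> = (e x \<otimes> y) \<otimes> f z" using c by (simp add: A.m_ac)
    also have "\<dots> = (x \<otimes> e y) \<otimes> f z" using eadj x yN by simp
    also have "\<dots> = (e y \<otimes> f z) \<otimes> x" using c by (simp add: A.m_ac)
    also have "\<dots> = (y \<otimes> f z) \<otimes> x" using eself[OF y fN[OF z]] by simp
    finally show ?thesis using c by (simp add: A.m_ac)
  qed
  have shift2: "a (a x) \<otimes> y \<otimes> z = x \<otimes> y \<otimes> f z" if x: "x \<in> N" and y: "y \<in> M i" and z: "z \<in> N" for x y z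
  proof -
    have yN: "y \<in> N" using y MN by simp
    have "a (a x) \<otimes> y \<otimes> z = x \<otimes> y \<otimes> f (f z)" using shift x y z aN fN by simp
    also have "\<dots> = f (f z) \<otimes> (x \<otimes> y)" using NC[OF x] NC[OF yN] NC[OF fN[OF fN[OF z]]] by (simp add: A.m_ac)
    also have "\<dots> = f z \<otimes> (x \<otimes> y)" using fself z Nm x yN by simp
    finally show ?thesis using NC[OF x] NC[OF yN] NC[OF fN[OF z]] by (simp add: A.m_ac)
  qed
  define c where "c = (\<lambda>x. a (a x) \<ominus> a x)"
  have cM: "c x \<in> M i" if "x \<in> N" for x using that aN aM by (auto simp: c_def intro: Mi.diff_closed)
  have c3: "c x \<otimes> y \<otimes> z = \<zero>" if x: "x \<in> N" and y: "y \<in> M i" and z: "z \<in> M i" for x y z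
  proof -
    have yN: "y \<in> N" and zN: "z \<in> N" using y z MN by auto
    note cs = NC[OF aN[OF x]] NC[OF aN[OF aN[OF x]]] NC[OF yN] NC[OF zN] NC[OF fN[OF zN]] NC[OF x]
    have "c x \<otimes> y \<otimes> z = a (a x) \<otimes> y \<otimes> z \<ominus> a x \<otimes> y \<otimes> z" unfolding c_def using cs by algebra
    then show ?thesis using shift[OF x y zN] shift2[OF x y zN] cs by (simp add: A.r_neg A.minus_eq)
  qed
  have nil: "(a (a x) \<ominus> a x) \<otimes> (a (a y) \<ominus> a y) = \<zero>" if "x \<in> N" "y \<in> N" for x y
    using A.square_annihilator_products[OF i, of "c x" "c y"] cM c3 that unfolding c_def by blast
  have "(\<forall>x\<in>M i. \<forall>z\<in>N. x \<otimes> a (a z) = \<zero>) \<or>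
    (\<forall>x\<in>M i. \<forall>z\<in>N. x \<otimes> (z \<ominus> a z \<ominus> a z \<oplus> a (a z)) = \<zero>)"
    by (rule A.almost_idempotent_splitting[OF A.total_ideal A.part_ideal[OF i] A.part_le[OF i]
          aM adj nil A.part_indecomposable[OF i]])
  then show ?thesis
  proof
    assume *: "\<forall>x\<in>M i. \<forall>z\<in>N. x \<otimes> a (a z) = \<zero>"
    have "x \<otimes> y \<otimes> f z = \<zero>" if "x \<in> M i" "y \<in> M i" "z \<in> N" for x y z
    proof -
      have xN: "x \<in> N" and yN: "y \<in> N" using that MN by auto
      have "x \<otimes> y \<otimes> f z = a (a x) \<otimes> y \<otimes> z" using shift2 xN that by simp
      also have "\<dots> = a (a x) \<otimes> (y \<otimes> z)" using that NC aN xN yN by (simp add: A.m_assoc)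
      also have "\<dots> = x \<otimes> a (a (y \<otimes> z))" using adj that xN yN aN Nm by simp
      finally show ?thesis using * that yN Nm by simp
    qed
    then show ?thesis unfolding f_def by blast
  next
    assume *: "\<forall>x\<in>M i. \<forall>z\<in>N. x \<otimes> (z \<ominus> a z \<ominus> a z \<oplus> a (a z)) = \<zero>"
    have "x \<otimes> y \<otimes> z = x \<otimes> y \<otimes> f z" if "x \<in> M i" "y \<in> M i" "z \<in> N" for x y z
    proof -
      have xN: "x \<in> N" and yN: "y \<in> N" using that MN by auto
      define w where "w = y \<otimes> z"
      have wN: "w \<in> N" using yN that Nm by (simp add: w_def)
      note cs = NC[OF wN] NC[OF aN[OF wN]] NC[OF aN[OF aN[OF wN]]] NC[OF xN] NC[OF yN]
        NC[OF that(3)] NC[OF fN[OF that(3)]]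
      (* With w = y z, the relation x (1 - 2a + a^2) w = 0 becomes x y z - x y f(z) = 0. *)
      have 1: "x \<otimes> a w = x \<otimes> y \<otimes> f z"
        using shift[OF xN that(2,3)] adj[OF xN wN] NC[OF aN[OF xN]] cs by (simp add: w_def A.m_assoc)
      have 2: "x \<otimes> a (a w) = x \<otimes> y \<otimes> f z"
        using shift2[OF xN that(2,3)] adj[OF aN[OF xN] wN] adj[OF xN aN[OF wN]] NC[OF aN[OF aN[OF xN]]] cs
        by (simp add: w_def A.m_assoc)
      have "\<zero> = x \<otimes> (w \<ominus> a w \<ominus> a w \<oplus> a (a w))" using * that wN by simp
      also have "\<dots> = x \<otimes> w \<ominus> x \<otimes> a w \<ominus> x \<otimes> a w \<oplus> x \<otimes> a (a w)" using cs by algebra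
      also have "\<dots> = x \<otimes> w \<ominus> x \<otimes> y \<otimes> f z" unfolding 1 2 using cs by algebra
      finally have "x \<otimes> w \<ominus> x \<otimes> y \<otimes> f z = \<zero>" by simp
      then have "x \<otimes> w = x \<otimes> y \<otimes> f z" using cs by (simp add: A.diff_eq_zero_iff)
      then show ?thesis using cs by (simp add: w_def A.m_assoc)
    qed
    then show ?thesis unfolding f_def by blast
  qed
qed

text \<open>By \<open>square_dichotomy\<close> this is the case where the projection to \<open>L j\<close> is the identity on the square of
\<open>M i\<close>.\<close>

definition linked :: "'i \<Rightarrow> 'j \<Rightarrow> bool"
  where "linked i j \<longleftrightarrow> (\<exists>x\<in>M i. \<exists>y\<in>M i. \<exists>z\<in>L j. x \<otimes> y \<otimes> z \<noteq> \<zero>)"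

lemma ex_linked:
  assumes i: "i \<in> I" shows "\<exists>j\<in>J. linked i j"
proof (rule ccontr)
  assume no: "\<not> (\<exists>j\<in>J. linked i j)"
  obtain x y z where xyz: "x \<in> M i" "y \<in> M i" "z \<in> M i" "x \<otimes> y \<otimes> z \<noteq> \<zero>"
    using A.part_cube i by blast
  have N: "x \<in> N" "y \<in> N" "z \<in> N" using xyz A.part_le[OF i] by auto
  have c: "x \<otimes> y \<in> carrier Q" "x \<otimes> y \<in> N" using N by (auto simp: A.total_carrier A.total_mult)
  have "x \<otimes> y \<in> self_annihilator Q N"
    by (rule B.self_annihilatorI) (use c no xyz in \<open>auto simp: linked_def\<close>)
  then show False using xyz N by (simp add: self_annihilator_def)
qed

lemma linked_products:
  assumes i: "i \<in> I" and jk: "j \<in> J" "k \<in> J" "k \<noteq> j" and l: "linked i j"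
    and x: "x \<in> M i" and y: "y \<in> M i" and z: "z \<in> L k"
  shows "x \<otimes> y \<otimes> z = \<zero>"
proof -
  have N: "x \<in> N" "y \<in> N" "z \<in> N" using x y z A.part_le[OF i] B.part_le[OF jk(2)] by auto
  have c: "x \<otimes> y \<in> carrier Q" "x \<otimes> y \<in> N" using N by (auto simp: A.total_carrier A.total_mult)
  obtain x' y' z' where w: "x' \<in> M i" "y' \<in> M i" "z' \<in> L j" "x' \<otimes> y' \<otimes> z' \<noteq> \<zero>"
    using l unfolding linked_def by blast
  have N': "x' \<in> N" "y' \<in> N" "z' \<in> N" using w A.part_le[OF i] B.part_le[OF jk(1)] by auto
  have c': "x' \<otimes> y' \<in> carrier Q" "x' \<otimes> y' \<in> N" using N' by (auto simp: A.total_carrier A.total_mult)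
  have "x' \<otimes> y' \<otimes> B.part j z' = x' \<otimes> y' \<otimes> z'"
    using B.part_mult_self[OF w(3) c'(2) jk(1)] N' c' jk by (simp add: A.m_comm[of "x' \<otimes> y'"] A.total_carrier)
  then have "x \<otimes> y \<otimes> z = x \<otimes> y \<otimes> B.part j z"
    using square_dichotomy[OF i jk(1)] w N N' x y by metis
  also have "\<dots> = (B.part j (x \<otimes> y)) \<otimes> z" using B.part_adjoint c N jk by simp
  also have "\<dots> = \<zero>"
    using B.part_orthogonal[of j k "B.part j (x \<otimes> y)" z] B.part_mem[OF c(2) jk(1)] jk z by auto
  finally show ?thesis .
qed

text \<open>If \<open>x y z \<noteq> 0\<close> with \<open>z\<close> in \<open>L j\<close>, then \<open>y\<close> may be replaced by its component in \<open>L j\<close>, and the same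
product is an element of \<open>L j L j M i\<close>.\<close>

lemma linked_sym:
  assumes ij: "i \<in> I" "j \<in> J" and l: "linked i j"
  shows "two_orthogonal_sums.linked Q L M j i"
proof -
  interpret sw: two_orthogonal_sums Q N J L I M by (rule swapped)
  obtain x y z where w: "x \<in> M i" "y \<in> M i" "z \<in> L j" "x \<otimes> y \<otimes> z \<noteq> \<zero>"
    using l unfolding linked_def by blast
  have N: "x \<in> N" "y \<in> N" "z \<in> N" using w A.part_le[OF ij(1)] B.part_le[OF ij(2)] by auto
  have c: "x \<in> carrier Q" "y \<in> carrier Q" "z \<in> carrier Q" "B.part j y \<in> carrier Q"
    using N ij by (auto simp: A.total_carrier)
  have "B.part j y \<otimes> z = y \<otimes> z" using B.part_mult N ij w by simp
  then have "B.part j y \<otimes> z \<otimes> x \<noteq> \<zero>" using w(4) c by (simp add: A.m_ac)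
  then show ?thesis using w B.part_mem[OF N(2) ij(2)] unfolding sw.linked_def by blast
qed

lemma linked_unique:
  assumes "i \<in> I" "j \<in> J" "k \<in> J" "linked i j" "linked i k" shows "j = k"
  using linked_products[of i j k] assms unfolding linked_def[of i k] by blast

text \<open>The difference of the two sides is the sum of the products of the components in \<open>L k\<close> for \<open>k \<noteq> j\<close>.
Such a \<open>k\<close> is linked to an index other than \<open>i\<close>, so \<open>L k L k M i = 0\<close>: the components in \<open>L k\<close> of
elements of \<open>M i\<close> annihilate the square of \<open>L k\<close>, and their products are zero.\<close>

lemma linked_isometry:
  assumes i: "i \<in> I" and j: "j \<in> J" and l: "linked i j" and x: "x \<in> M i" and y: "y \<in> M i"
  shows "x \<otimes> y = B.part j x \<otimes> B.part j y"
proof -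
  interpret sw: two_orthogonal_sums Q N J L I M by (rule swapped)
  have N: "x \<in> N" "y \<in> N" using x y A.part_le[OF i] by auto
  have other: "B.part k x \<otimes> y = \<zero>" if k: "k \<in> J" "k \<noteq> j" for k
  proof -
    obtain i' where i': "i' \<in> I" "sw.linked k i'" using sw.ex_linked k by blast
    have "i' \<noteq> i"
      using sw.linked_sym[OF k(1) i'] linked_unique[OF i j k(1) l] k i' by auto
    have small: "B.part k w \<otimes> s \<otimes> t = \<zero>" if w: "w \<in> M i" and st: "s \<in> L k" "t \<in> L k" for w s t
    proof -
      have N': "w \<in> N" "s \<in> N" "t \<in> N" using w st A.part_le[OF i] B.part_le[OF k(1)] by auto
      then have c: "w \<in> carrier Q" "s \<in> carrier Q" "t \<in> carrier Q" by (auto simp: A.total_carrier)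
      have "B.part k w \<otimes> s \<otimes> t = s \<otimes> t \<otimes> w"
        using B.part_mult[OF N'(1) k(1) st(1)] c by (simp add: A.m_ac)
      then show ?thesis using sw.linked_products[OF k(1) i'(1) i _ i'(2) st w] \<open>i' \<noteq> i\<close> by simp
    qed
    have "B.part k x \<otimes> B.part k y = \<zero>"
      by (rule B.square_annihilator_products[OF k(1)])
        (use small x y N k in \<open>auto intro: B.part_mem\<close>)
    then show ?thesis
      using B.part_adjoint[of "B.part k x" y k] B.part_mult_self[of "B.part k x" k y] N k
      by (simp add: B.part_mem B.part_mem_total)
  qed
  have yc: "y \<in> carrier Q" using N A.total_carrier by simp
  have "x \<otimes> y = finsum Q (\<lambda>k. B.part k x) J \<otimes> y" using B.part_sum[OF N(1)] by simp
  also have "\<dots> = finsum Q (\<lambda>k. B.part k x \<otimes> y) J"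
    by (rule A.finsum_ldistr[OF B.finite_index yc]) (use N in auto)
  also have "\<dots> = finsum Q (\<lambda>k. if j = k then B.part k x \<otimes> y else \<zero>) J"
    by (rule A.finsum_cong) (use other N yc in \<open>auto simp: simp_implies_def\<close>)
  also have "\<dots> = B.part j x \<otimes> y"
    by (rule A.finsum_singleton) (use N j yc B.finite_index in auto)
  also have "\<dots> = B.part j x \<otimes> B.part j y"
    using B.part_adjoint[of "B.part j x" y j] B.part_mult_self[of "B.part j x" j y] N j
    by (simp add: B.part_mem B.part_mem_total)
  finally show ?thesis .
qed

text \<open>The relation \<open>\<forall>z\<in>L (\<sigma> i). x \<otimes> z = y \<otimes> z\<close> says that \<open>y\<close> is the component of \<open>x\<close> in \<open>L (\<sigma> i)\<close>, modulo the
radical. Stated with this relation, the result does not depend on the chosen components.\<close>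

theorem matching:
  "\<exists>\<sigma>. bij_betw \<sigma> I J \<and> (\<forall>i\<in>I.
    (\<forall>x\<in>M i. \<exists>y\<in>L (\<sigma> i). \<forall>z\<in>L (\<sigma> i). x \<otimes> z = y \<otimes> z) \<and>
    (\<forall>y\<in>L (\<sigma> i). \<exists>x\<in>M i. \<forall>z\<in>L (\<sigma> i). x \<otimes> z = y \<otimes> z) \<and>
    (\<forall>x\<in>M i. \<forall>x'\<in>M i. \<forall>y\<in>L (\<sigma> i). \<forall>y'\<in>L (\<sigma> i). (\<forall>z\<in>L (\<sigma> i). x \<otimes> z = y \<otimes> z) \<longrightarrow>
      (\<forall>z\<in>L (\<sigma> i). x' \<otimes> z = y' \<otimes> z) \<longrightarrow> x \<otimes> x' = y \<otimes> y'))"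
proof -
  interpret sw: two_orthogonal_sums Q N J L I M by (rule swapped)
  define \<sigma> where "\<sigma> i = (SOME j. j \<in> J \<and> linked i j)" for i
  define \<tau> where "\<tau> j = (SOME i. i \<in> I \<and> sw.linked j i)" for j
  have \<sigma>: "\<sigma> i \<in> J" "linked i (\<sigma> i)" if "i \<in> I" for i
    using someI_ex[of "\<lambda>j. j \<in> J \<and> linked i j"] ex_linked[OF that] unfolding \<sigma>_def by blast+
  have \<tau>: "\<tau> j \<in> I" "sw.linked j (\<tau> j)" if "j \<in> J" for j
    using someI_ex[of "\<lambda>i. i \<in> I \<and> sw.linked j i"] sw.ex_linked[OF that] unfolding \<tau>_def by blast+
  have "bij_betw \<sigma> I J"
  proof (rule bij_betw_byWitness[where f' = \<tau>])
    show "\<forall>i\<in>I. \<tau> (\<sigma> i) = i"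
      using \<sigma> \<tau> linked_sym sw.linked_unique by metis
    show "\<forall>j\<in>J. \<sigma> (\<tau> j) = j"
      using \<sigma> \<tau> sw.linked_sym linked_unique by metis
  qed (use \<sigma> \<tau> in auto)
  moreover have "(\<forall>x\<in>M i. \<exists>y\<in>L (\<sigma> i). \<forall>z\<in>L (\<sigma> i). x \<otimes> z = y \<otimes> z) \<and>
    (\<forall>y\<in>L (\<sigma> i). \<exists>x\<in>M i. \<forall>z\<in>L (\<sigma> i). x \<otimes> z = y \<otimes> z) \<and>
    (\<forall>x\<in>M i. \<forall>x'\<in>M i. \<forall>y\<in>L (\<sigma> i). \<forall>y'\<in>L (\<sigma> i). (\<forall>z\<in>L (\<sigma> i). x \<otimes> z = y \<otimes> z) \<longrightarrow>
      (\<forall>z\<in>L (\<sigma> i). x' \<otimes> z = y' \<otimes> z) \<longrightarrow> x \<otimes> x' = y \<otimes> y')" if i: "i \<in> I" for i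
  proof (intro conjI ballI impI)
    let ?j = "\<sigma> i"
    have j: "?j \<in> J" and l: "linked i ?j" using \<sigma> i by auto
    have MN: "x \<in> N" if "x \<in> M i" for x using that A.part_le[OF i] by auto
    have LN: "x \<in> N" if "x \<in> L ?j" for x using that B.part_le[OF j] by auto
    show "\<exists>y\<in>L ?j. \<forall>z\<in>L ?j. x \<otimes> z = y \<otimes> z" if x: "x \<in> M i" for x
      using B.part_mult[OF MN[OF x] j] B.part_mem[OF MN[OF x] j] by metis
    show "\<exists>x\<in>M i. \<forall>z\<in>L ?j. x \<otimes> z = y \<otimes> z" if y: "y \<in> L ?j" for y
    proof (intro bexI ballI)
      show "A.part i y \<in> M i" using A.part_mem LN y i by simp
      show "A.part i y \<otimes> z = y \<otimes> z" if z: "z \<in> L ?j" for z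
      proof -
        have "y \<otimes> z = A.part i y \<otimes> A.part i z"
          using sw.linked_isometry[OF j i linked_sym[OF i j l] y z] .
        also have "\<dots> = A.part i y \<otimes> z"
          using A.part_adjoint[of "A.part i y" z i] A.part_mult_self[of "A.part i y" i z] LN[OF y] LN[OF z] i
          by (simp add: A.part_mem A.part_mem_total)
        finally show ?thesis by simp
      qed
    qed
    show "x \<otimes> x' = y \<otimes> y'" if a: "x \<in> M i" "x' \<in> M i" "y \<in> L ?j" "y' \<in> L ?j"
      "\<forall>z\<in>L ?j. x \<otimes> z = y \<otimes> z" "\<forall>z\<in>L ?j. x' \<otimes> z = y' \<otimes> z" for x x' y y'
    proof -
      have fx': "B.part ?j x' \<in> L ?j" using B.part_mem MN a j by simp
      have c: "x' \<in> carrier Q" "y' \<in> carrier Q" "y \<in> carrier Q" "B.part ?j x' \<in> carrier Q"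
        using a MN LN j by (auto simp: A.total_carrier)
      have "x \<otimes> x' = B.part ?j x \<otimes> B.part ?j x'" using linked_isometry[OF i j l a(1,2)] .
      also have "\<dots> = y \<otimes> B.part ?j x'" using B.part_mult[OF MN[OF a(1)] j fx'] a(5) fx' by simp
      also have "\<dots> = y \<otimes> x'"
        using B.part_mult[OF MN[OF a(2)] j a(3)] c by (simp add: A.m_comm)
      also have "\<dots> = x' \<otimes> y" using c by (simp add: A.m_comm)
      also have "\<dots> = y' \<otimes> y" using a by simp
      finally show ?thesis using c by (simp add: A.m_comm)
    qed
  qed
  ultimately show ?thesis by blast
qed

end

section \<open>Graded Artinian rings\<close>

lemma (in additive_subgroup) finsum_closed_subgroup:
  assumes "abelian_group G" "\<And>i. i \<in> S \<Longrightarrow> f i \<in> H"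
  shows "finsum G f S \<in> H"
proof -
  interpret abelian_group G by fact
  show ?thesis
    using assms(2)
  proof (induction S rule: infinite_finite_induct)
    case (insert i S)
    then have "finsum G f (insert i S) = f i \<oplus> finsum G f S"
      by (intro finsum_insert) auto
    then show ?case using insert by auto
  qed (auto simp: finsum_infinite)
qed

lemma (in cring) unit_memI: "\<lbrakk>x \<in> carrier R; y \<in> carrier R; x \<otimes> y = \<one>\<rbrakk> \<Longrightarrow> x \<in> Units R"
  unfolding Units_def using m_comm[of x y] by auto

lemma (in ideal) unit_imp_carrier: "\<lbrakk>x \<in> I; x \<in> Units R\<rbrakk> \<Longrightarrow> I = carrier R"
  using one_imp_carrier I_l_closed Units_inv_closed Units_l_inv by metis

lemma (in cring) nonunits_unique_maximal:
  assumes H: "ideal H R" "H \<noteq> carrier R" and units: "\<And>x. x \<in> carrier R \<Longrightarrow> x \<notin> H \<Longrightarrow> x \<in> Units R"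
  shows "\<exists>!M. maximalideal M R" "max_ideal R = H"
proof -
  have sub: "J \<subseteq> H" if "ideal J R" "J \<noteq> carrier R" for J
    using that units ideal.unit_imp_carrier ideal.Icarr by (metis subsetI)
  have max: "maximalideal H R"
    by (rule maximalidealI) (use H sub in auto)
  moreover have "M = H" if M: "maximalideal M R" for M
  proof -
    interpret M: maximalideal M R by fact
    show ?thesis
      using M.I_maximal[OF H(1)] H sub[OF M.is_ideal] M.I_notcarr ideal.Icarr by (metis subsetI)
  qed
  ultimately show ex: "\<exists>!M. maximalideal M R" by blast
  show "max_ideal R = H"
    unfolding max_ideal_def by (rule the1_equality[OF ex max])
qed

text \<open>Products generate the powers additively, so any filtration \<open>F\<close> compatible with multiplication by \<open>H\<close>
bounds them. The filtration by degree shows that high powers vanish, and a short filtration that ends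
in zero turns vanishing triple products into a vanishing third power.\<close>

lemma (in cring) ideal_power_subset:
  assumes F0: "carrier R \<subseteq> F 0"
    and add: "\<And>n x y. x \<in> F n \<Longrightarrow> y \<in> F n \<Longrightarrow> x \<oplus> y \<in> F n"
    and mult: "\<And>n x y. x \<in> F n \<Longrightarrow> y \<in> H \<Longrightarrow> x \<otimes> y \<in> F (Suc n)"
  shows "H [^]\<^bsub>ideals_set R\<^esub> (n::nat) \<subseteq> F n"
proof (induction n)
  case 0
  then show ?case using F0 by (simp add: ideals_set_def)
next
  case (Suc n)
  have "x \<in> F (Suc n)" if "x \<in> ideal_prod R (H [^]\<^bsub>ideals_set R\<^esub> n) H" for x
    using that by induction (use Suc mult add in auto)
  then show ?case by (auto simp: ideals_set_def)
qed

text \<open>The part of a graded Artinian algebra that refers to the ring alone; the base field appears as the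
component of degree zero. That the ring is local is a consequence (\<open>max_ideal_eq\<close>).\<close>

locale graded_artinian_ring = cring G for G (structure) +
  fixes A :: "nat \<Rightarrow> 'a set"
  assumes comp_subgroup: "additive_subgroup (A n) G"
    and comp_mult: "\<lbrakk>x \<in> A m; y \<in> A n\<rbrakk> \<Longrightarrow> x \<otimes> y \<in> A (m + n)"
    and unique_components: "x \<in> carrier G \<Longrightarrow>
      \<exists>!f. (\<forall>n. f n \<in> A n) \<and> finite {n. f n \<noteq> \<zero>} \<and> x = finsum G f {n. f n \<noteq> \<zero>}"
    and one_degree: "\<one> \<in> A 0"
    and one_nonzero: "\<one> \<noteq> \<zero>"
    and degree_zero_field: "\<lbrakk>x \<in> A 0; x \<noteq> \<zero>\<rbrakk> \<Longrightarrow> \<exists>y\<in>A 0. x \<otimes> y = \<one>"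
    and dcc: "\<lbrakk>\<And>n. ideal (C n) G; \<And>n. C (Suc n) \<subseteq> C n\<rbrakk> \<Longrightarrow> \<exists>n. \<forall>m\<ge>n. C m = C n"
begin

lemma A_carrier: "x \<in> A n \<Longrightarrow> x \<in> carrier G"
  using comp_subgroup additive_subgroup.a_Hcarr by metis

lemma A_add: "x \<in> A n \<Longrightarrow> y \<in> A n \<Longrightarrow> x \<oplus> y \<in> A n"
  using comp_subgroup additive_subgroup.a_closed by metis

lemma A_zero: "\<zero> \<in> A n"
  using comp_subgroup additive_subgroup.zero_closed by metis

lemma A_minus: "x \<in> A n \<Longrightarrow> \<ominus> x \<in> A n"
  using comp_subgroup additive_subgroup.a_inv_closed is_abelian_group by (metis abelian_group.a_inv_closed)

definition component :: "nat \<Rightarrow> 'a \<Rightarrow> 'a"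
  where "component n x =
    (THE f. (\<forall>n. f n \<in> A n) \<and> finite {n. f n \<noteq> \<zero>} \<and> x = finsum G f {n. f n \<noteq> \<zero>}) n"

lemma component_props:
  assumes "x \<in> carrier G"
  shows component_mem: "component n x \<in> A n"
    and component_finite: "finite {n. component n x \<noteq> \<zero>}"
    and component_sum: "x = finsum G (\<lambda>n. component n x) {n. component n x \<noteq> \<zero>}"
  using theI'[OF unique_components[OF assms]] unfolding component_def by auto

lemma component_closed [simp]: "x \<in> carrier G \<Longrightarrow> component n x \<in> carrier G"
  using component_mem A_carrier by blast

lemma component_eqI:
  assumes f: "\<And>n. f n \<in> A n" and S: "finite S" "\<And>n. n \<notin> S \<Longrightarrow> f n = \<zero>" and x: "x = finsum G f S"
  shows "component n x = f n"
proof -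
  have fc: "f n \<in> carrier G" for n using f A_carrier by blast
  have sub: "{n. f n \<noteq> \<zero>} \<subseteq> S" using S(2) by blast
  have "x = finsum G f {n. f n \<noteq> \<zero>}"
    unfolding x by (rule add.finprod_mono_neutral_cong_left[symmetric]) (use fc S sub in auto)
  moreover have "finite {n. f n \<noteq> \<zero>}" using sub S finite_subset by blast
  moreover have "x \<in> carrier G" using x fc by auto
  ultimately have "(THE f. (\<forall>n. f n \<in> A n) \<and> finite {n. f n \<noteq> \<zero>} \<and> x = finsum G f {n. f n \<noteq> \<zero>}) = f"
    using the1_equality[OF unique_components, of x f] f by blast
  then show ?thesis unfolding component_def by simp
qed

lemma component_sum':
  assumes "x \<in> carrier G" "finite S" "{n. component n x \<noteq> \<zero>} \<subseteq> S"
  shows "x = finsum G (\<lambda>n. component n x) S"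
proof -
  have "finsum G (\<lambda>n. component n x) {n. component n x \<noteq> \<zero>} = finsum G (\<lambda>n. component n x) S"
    by (rule add.finprod_mono_neutral_cong_left) (use assms in auto)
  then show ?thesis using component_sum[OF assms(1)] by simp
qed

lemma component_homogeneous:
  assumes "x \<in> A m" shows "component n x = (if n = m then x else \<zero>)"
proof (rule component_eqI[of _ "{m}"])
  show "x = finsum G (\<lambda>n. if n = m then x else \<zero>) {m}"
    using assms A_carrier by (subst finsum_insert) auto
qed (use assms A_zero in auto)

lemma component_add:
  assumes "x \<in> carrier G" "y \<in> carrier G"
  shows "component n (x \<oplus> y) = component n x \<oplus> component n y"
proof (rule component_eqI[where S = "{n. component n x \<noteq> \<zero>} \<union> {n. component n y \<noteq> \<zero>}"])
  let ?S = "{n. component n x \<noteq> \<zero>} \<union> {n. component n y \<noteq> \<zero>}"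
  show fin: "finite ?S" using assms component_finite by blast
  have "x = finsum G (\<lambda>n. component n x) ?S" "y = finsum G (\<lambda>n. component n y) ?S"
    by (rule component_sum'[OF _ fin]; use assms in auto)+
  then have "x \<oplus> y = finsum G (\<lambda>n. component n x) ?S \<oplus> finsum G (\<lambda>n. component n y) ?S" by simp
  also have "\<dots> = finsum G (\<lambda>n. component n x \<oplus> component n y) ?S"
    by (rule finsum_addf[symmetric]) (use assms in auto)
  finally show "x \<oplus> y = finsum G (\<lambda>n. component n x \<oplus> component n y) ?S" .
qed (use assms component_mem A_add in auto)

lemma component_ext:
  assumes "x \<in> carrier G" "y \<in> carrier G" "\<And>n. component n x = component n y" shows "x = y"
  using component_sum[OF assms(1)] component_sum[OF assms(2)] assms(3) by simp

lemma component_zero [simp]: "component n \<zero> = \<zero>"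
  using component_homogeneous[OF A_zero, of n n] by simp

lemma component_minus:
  assumes "x \<in> carrier G" shows "component n (\<ominus> x) = \<ominus> component n x"
  using component_add[of "\<ominus> x" x n] assms by (simp add: l_neg minus_equality)

lemma component_diff:
  assumes "x \<in> carrier G" "y \<in> carrier G"
  shows "component n (x \<ominus> y) = component n x \<ominus> component n y"
  using assms by (simp add: minus_eq component_add component_minus)

lemma component_mult_homogeneous:
  assumes x: "x \<in> carrier G" and y: "y \<in> A m"
  shows "component n (x \<otimes> y) = (if m \<le> n then component (n - m) x \<otimes> y else \<zero>)"
proof (rule component_eqI[where S = "(\<lambda>k. k + m) ` {k. component k x \<noteq> \<zero>}"])
  let ?S = "{k. component k x \<noteq> \<zero>}"
  let ?f = "\<lambda>n. if m \<le> n then component (n - m) x \<otimes> y else \<zero>"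
  have yc: "y \<in> carrier G" using y A_carrier by blast
  show "?f n \<in> A n" for n
    using comp_mult[OF component_mem[OF x] y, of "n - m"] A_zero by auto
  show "finite ((\<lambda>k. k + m) ` ?S)" using component_finite[OF x] by simp
  show "?f n = \<zero>" if "n \<notin> (\<lambda>k. k + m) ` ?S" for n
  proof (cases "m \<le> n")
    case True
    then have "component (n - m) x = \<zero>" using that image_eqI[of n "\<lambda>k. k + m" "n - m" ?S] by auto
    then show ?thesis using yc by simp
  qed simp
  have "x \<otimes> y = finsum G (\<lambda>k. component k x) ?S \<otimes> y" using component_sum[OF x] by simp
  also have "\<dots> = finsum G (\<lambda>k. component k x \<otimes> y) ?S"
    by (rule finsum_ldistr[OF component_finite[OF x] yc]) (use x in auto)
  also have "\<dots> = finsum G (\<lambda>k. ?f (k + m)) ?S" by simp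
  also have "\<dots> = finsum G ?f ((\<lambda>k. k + m) ` ?S)"
    by (rule finsum_reindex[symmetric]) (use x yc in \<open>auto simp: inj_on_def\<close>)
  finally show "x \<otimes> y = finsum G ?f ((\<lambda>k. k + m) ` ?S)" .
qed

definition degree_ge :: "nat \<Rightarrow> 'a set"
  where "degree_ge n = {x \<in> carrier G. \<forall>m<n. component m x = \<zero>}"

lemma degree_ge_closed: "x \<in> degree_ge n \<Longrightarrow> x \<in> carrier G"
  by (simp add: degree_ge_def)

lemma degree_ge_antimono: "m \<le> n \<Longrightarrow> degree_ge n \<subseteq> degree_ge m"
  by (auto simp: degree_ge_def)

lemma degree_ge_0: "degree_ge 0 = carrier G"
  by (simp add: degree_ge_def)

lemma degree_ge_add: "x \<in> degree_ge n \<Longrightarrow> y \<in> degree_ge n \<Longrightarrow> x \<oplus> y \<in> degree_ge n"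
  by (auto simp: degree_ge_def component_add)

lemma degree_ge_subgroup: "additive_subgroup (degree_ge n) G"
proof (intro additive_subgroup.intro add.subgroupI)
  have "\<zero> \<in> degree_ge n" by (simp add: degree_ge_def)
  then show "degree_ge n \<noteq> {}" by blast
qed (auto simp: degree_ge_def component_add component_minus)

lemma homogeneous_degree_ge: "x \<in> A m \<Longrightarrow> n \<le> m \<Longrightarrow> x \<in> degree_ge n"
  by (auto simp: degree_ge_def component_homogeneous A_carrier)

lemma degree_ge_mult:
  assumes x: "x \<in> degree_ge m" and y: "y \<in> degree_ge n"
  shows "x \<otimes> y \<in> degree_ge (m + n)"
proof -
  have xc: "x \<in> carrier G" and yc: "y \<in> carrier G" using x y degree_ge_closed by auto
  have "x \<otimes> component k y \<in> degree_ge (m + n)" if "component k y \<noteq> \<zero>" for k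
  proof -
    have "\<not> k < n" using that y unfolding degree_ge_def by blast
    then have "n \<le> k" by simp
    have "component l (x \<otimes> component k y) = \<zero>" if "l < m + n" for l
    proof (cases "k \<le> l")
      case True
      then have "l - k < m" using that \<open>n \<le> k\<close> by linarith
      then have "component (l - k) x = \<zero>" using x unfolding degree_ge_def by blast
      then show ?thesis using component_mult_homogeneous[OF xc component_mem[OF yc], of l k] yc by simp
    next
      case False
      then show ?thesis using component_mult_homogeneous[OF xc component_mem[OF yc], of l k] by simp
    qed
    then show ?thesis using xc yc by (simp add: degree_ge_def)
  qed
  then have "finsum G (\<lambda>k. x \<otimes> component k y) {k. component k y \<noteq> \<zero>} \<in> degree_ge (m + n)"
    by (intro additive_subgroup.finsum_closed_subgroup[OF degree_ge_subgroup] is_abelian_group) auto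
  moreover have "x \<otimes> finsum G (\<lambda>k. component k y) {k. component k y \<noteq> \<zero>} =
      finsum G (\<lambda>k. x \<otimes> component k y) {k. component k y \<noteq> \<zero>}"
    by (rule finsum_rdistr[OF component_finite[OF yc] xc]) (use yc in auto)
  ultimately show ?thesis using component_sum[OF yc] by simp
qed

lemma degree_ge_ideal: "ideal (degree_ge n) G"
proof (rule commutative_idealI)
  show "\<zero> \<in> degree_ge n" by (simp add: degree_ge_def)
  show "r \<otimes> x \<in> degree_ge n" if "r \<in> carrier G" "x \<in> degree_ge n" for r x
    using degree_ge_mult[of r 0 x n] that by (simp add: degree_ge_0)
qed (auto intro: degree_ge_add degree_ge_closed)

text \<open>The ideals \<open>degree_ge n\<close> form a descending chain, and an element of all of them has only zero
components.\<close>

lemma degree_ge_vanish: "\<exists>n. degree_ge n = {\<zero>}"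
proof -
  obtain n where n: "\<forall>m\<ge>n. degree_ge m = degree_ge n"
    using dcc[of degree_ge, OF degree_ge_ideal degree_ge_antimono[OF le_SucI[OF order_refl]]] by blast
  have "x = \<zero>" if x: "x \<in> degree_ge n" for x
  proof (rule component_ext)
    show "component k x = component k \<zero>" for k
    proof -
      have "degree_ge (max n (Suc k)) = degree_ge n" using n max.cobounded1 by blast
      then have "x \<in> degree_ge (max n (Suc k))" using x by blast
      then have "component k x = \<zero>" unfolding degree_ge_def by auto
      then show ?thesis by simp
    qed
  qed (use x degree_ge_closed in auto)
  then show ?thesis
    using ideal.axioms(1)[OF degree_ge_ideal, of n] additive_subgroup.zero_closed by blast
qed

lemma degree_zero_unit: "x \<in> A 0 \<Longrightarrow> x \<noteq> \<zero> \<Longrightarrow> x \<in> Units G"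
  using degree_zero_field unit_memI A_carrier by metis

text \<open>\<open>(1 - u)(1 + u) = 1 - u\<^sup>2\<close>, and squaring raises the lowest degree, so that the induction ends at
\<open>degree_ge N = 0\<close>.\<close>

lemma one_minus_unit:
  assumes "u \<in> degree_ge 1" shows "\<one> \<ominus> u \<in> Units G"
proof -
  obtain N where N: "degree_ge N = {\<zero>}" using degree_ge_vanish by blast
  have "\<one> \<ominus> u \<in> Units G" if "u \<in> degree_ge k" "1 \<le> k" for u k
    using that
  proof (induction "N - k" arbitrary: k u rule: less_induct)
    case less
    have uc: "u \<in> carrier G" using less degree_ge_closed by blast
    show ?case
    proof (cases "N \<le> k")
      case True
      then have "u = \<zero>" using less(2) degree_ge_antimono N by blast
      then show ?thesis by (simp add: minus_eq)
    next
      case False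
      have "u \<otimes> u \<in> degree_ge (Suc k)"
        using degree_ge_mult[OF less(2,2)] degree_ge_antimono[of "Suc k" "k + k"] less(3) by auto
      then have unit: "\<one> \<ominus> u \<otimes> u \<in> Units G" using less(1)[of "Suc k"] False by auto
      have "(\<one> \<ominus> u) \<otimes> (\<one> \<oplus> u) = \<one> \<ominus> u \<otimes> u" using uc by algebra
      then have "(\<one> \<ominus> u) \<otimes> ((\<one> \<oplus> u) \<otimes> inv (\<one> \<ominus> u \<otimes> u)) = \<one>"
        using unit uc by (simp add: m_assoc[symmetric])
      then show ?thesis using unit uc by (intro unit_memI) auto
    qed
  qed
  then show ?thesis using assms by blast
qed

lemma minus_component_0: "x \<in> carrier G \<Longrightarrow> x \<ominus> component 0 x \<in> degree_ge 1"
  using component_homogeneous[OF component_mem, of x 0 0]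
  by (simp add: degree_ge_def component_diff) (simp add: minus_eq r_neg)

lemma unit_if_component_0:
  assumes x: "x \<in> carrier G" and nz: "component 0 x \<noteq> \<zero>" shows "x \<in> Units G"
proof -
  let ?c = "component 0 x"
  have cu: "?c \<in> Units G" using degree_zero_unit component_mem x nz by blast
  then have cc: "?c \<in> carrier G" "inv ?c \<in> carrier G" by auto
  define u where "u = x \<ominus> ?c"
  have u: "u \<in> degree_ge 1" unfolding u_def using minus_component_0[OF x] .
  then have uc: "u \<in> carrier G" using degree_ge_closed by blast
  have "\<ominus> (inv ?c \<otimes> u) \<in> degree_ge 1"
    using ideal.I_l_closed[OF degree_ge_ideal u cc(2)] degree_ge_subgroup additive_subgroup.a_inv_closed
    by (metis is_abelian_group)
  then have "\<one> \<ominus> (\<ominus> (inv ?c \<otimes> u)) \<in> Units G" by (rule one_minus_unit)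
  moreover have "?c \<otimes> (\<one> \<ominus> (\<ominus> (inv ?c \<otimes> u))) = x"
  proof -
    have "?c \<otimes> (\<one> \<ominus> (\<ominus> (inv ?c \<otimes> u))) = ?c \<oplus> (?c \<otimes> inv ?c) \<otimes> u" using cc uc by algebra
    also have "\<dots> = ?c \<oplus> u" using cu uc by simp
    also have "\<dots> = x" unfolding u_def using cc x by algebra
    finally show ?thesis .
  qed
  ultimately show ?thesis using cu Units_m_closed by metis
qed

lemma component_0_one: "component 0 \<one> = \<one>"
  using component_homogeneous[OF one_degree] by simp

lemma not_degree_ge_1: "x \<in> carrier G \<Longrightarrow> x \<notin> degree_ge 1 \<Longrightarrow> x \<in> Units G"
  using unit_if_component_0 by (auto simp: degree_ge_def)

lemma degree_ge_1_proper: "degree_ge 1 \<noteq> carrier G"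
proof -
  have "\<one> \<notin> degree_ge 1" using component_0_one one_nonzero by (simp add: degree_ge_def)
  then show ?thesis using one_closed by blast
qed

lemma max_ideal_eq: "max_ideal G = degree_ge 1"
  by (rule nonunits_unique_maximal[OF degree_ge_ideal degree_ge_1_proper not_degree_ge_1])

lemma socle_eq: "socle G = {x \<in> carrier G. \<forall>y\<in>degree_ge 1. x \<otimes> y = \<zero>}"
  by (simp add: socle_def max_ideal_eq)

lemma socle_ideal: "ideal (socle G) G"
  unfolding socle_eq by (rule annihilated_ideal[OF oneideal]) (rule degree_ge_closed)

lemma socle_generator_nonzero: "socle_generator G \<delta> \<Longrightarrow> \<delta> \<in> socle G \<and> \<delta> \<in> carrier G \<and> \<delta> \<noteq> \<zero>"
  unfolding socle_generator_def using cgenideal_self by blast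

text \<open>The generator is annihilated by positive degrees, so only the degree-zero component of a coefficient
acts on it.\<close>

lemma socle_multiple:
  assumes \<delta>: "socle_generator G \<delta>" and z: "z \<in> socle G"
  shows "\<exists>c\<in>A 0. z = c \<otimes> \<delta>"
proof -
  obtain r where r: "r \<in> carrier G" "z = r \<otimes> \<delta>"
    using z \<delta> unfolding socle_generator_def cgenideal_def by blast
  have d: "\<delta> \<in> carrier G" "\<delta> \<in> socle G" using socle_generator_nonzero[OF \<delta>] by auto
  let ?c = "component 0 r"
  have cc: "?c \<in> carrier G" using r by simp
  have "(r \<ominus> ?c) \<otimes> \<delta> = \<zero>"
    using d minus_component_0[OF r(1)] degree_ge_closed by (auto simp: socle_eq m_comm[of _ \<delta>])
  moreover have "r \<otimes> \<delta> = (r \<ominus> ?c) \<otimes> \<delta> \<oplus> ?c \<otimes> \<delta>" using r(1) cc d by algebra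
  ultimately have "z = ?c \<otimes> \<delta>" using r cc d by simp
  then show ?thesis using component_mem r by blast
qed

lemma socle_line:
  assumes \<delta>: "socle_generator G \<delta>" and zw: "z \<in> socle G" "z \<noteq> \<zero>" "w \<in> socle G"
  shows "\<exists>c\<in>A 0. w = c \<otimes> z"
proof -
  obtain a b where ab: "a \<in> A 0" "z = a \<otimes> \<delta>" "b \<in> A 0" "w = b \<otimes> \<delta>"
    using socle_multiple[OF \<delta>] zw by metis
  have d: "\<delta> \<in> carrier G" using socle_generator_nonzero[OF \<delta>] by auto
  have "a \<noteq> \<zero>" using ab zw d by auto
  then obtain a' where a': "a' \<in> A 0" "a \<otimes> a' = \<one>" using degree_zero_field ab by blast
  have c: "a \<in> carrier G" "a' \<in> carrier G" "b \<in> carrier G" using ab a' A_carrier by auto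
  have "(b \<otimes> a') \<otimes> z = b \<otimes> (a \<otimes> a') \<otimes> \<delta>" unfolding ab using c d by algebra
  then have "w = (b \<otimes> a') \<otimes> z" using a' c d ab by simp
  then show ?thesis using comp_mult[OF ab(3) a'(1)] by auto
qed

text \<open>The largest degree \<open>D\<close> with a nonzero component exists because \<open>degree_ge N\<close> vanishes. That component
lies in the socle, and the socle, generated by an element of degree \<open>d\<close>, lies in \<open>A d\<close>.\<close>

lemma top_degree:
  assumes \<delta>: "socle_generator G \<delta>" and d: "\<delta> \<in> A d"
  shows "socle G = A d" "degree_ge (Suc d) = {\<zero>}"
proof -
  obtain N where N: "degree_ge N = {\<zero>}" using degree_ge_vanish by blast
  have AN: "A n = {\<zero>}" if "N \<le> n" for n
    using homogeneous_degree_ge[of _ n N] N that A_zero by blast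
  define D where "D = Max {n. A n \<noteq> {\<zero>}}"
  have fin: "finite {n. A n \<noteq> {\<zero>}}"
    by (rule finite_subset[of _ "{..N}"]) (use AN in \<open>auto simp: not_le intro: less_imp_le\<close>)
  have "A 0 \<noteq> {\<zero>}" using one_degree one_nonzero by blast
  then have AD: "A D \<noteq> {\<zero>}" using Max_in[OF fin] unfolding D_def by blast
  have big: "A n = {\<zero>}" if "D < n" for n
    using Max_ge[OF fin, of n] that unfolding D_def by fastforce
  have TD: "x = \<zero>" if x: "x \<in> degree_ge (Suc D)" for x
  proof (rule component_ext)
    show "component k x = component k \<zero>" for k
      using x big[of k] component_mem[of x k] by (cases "k < Suc D") (auto simp: degree_ge_def)
  qed (use x degree_ge_closed in auto)
  have 1: "A D \<subseteq> socle G"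
    using degree_ge_mult[of _ D _ 1] homogeneous_degree_ge[of _ D D] TD A_carrier
    by (auto simp: socle_eq)
  have 2: "socle G \<subseteq> A d"
    using socle_multiple[OF \<delta>] comp_mult[OF _ d, of _ 0] by fastforce
  obtain x where x: "x \<in> A D" "x \<noteq> \<zero>" using AD A_zero by blast
  then have "D = d"
    using component_homogeneous[OF x(1), of D] component_homogeneous[of x d D] 1 2 by (auto split: if_splits)
  then show "socle G = A d" using 1 2 by blast
  show "degree_ge (Suc d) = {\<zero>}"
    using TD \<open>D = d\<close> ideal.axioms(1)[OF degree_ge_ideal, of "Suc d"] additive_subgroup.zero_closed by blast
qed

text \<open>Since \<open>loewy_length\<close> is a \<open>Max\<close>, the exponents in question have to be shown to form a finite set first;
this follows from the inclusion of the \<open>n\<close>-th power in \<open>degree_ge n\<close>. If all triple products were zero, the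
powers from the third on would vanish by comparison with the filtration \<open>F\<close>.\<close>

lemma cube_nonzero:
  assumes "loewy_length G \<ge> 3"
  shows "\<exists>x\<in>degree_ge 1. \<exists>y\<in>degree_ge 1. \<exists>z\<in>degree_ge 1. x \<otimes> y \<otimes> z \<noteq> \<zero>"
proof (rule ccontr)
  assume no: "\<not> ?thesis"
  let ?m = "degree_ge 1"
  let ?P = "\<lambda>n::nat. ?m [^]\<^bsub>ideals_set G\<^esub> n"
  interpret m: ideal ?m G by (rule degree_ge_ideal)
  have sub: "?P n \<subseteq> degree_ge n" for n
    by (rule ideal_power_subset)
      (use degree_ge_mult[of _ _ _ 1] degree_ge_add in \<open>auto simp: degree_ge_0\<close>)
  obtain N where N: "degree_ge N = {\<zero>}" using degree_ge_vanish by blast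
  have id: "ideal (?P n) G" for n
    by (induction n) (auto simp: ideals_set_def oneideal intro: ideal_prod_is_ideal degree_ge_ideal)
  have z: "\<zero> \<in> ?P n" for n using ideal.axioms(1)[OF id] additive_subgroup.zero_closed by blast
  have PN: "?P n = {\<zero>}" if "N \<le> n" for n
    using sub[of n] z[of n] degree_ge_antimono[OF that] N by blast
  have fin: "finite {n. ?P n \<noteq> {\<zero>}}"
    by (rule finite_subset[of _ "{..N}"]) (use PN in \<open>auto simp: not_le intro: less_imp_le\<close>)
  have "?P 0 \<noteq> {\<zero>}" using one_nonzero by (auto simp: ideals_set_def)
  then have ne: "{n. ?P n \<noteq> {\<zero>}} \<noteq> {}" by blast
  define L where "L = loewy_length G"
  have L: "?P L \<noteq> {\<zero>}" "3 \<le> L"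
    using Max_in[OF fin ne] assms unfolding L_def loewy_length_def max_ideal_eq by blast+
  define F where "F n = (if n = 0 then carrier G else if n = 1 then ?m
    else if n = 2 then {s \<in> ?m. \<forall>z\<in>?m. s \<otimes> z = \<zero>} else {\<zero>})" for n :: nat
  have "?P L \<subseteq> F L"
  proof (rule ideal_power_subset)
    show "x \<oplus> y \<in> F n" if "x \<in> F n" "y \<in> F n" for n x y
      using that degree_ge_closed degree_ge_add[of x 1 y] by (auto simp: F_def l_distr split: if_splits)
    show "x \<otimes> y \<in> F (Suc n)" if "x \<in> F n" "y \<in> ?m" for n x y
      using that no degree_ge_closed m.I_l_closed[of y x] by (auto simp: F_def numeral_2_eq_2 split: if_splits)
  qed (simp add: F_def)
  then show False using L z[of L] by (auto simp: F_def)
qed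

end

section \<open>Residue maps and fibre products\<close>

lemma (in graded_artinian_ring) component_0_mult:
  assumes x: "x \<in> carrier G" and y: "y \<in> carrier G"
  shows "component 0 (x \<otimes> y) = component 0 x \<otimes> component 0 y"
proof -
  have "x \<otimes> (y \<ominus> component 0 y) \<in> degree_ge 1"
    using degree_ge_mult[of x 0 "y \<ominus> component 0 y" 1] minus_component_0[OF y] x by (simp add: degree_ge_0)
  then have 0: "component 0 (x \<otimes> (y \<ominus> component 0 y)) = \<zero>" by (simp add: degree_ge_def)
  have c: "component 0 y \<in> carrier G" using y by simp
  have "x \<otimes> y = x \<otimes> (y \<ominus> component 0 y) \<oplus> x \<otimes> component 0 y" using x y c by algebra
  then have "component 0 (x \<otimes> y) = component 0 (x \<otimes> (y \<ominus> component 0 y)) \<oplus> component 0 (x \<otimes> component 0 y)"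
    using x y c by (simp add: component_add)
  also have "\<dots> = component 0 (x \<otimes> component 0 y)" using 0 x c by simp
  also have "\<dots> = component 0 x \<otimes> component 0 y"
    using component_mult_homogeneous[OF x component_mem[OF y], of 0 0] by simp
  finally show ?thesis .
qed

text \<open>The base field is linked to the ring by the structure map \<open>scalar\<close> and the residue map \<open>\<pi>\<close>, which
are mutually inverse between \<open>K\<close> and the degree-zero component.\<close>

locale graded_residue_ring = graded_artinian_ring +
  fixes K :: "('k, 'l) ring_scheme" and scalar :: "'k \<Rightarrow> 'a" and \<pi> :: "'a \<Rightarrow> 'k"
  assumes residue_cring: "cring K"
    and scalar_hom: "scalar \<in> ring_hom K G"
    and scalar_degree: "c \<in> carrier K \<Longrightarrow> scalar c \<in> A 0"
    and residue_hom: "\<pi> \<in> ring_hom G K"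
    and scalar_residue: "x \<in> carrier G \<Longrightarrow> scalar (\<pi> x) = component 0 x"
    and residue_scalar: "c \<in> carrier K \<Longrightarrow> \<pi> (scalar c) = c"
begin

sublocale scalar: ring_hom_cring K G scalar
  by (intro ring_hom_cring.intro ring_hom_cring_axioms.intro residue_cring is_cring scalar_hom)

sublocale residue: ring_hom_cring G K \<pi>
  by (intro ring_hom_cring.intro ring_hom_cring_axioms.intro residue_cring is_cring residue_hom)

lemma residue_eq_iff:
  "\<lbrakk>x \<in> carrier G; y \<in> carrier G\<rbrakk> \<Longrightarrow> \<pi> x = \<pi> y \<longleftrightarrow> component 0 x = component 0 y"
  by (metis scalar_residue residue_scalar residue.hom_closed)

lemma residue_zero_iff: "x \<in> carrier G \<Longrightarrow> \<pi> x = \<zero>\<^bsub>K\<^esub> \<longleftrightarrow> x \<in> degree_ge 1"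
  using residue_eq_iff[of x \<zero>] by (simp add: degree_ge_def)

end

text \<open>The maximal ideal is \<open>degree_ge 1\<close>, so the residue of \<open>x\<close> is the scalar that represents its
degree-zero component.\<close>

lemma graded_gorenstein_imp_residue_ring:
  assumes G: "graded_gorenstein_artinian_algebra K G A"
  shows "graded_residue_ring G A K (\<lambda>c. c \<odot>\<^bsub>G\<^esub> \<one>\<^bsub>G\<^esub>) (algebra_residue K G)"
proof -
  interpret ga: graded_algebra K G A using G by (simp add: graded_gorenstein_artinian_algebra_def)
  interpret gor: gorenstein_artinian_local_ring G using G by (simp add: graded_gorenstein_artinian_algebra_def)
  interpret K: field K by (rule ga.base_field)
  interpret G: cring G by (rule ga.M_cring)
  note G_diff = abelian_group.diff_eq_zero_iff[OF ring.is_abelian_group[OF cring.axioms(1)[OF ga.M_cring]]]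
  define s where "s c = c \<odot>\<^bsub>G\<^esub> \<one>\<^bsub>G\<^esub>" for c
  have bij: "bij_betw s (carrier K) (A 0)" using ga.component_zero unfolding s_def .
  have sc: "s c \<in> carrier G" if "c \<in> carrier K" for c using that by (simp add: s_def)
  have s_mult: "s (c \<otimes>\<^bsub>K\<^esub> d) = s c \<otimes>\<^bsub>G\<^esub> s d" if "c \<in> carrier K" "d \<in> carrier K" for c d
    using that by (simp add: s_def ga.smult_assoc1 ga.smult_assoc2)
  have s_hom: "s \<in> ring_hom K G"
    by (rule ring_hom_memI) (use sc s_mult in \<open>auto simp: s_def ga.smult_l_distr\<close>)
  interpret s: ring_hom_cring K G s
    by (intro ring_hom_cring.intro ring_hom_cring_axioms.intro s_hom ga.R_cring ga.M_cring)
  have sA: "s c \<in> A 0" if "c \<in> carrier K" for c using that bij bij_betwE by metis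
  interpret graded_artinian_ring G A
  proof (intro graded_artinian_ring.intro graded_artinian_ring_axioms.intro)
    show "cring G" by (rule ga.M_cring)
    show "\<one>\<^bsub>G\<^esub> \<in> A 0" using sA[of "\<one>\<^bsub>K\<^esub>"] by simp
    show "\<one>\<^bsub>G\<^esub> \<noteq> \<zero>\<^bsub>G\<^esub>"
    proof
      assume "\<one>\<^bsub>G\<^esub> = \<zero>\<^bsub>G\<^esub>"
      then have "s \<one>\<^bsub>K\<^esub> = s \<zero>\<^bsub>K\<^esub>" by simp
      then have "\<one>\<^bsub>K\<^esub> = \<zero>\<^bsub>K\<^esub>" using inj_onD[OF bij_betw_imp_inj_on[OF bij]] by blast
      then show False by simp
    qed
    show "\<exists>y\<in>A 0. x \<otimes>\<^bsub>G\<^esub> y = \<one>\<^bsub>G\<^esub>" if x: "x \<in> A 0" "x \<noteq> \<zero>\<^bsub>G\<^esub>" for x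
    proof -
      obtain c where c: "c \<in> carrier K" "x = s c" using x bij unfolding bij_betw_def by blast
      have "c \<noteq> \<zero>\<^bsub>K\<^esub>" using c x by auto
      then have cu: "c \<in> Units K" using c K.field_Units by auto
      then have "x \<otimes>\<^bsub>G\<^esub> s (inv\<^bsub>K\<^esub> c) = \<one>\<^bsub>G\<^esub>" using c s_mult[of c "inv\<^bsub>K\<^esub> c"] by simp
      then show ?thesis using sA cu by blast
    qed
  qed (use ga.component_subgroup ga.component_mult ga.direct_sum gor.descending_chain in auto)
  define \<pi> where "\<pi> = algebra_residue K G"
  have key: "\<pi> x \<in> carrier K \<and> s (\<pi> x) = component 0 x" if x: "x \<in> carrier G" for x
  proof -
    have eq: "x \<ominus>\<^bsub>G\<^esub> s c \<in> max_ideal G \<longleftrightarrow> s c = component 0 x" if "c \<in> carrier K" for c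
    proof -
      have "component 0 (x \<ominus>\<^bsub>G\<^esub> s c) = component 0 x \<ominus>\<^bsub>G\<^esub> s c"
        using component_diff[OF x sc[OF that], of 0] component_homogeneous[OF sA[OF that], of 0] by simp
      then have "x \<ominus>\<^bsub>G\<^esub> s c \<in> max_ideal G \<longleftrightarrow> component 0 x \<ominus>\<^bsub>G\<^esub> s c = \<zero>\<^bsub>G\<^esub>"
        using x sc[OF that] by (simp add: max_ideal_eq degree_ge_def)
      then show ?thesis using G_diff[OF component_closed[OF x] sc[OF that], of 0] by auto
    qed
    have "\<exists>!c. c \<in> carrier K \<and> s c = component 0 x"
    proof -
      obtain c where c: "c \<in> carrier K" "s c = component 0 x"
        using bij_betw_imp_surj_on[OF bij] component_mem[OF x, of 0] by (metis imageE)
      show ?thesis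
        by (rule ex1I[of _ c]) (use c inj_onD[OF bij_betw_imp_inj_on[OF bij]] in auto)
    qed
    then have "\<exists>!c. c \<in> carrier K \<and> x \<ominus>\<^bsub>G\<^esub> s c \<in> max_ideal G" using eq by blast
    from theI'[OF this] show ?thesis
      unfolding \<pi>_def algebra_residue_def s_def[symmetric] using eq by blast
  qed
  have inj: "c = d" if "c \<in> carrier K" "d \<in> carrier K" "s c = s d" for c d
    using that bij by (auto simp: bij_betw_def inj_on_def)
  have "graded_residue_ring G A K s \<pi>"
  proof (intro graded_residue_ring.intro graded_residue_ring_axioms.intro)
    show "graded_artinian_ring G A" by unfold_locales
    show "cring K" by (rule ga.R_cring)
    show "\<pi> \<in> ring_hom G K"
    proof (rule ring_hom_memI)
      fix x y assume xy: "x \<in> carrier G" "y \<in> carrier G"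
      show "\<pi> (x \<otimes>\<^bsub>G\<^esub> y) = \<pi> x \<otimes>\<^bsub>K\<^esub> \<pi> y"
        by (rule inj) (use key xy s_mult component_0_mult in auto)
      show "\<pi> (x \<oplus>\<^bsub>G\<^esub> y) = \<pi> x \<oplus>\<^bsub>K\<^esub> \<pi> y"
        by (rule inj) (use key xy component_add in auto)
    next
      show "\<pi> \<one>\<^bsub>G\<^esub> = \<one>\<^bsub>K\<^esub>"
        by (rule inj) (use key component_0_one in auto)
    qed (use key in auto)
    show "\<pi> (s c) = c" if c: "c \<in> carrier K" for c
      by (rule inj) (use key sc[OF c] c component_homogeneous[OF sA[OF c], of 0] in auto)
  qed (use s_hom sA key in auto)
  then show ?thesis unfolding s_def \<pi>_def .
qed

locale fibre_family =
  fixes I :: "'i set" and R :: "'i \<Rightarrow> ('a, 'm) ring_scheme" and K :: "('k, 'l) ring_scheme"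
    and \<pi> :: "'i \<Rightarrow> 'a \<Rightarrow> 'k"
  assumes factor_cring: "i \<in> I \<Longrightarrow> cring (R i)"
    and base_cring: "cring K"
    and factor_hom: "i \<in> I \<Longrightarrow> \<pi> i \<in> ring_hom (R i) K"
begin

abbreviation F where "F \<equiv> fibre_product I R \<pi>"

lemma fibre_carrier_iff:
  "x \<in> carrier F \<longleftrightarrow> x \<in> extensional I \<and> (\<forall>i\<in>I. x i \<in> carrier (R i)) \<and> (\<forall>i\<in>I. \<forall>j\<in>I. \<pi> i (x i) = \<pi> j (x j))"
  by (auto simp: fibre_product_def PiE_def extensional_def)

lemma fibre_entry: "\<lbrakk>x \<in> carrier F; i \<in> I\<rbrakk> \<Longrightarrow> x i \<in> carrier (R i)"
  unfolding fibre_carrier_iff by blast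

lemma fibre_carrierI:
  assumes "x \<in> extensional I" "\<And>i. i \<in> I \<Longrightarrow> x i \<in> carrier (R i)"
    and "\<And>i j. i \<in> I \<Longrightarrow> j \<in> I \<Longrightarrow> \<pi> i (x i) = \<pi> j (x j)"
  shows "x \<in> carrier F"
  unfolding fibre_carrier_iff using assms by blast

lemma fibre_mult: "i \<in> I \<Longrightarrow> (x \<otimes>\<^bsub>F\<^esub> y) i = x i \<otimes>\<^bsub>R i\<^esub> y i"
  and fibre_add: "i \<in> I \<Longrightarrow> (x \<oplus>\<^bsub>F\<^esub> y) i = x i \<oplus>\<^bsub>R i\<^esub> y i"
  and fibre_one: "i \<in> I \<Longrightarrow> \<one>\<^bsub>F\<^esub> i = \<one>\<^bsub>R i\<^esub>"
  and fibre_zero: "i \<in> I \<Longrightarrow> \<zero>\<^bsub>F\<^esub> i = \<zero>\<^bsub>R i\<^esub>"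
  by (simp_all add: fibre_product_def)

lemma fibre_ext:
  assumes "x \<in> carrier F" "y \<in> carrier F" "\<And>i. i \<in> I \<Longrightarrow> x i = y i" shows "x = y"
  using assms unfolding fibre_carrier_iff by (blast intro: extensionalityI)

lemma factor_hom_cring: "i \<in> I \<Longrightarrow> ring_hom_cring (R i) K (\<pi> i)"
  by (intro ring_hom_cring.intro ring_hom_cring_axioms.intro factor_cring base_cring factor_hom)

lemma fibre_closed:
  assumes "x \<in> carrier F" "y \<in> carrier F"
  shows fibre_mult_closed: "x \<otimes>\<^bsub>F\<^esub> y \<in> carrier F" and fibre_add_closed: "x \<oplus>\<^bsub>F\<^esub> y \<in> carrier F"
proof -
  have h: "\<pi> i (x i \<otimes>\<^bsub>R i\<^esub> y i) = \<pi> i (x i) \<otimes>\<^bsub>K\<^esub> \<pi> i (y i)" "\<pi> i (x i \<oplus>\<^bsub>R i\<^esub> y i) = \<pi> i (x i) \<oplus>\<^bsub>K\<^esub> \<pi> i (y i)"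
    if "i \<in> I" for i
    using ring_hom_mult[OF factor_hom[OF that]] ring_hom_add[OF factor_hom[OF that]] assms fibre_entry that by auto
  have e: "x \<otimes>\<^bsub>F\<^esub> y \<in> extensional I" "x \<oplus>\<^bsub>F\<^esub> y \<in> extensional I" by (auto simp: fibre_product_def)
  have c: "x i \<otimes>\<^bsub>R i\<^esub> y i \<in> carrier (R i)" "x i \<oplus>\<^bsub>R i\<^esub> y i \<in> carrier (R i)" if "i \<in> I" for i
  proof -
    interpret Ri: cring "R i" using factor_cring that .
    show "x i \<otimes>\<^bsub>R i\<^esub> y i \<in> carrier (R i)" "x i \<oplus>\<^bsub>R i\<^esub> y i \<in> carrier (R i)"
      using assms fibre_entry that by auto
  qed
  have p: "\<pi> i (x i) = \<pi> j (x j)" "\<pi> i (y i) = \<pi> j (y j)" if "i \<in> I" "j \<in> I" for i j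
    using assms that unfolding fibre_carrier_iff by blast+
  have eq: "\<pi> i (x i \<otimes>\<^bsub>R i\<^esub> y i) = \<pi> j (x j \<otimes>\<^bsub>R j\<^esub> y j)" "\<pi> i (x i \<oplus>\<^bsub>R i\<^esub> y i) = \<pi> j (x j \<oplus>\<^bsub>R j\<^esub> y j)"
    if "i \<in> I" "j \<in> I" for i j
    unfolding h[OF that(1)] h[OF that(2)] p[OF that] by (rule refl)+
  show "x \<otimes>\<^bsub>F\<^esub> y \<in> carrier F"
  proof (rule fibre_carrierI)
    show "\<pi> i ((x \<otimes>\<^bsub>F\<^esub> y) i) = \<pi> j ((x \<otimes>\<^bsub>F\<^esub> y) j)" if "i \<in> I" "j \<in> I" for i j
      unfolding fibre_mult[OF that(1)] fibre_mult[OF that(2)] by (rule eq(1)[OF that])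
  qed (simp_all add: fibre_mult e c)
  show "x \<oplus>\<^bsub>F\<^esub> y \<in> carrier F"
  proof (rule fibre_carrierI)
    show "\<pi> i ((x \<oplus>\<^bsub>F\<^esub> y) i) = \<pi> j ((x \<oplus>\<^bsub>F\<^esub> y) j)" if "i \<in> I" "j \<in> I" for i j
      unfolding fibre_add[OF that(1)] fibre_add[OF that(2)] by (rule eq(2)[OF that])
  qed (simp_all add: fibre_add e c)
qed

lemma fibre_zero_closed: "\<zero>\<^bsub>F\<^esub> \<in> carrier F"
proof -
  have "\<pi> i \<zero>\<^bsub>R i\<^esub> = \<zero>\<^bsub>K\<^esub>" "\<zero>\<^bsub>R i\<^esub> \<in> carrier (R i)" if "i \<in> I" for i
    using ring_hom_cring.hom_zero[OF factor_hom_cring[OF that]] cring.cring_simprules(2)[OF factor_cring[OF that]] by auto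
  then show ?thesis by (intro fibre_carrierI) (simp_all add: fibre_zero, simp add: fibre_product_def)
qed

lemma fibre_one_closed: "\<one>\<^bsub>F\<^esub> \<in> carrier F"
proof -
  have "\<pi> i \<one>\<^bsub>R i\<^esub> = \<one>\<^bsub>K\<^esub>" "\<one>\<^bsub>R i\<^esub> \<in> carrier (R i)" if "i \<in> I" for i
    using ring_hom_one[OF factor_hom[OF that]] cring.cring_simprules(6)[OF factor_cring[OF that]] by auto
  then show ?thesis by (intro fibre_carrierI) (simp_all add: fibre_one, simp add: fibre_product_def)
qed

lemma fibre_product_cring: "cring F"
proof (intro cringI abelian_groupI comm_monoidI)
  note cl = fibre_closed fibre_zero_closed fibre_one_closed
  fix x y z assume xyz: "x \<in> carrier F" "y \<in> carrier F" "z \<in> carrier F"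
  have laws:
    "x i \<oplus>\<^bsub>R i\<^esub> y i \<oplus>\<^bsub>R i\<^esub> z i = x i \<oplus>\<^bsub>R i\<^esub> (y i \<oplus>\<^bsub>R i\<^esub> z i)"
    "x i \<otimes>\<^bsub>R i\<^esub> y i \<otimes>\<^bsub>R i\<^esub> z i = x i \<otimes>\<^bsub>R i\<^esub> (y i \<otimes>\<^bsub>R i\<^esub> z i)"
    "x i \<oplus>\<^bsub>R i\<^esub> y i = y i \<oplus>\<^bsub>R i\<^esub> x i" "x i \<otimes>\<^bsub>R i\<^esub> y i = y i \<otimes>\<^bsub>R i\<^esub> x i"
    "(x i \<oplus>\<^bsub>R i\<^esub> y i) \<otimes>\<^bsub>R i\<^esub> z i = x i \<otimes>\<^bsub>R i\<^esub> z i \<oplus>\<^bsub>R i\<^esub> y i \<otimes>\<^bsub>R i\<^esub> z i"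
    "\<zero>\<^bsub>R i\<^esub> \<oplus>\<^bsub>R i\<^esub> x i = x i" "\<one>\<^bsub>R i\<^esub> \<otimes>\<^bsub>R i\<^esub> x i = x i"
    "\<ominus>\<^bsub>R i\<^esub> x i \<in> carrier (R i)" "\<ominus>\<^bsub>R i\<^esub> x i \<oplus>\<^bsub>R i\<^esub> x i = \<zero>\<^bsub>R i\<^esub>"
    if "i \<in> I" for i
  proof -
    interpret Ri: cring "R i" using factor_cring that .
    note c = fibre_entry[OF xyz(1) that] fibre_entry[OF xyz(2) that] fibre_entry[OF xyz(3) that]
    show "x i \<oplus>\<^bsub>R i\<^esub> y i \<oplus>\<^bsub>R i\<^esub> z i = x i \<oplus>\<^bsub>R i\<^esub> (y i \<oplus>\<^bsub>R i\<^esub> z i)"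
      "x i \<otimes>\<^bsub>R i\<^esub> y i \<otimes>\<^bsub>R i\<^esub> z i = x i \<otimes>\<^bsub>R i\<^esub> (y i \<otimes>\<^bsub>R i\<^esub> z i)"
      "x i \<oplus>\<^bsub>R i\<^esub> y i = y i \<oplus>\<^bsub>R i\<^esub> x i" "x i \<otimes>\<^bsub>R i\<^esub> y i = y i \<otimes>\<^bsub>R i\<^esub> x i"
      "(x i \<oplus>\<^bsub>R i\<^esub> y i) \<otimes>\<^bsub>R i\<^esub> z i = x i \<otimes>\<^bsub>R i\<^esub> z i \<oplus>\<^bsub>R i\<^esub> y i \<otimes>\<^bsub>R i\<^esub> z i"
      "\<zero>\<^bsub>R i\<^esub> \<oplus>\<^bsub>R i\<^esub> x i = x i" "\<one>\<^bsub>R i\<^esub> \<otimes>\<^bsub>R i\<^esub> x i = x i"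
      "\<ominus>\<^bsub>R i\<^esub> x i \<in> carrier (R i)" "\<ominus>\<^bsub>R i\<^esub> x i \<oplus>\<^bsub>R i\<^esub> x i = \<zero>\<^bsub>R i\<^esub>"
      using c by (simp_all add: Ri.a_ac Ri.m_ac Ri.r_distr Ri.r_neg)
  qed
  show "x \<oplus>\<^bsub>F\<^esub> y \<in> carrier F" "x \<otimes>\<^bsub>F\<^esub> y \<in> carrier F" using xyz cl by auto
  show "x \<oplus>\<^bsub>F\<^esub> y \<oplus>\<^bsub>F\<^esub> z = x \<oplus>\<^bsub>F\<^esub> (y \<oplus>\<^bsub>F\<^esub> z)"
    by (rule fibre_ext) (simp_all add: xyz cl fibre_add laws(1))
  show "x \<otimes>\<^bsub>F\<^esub> y \<otimes>\<^bsub>F\<^esub> z = x \<otimes>\<^bsub>F\<^esub> (y \<otimes>\<^bsub>F\<^esub> z)"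
    by (rule fibre_ext) (simp_all add: xyz cl fibre_mult laws(2))
  show "x \<oplus>\<^bsub>F\<^esub> y = y \<oplus>\<^bsub>F\<^esub> x"
    by (rule fibre_ext) (simp_all add: xyz cl fibre_add laws(3))
  show "x \<otimes>\<^bsub>F\<^esub> y = y \<otimes>\<^bsub>F\<^esub> x"
    by (rule fibre_ext) (simp_all add: xyz cl fibre_mult laws(4))
  show "(x \<oplus>\<^bsub>F\<^esub> y) \<otimes>\<^bsub>F\<^esub> z = x \<otimes>\<^bsub>F\<^esub> z \<oplus>\<^bsub>F\<^esub> y \<otimes>\<^bsub>F\<^esub> z"
    by (rule fibre_ext) (simp_all add: xyz cl fibre_mult fibre_add laws(5))
  show "\<zero>\<^bsub>F\<^esub> \<oplus>\<^bsub>F\<^esub> x = x"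
    by (rule fibre_ext) (simp_all add: xyz cl fibre_zero fibre_add laws(6))
  show "\<one>\<^bsub>F\<^esub> \<otimes>\<^bsub>F\<^esub> x = x"
    by (rule fibre_ext) (simp_all add: xyz cl fibre_one fibre_mult laws(7))
  show "\<exists>y\<in>carrier F. y \<oplus>\<^bsub>F\<^esub> x = \<zero>\<^bsub>F\<^esub>"
  proof
    let ?y = "\<lambda>i\<in>I. \<ominus>\<^bsub>R i\<^esub> x i"
    have n: "\<pi> i (\<ominus>\<^bsub>R i\<^esub> x i) = \<ominus>\<^bsub>K\<^esub> \<pi> i (x i)" if "i \<in> I" for i
      using ring_hom_cring.hom_a_inv[OF factor_hom_cring[OF that]] fibre_entry[OF xyz(1) that] by auto
    have p: "\<pi> i (x i) = \<pi> j (x j)" if "i \<in> I" "j \<in> I" for i j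
      using xyz that unfolding fibre_carrier_iff by blast
    show y: "?y \<in> carrier F"
    proof (rule fibre_carrierI)
      show "\<pi> i (?y i) = \<pi> j (?y j)" if "i \<in> I" "j \<in> I" for i j
        using n[OF that(1)] n[OF that(2)] p[OF that] that by (simp only: restrict_apply' simp_thms)
    qed (simp_all add: laws(8))
    show "?y \<oplus>\<^bsub>F\<^esub> x = \<zero>\<^bsub>F\<^esub>"
      by (rule fibre_ext) (simp_all only: xyz cl y, simp add: fibre_zero fibre_add laws(9))
  qed
qed (use fibre_zero_closed fibre_one_closed in auto)

sublocale F: cring F by (rule fibre_product_cring)

lemma projection_hom: "i \<in> I \<Longrightarrow> (\<lambda>x. x i) \<in> ring_hom F (R i)"
  by (intro ring_hom_memI) (auto simp: fibre_mult fibre_add fibre_one fibre_entry)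

lemma projection_hom_cring: "i \<in> I \<Longrightarrow> ring_hom_cring F (R i) (\<lambda>x. x i)"
  by (intro ring_hom_cring.intro ring_hom_cring_axioms.intro factor_cring fibre_product_cring projection_hom)

lemma fibre_uminus: "\<lbrakk>i \<in> I; x \<in> carrier F\<rbrakk> \<Longrightarrow> (\<ominus>\<^bsub>F\<^esub> x) i = \<ominus>\<^bsub>R i\<^esub> x i"
  using ring_hom_cring.hom_a_inv[OF projection_hom_cring] by simp

lemma fibre_minus: "\<lbrakk>i \<in> I; x \<in> carrier F; y \<in> carrier F\<rbrakk> \<Longrightarrow> (x \<ominus>\<^bsub>F\<^esub> y) i = x i \<ominus>\<^bsub>R i\<^esub> y i"
  by (simp add: a_minus_def fibre_add fibre_uminus)

lemma single_entry_closed: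
  assumes "i \<in> I" "a \<in> carrier (R i)" "\<pi> i a = \<zero>\<^bsub>K\<^esub>"
  shows "single_entry I R i a \<in> carrier F"
proof -
  have "\<pi> j \<zero>\<^bsub>R j\<^esub> = \<zero>\<^bsub>K\<^esub>" "\<zero>\<^bsub>R j\<^esub> \<in> carrier (R j)" if "j \<in> I" for j
    using ring_hom_cring.hom_zero[OF factor_hom_cring[OF that]] cring.cring_simprules(2)[OF factor_cring[OF that]] by auto
  then show ?thesis using assms by (intro fibre_carrierI) (auto simp: single_entry_def)
qed

lemma connected_sum_ideal_ideal:
  assumes "\<And>i. i \<in> I \<Longrightarrow> \<delta> i \<in> carrier (R i)" "\<And>i. i \<in> I \<Longrightarrow> \<pi> i (\<delta> i) = \<zero>\<^bsub>K\<^esub>"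
  shows "ideal (connected_sum_ideal I R \<pi> \<delta>) F"
    and "i \<in> I \<Longrightarrow> j \<in> I \<Longrightarrow>
      single_entry I R i (\<delta> i) \<ominus>\<^bsub>F\<^esub> single_entry I R j (\<delta> j) \<in> connected_sum_ideal I R \<pi> \<delta>"
    and "\<lbrakk>ideal J F; \<And>i j. i \<in> I \<Longrightarrow> j \<in> I \<Longrightarrow>
      single_entry I R i (\<delta> i) \<ominus>\<^bsub>F\<^esub> single_entry I R j (\<delta> j) \<in> J\<rbrakk> \<Longrightarrow> connected_sum_ideal I R \<pi> \<delta> \<subseteq> J"
proof -
  let ?gen = "{single_entry I R i (\<delta> i) \<ominus>\<^bsub>F\<^esub> single_entry I R j (\<delta> j) | i j. i \<in> I \<and> j \<in> I}"
  have sub: "?gen \<subseteq> carrier F" using single_entry_closed assms by (auto intro!: F.minus_closed)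
  show "ideal (connected_sum_ideal I R \<pi> \<delta>) F"
    unfolding connected_sum_ideal_def by (rule F.genideal_ideal[OF sub])
  show "single_entry I R i (\<delta> i) \<ominus>\<^bsub>F\<^esub> single_entry I R j (\<delta> j) \<in> connected_sum_ideal I R \<pi> \<delta>" if "i \<in> I" "j \<in> I" for i j
    using F.genideal_self[OF sub] that unfolding connected_sum_ideal_def by blast
  show "connected_sum_ideal I R \<pi> \<delta> \<subseteq> J" if "ideal J F" "\<And>i j. i \<in> I \<Longrightarrow> j \<in> I \<Longrightarrow>
      single_entry I R i (\<delta> i) \<ominus>\<^bsub>F\<^esub> single_entry I R j (\<delta> j) \<in> J"
    unfolding connected_sum_ideal_def by (rule F.genideal_minimal[OF that(1)]) (use that(2) in blast)
qed

end

section \<open>Orthogonal splittings of the maximal ideal\<close>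

text \<open>A nonzero element of \<open>U\<close> of largest possible lowest degree is annihilated by positive degrees, hence
lies in the socle; and the socle is one-dimensional.\<close>

lemma (in graded_artinian_ring) ideal_meets_socle:
  assumes U: "ideal U G" "U \<noteq> {\<zero>}" and \<delta>: "socle_generator G \<delta>"
  shows "socle G \<subseteq> U"
proof -
  interpret U: ideal U G by fact
  obtain N where N: "degree_ge N = {\<zero>}" using degree_ge_vanish by blast
  define P where "P n \<longleftrightarrow> (\<exists>x\<in>U. x \<in> degree_ge n \<and> x \<noteq> \<zero>)" for n
  have bound: "n < N" if "P n" for n
    using that N degree_ge_antimono[of N n] by (force simp: P_def not_less[symmetric])
  have "P 0" using U U.Icarr U.zero_closed by (auto simp: P_def degree_ge_0)
  then have PM: "P (GREATEST n. P n)" using bound by (intro GreatestI_nat[of P 0 N]) (auto intro: less_imp_le)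
  have max: "\<not> P (Suc (GREATEST n. P n))"
  proof
    assume "P (Suc (GREATEST n. P n))"
    then have "Suc (GREATEST n. P n) \<le> (GREATEST n. P n)"
      by (rule Greatest_le_nat[where b = N]) (use bound in \<open>auto intro: less_imp_le\<close>)
    then show False by simp
  qed
  obtain x where x: "x \<in> U" "x \<in> degree_ge (GREATEST n. P n)" "x \<noteq> \<zero>" using PM P_def by blast
  have "x \<otimes> y = \<zero>" if y: "y \<in> degree_ge 1" for y
    using degree_ge_mult[OF x(2) y] max U.I_r_closed[OF x(1)] degree_ge_closed[OF y] by (auto simp: P_def)
  then have xs: "x \<in> socle G" using x U.Icarr by (auto simp: socle_eq)
  show ?thesis
  proof
    fix w assume "w \<in> socle G"
    then obtain c where "c \<in> A 0" "w = c \<otimes> x" using socle_line[OF \<delta> xs x(3)] by blast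
    then show "w \<in> U" using U.I_l_closed x A_carrier by blast
  qed
qed

lemma (in graded_artinian_ring) socle_le_degree_ge_1:
  assumes \<delta>: "socle_generator G \<delta>"
    and cube: "\<exists>x\<in>degree_ge 1. \<exists>y\<in>degree_ge 1. \<exists>z\<in>degree_ge 1. x \<otimes> y \<otimes> z \<noteq> \<zero>"
  shows "socle G \<subseteq> degree_ge 1"
proof (rule ideal_meets_socle[OF degree_ge_ideal _ \<delta>])
  show "degree_ge 1 \<noteq> {\<zero>}"
  proof
    assume "degree_ge 1 = {\<zero>}"
    then have "\<zero> \<otimes> \<zero> \<otimes> \<zero> \<noteq> \<zero>"
      using cube by (simp only: bex_simps singleton_iff) blast
    then show False by simp
  qed
qed

definition subring_on :: "('a, 'm) ring_scheme \<Rightarrow> 'a set \<Rightarrow> 'a ring"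
  where "subring_on R H =
    \<lparr>carrier = H, mult = mult R, one = one R, zero = zero R, add = add R\<rparr>"

lemma subring_on_simps [simp]:
  "carrier (subring_on R H) = H" "mult (subring_on R H) = mult R" "one (subring_on R H) = one R"
  "zero (subring_on R H) = zero R" "add (subring_on R H) = add R"
  by (simp_all add: subring_on_def)

lemma (in cring) subring_on_cring:
  assumes "H \<subseteq> carrier R" "\<one> \<in> H" "\<zero> \<in> H"
    and "\<And>x y. x \<in> H \<Longrightarrow> y \<in> H \<Longrightarrow> x \<oplus> y \<in> H" "\<And>x y. x \<in> H \<Longrightarrow> y \<in> H \<Longrightarrow> x \<otimes> y \<in> H"
    and "\<And>x. x \<in> H \<Longrightarrow> \<ominus> x \<in> H"
  shows "cring (subring_on R H)"
proof (intro cringI abelian_groupI comm_monoidI)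
  show "\<exists>y\<in>carrier (subring_on R H). y \<oplus>\<^bsub>subring_on R H\<^esub> x = \<zero>\<^bsub>subring_on R H\<^esub>"
    if "x \<in> carrier (subring_on R H)" for x
    using that assms by (auto intro!: bexI[of _ "\<ominus> x"] simp: l_neg)
qed (use assms in \<open>auto simp: a_assoc m_assoc l_distr subset_eq intro: a_comm m_comm\<close>)

text \<open>The situation that indecomposability excludes. The subring \<open>S\<close> on \<open>H = k + U\<close> is one summand of the
connected sum; the other is obtained by exchanging \<open>U\<close> and \<open>V\<close> (\<open>swapped\<close>). Its ring theory is
inherited from \<open>G\<close> because an ideal of \<open>S\<close> inside \<open>U\<close> is an ideal of \<open>G\<close>: the complement \<open>V\<close> acts
on it by zero.\<close>

locale orthogonal_splitting = graded_residue_ring +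
  fixes U V \<delta>
  assumes generator: "socle_generator G \<delta>"
    and U_ideal: "ideal U G" and V_ideal: "ideal V G"
    and U_le: "U \<subseteq> degree_ge 1" and V_le: "V \<subseteq> degree_ge 1"
    and orthogonal: "\<lbrakk>u \<in> U; v \<in> V\<rbrakk> \<Longrightarrow> u \<otimes> v = \<zero>"
    and sum: "x \<in> degree_ge 1 \<Longrightarrow> \<exists>u\<in>U. \<exists>v\<in>V. x = u \<oplus> v"
    and U_large: "\<not> U \<subseteq> socle G" and V_large: "\<not> V \<subseteq> socle G"
begin

lemma swapped: "orthogonal_splitting G A K scalar \<pi> V U \<delta>"
proof (intro orthogonal_splitting.intro orthogonal_splitting_axioms.intro)
  show "v \<otimes> u = \<zero>" if "v \<in> V" "u \<in> U" for u v
    using orthogonal[OF that(2,1)] U_ideal V_ideal that ideal.Icarr m_comm by metis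
  show "\<exists>u\<in>V. \<exists>v\<in>U. x = u \<oplus> v" if "x \<in> degree_ge 1" for x
    using sum[OF that] U_ideal V_ideal ideal.Icarr a_comm by metis
qed (rule graded_residue_ring_axioms generator U_ideal V_ideal U_le V_le U_large V_large)+

sublocale U: ideal U G by (rule U_ideal)
sublocale V: ideal V G by (rule V_ideal)

definition H where "H = {x \<in> carrier G. x \<ominus> component 0 x \<in> U}"

abbreviation S where "S \<equiv> subring_on G H"

lemma component_0_U: "u \<in> U \<Longrightarrow> component 0 u = \<zero>"
  using U_le by (auto simp: degree_ge_def)

lemma U_sub_H: "u \<in> U \<Longrightarrow> u \<in> H"
  using component_0_U U.Icarr by (simp add: H_def minus_eq)

lemma A_sub_H: "c \<in> A 0 \<Longrightarrow> c \<in> H"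
  using component_homogeneous[of c 0 0] A_carrier by (simp add: H_def minus_eq r_neg)

lemma H_carrier: "x \<in> H \<Longrightarrow> x \<in> carrier G"
  by (simp add: H_def)

lemma H_add: "x \<in> H \<Longrightarrow> y \<in> H \<Longrightarrow> x \<oplus> y \<in> H"
proof -
  assume xy: "x \<in> H" "y \<in> H"
  then have c: "x \<in> carrier G" "y \<in> carrier G" "component 0 x \<in> carrier G" "component 0 y \<in> carrier G"
    by (auto simp: H_def)
  have "x \<oplus> y \<ominus> (component 0 x \<oplus> component 0 y) = (x \<ominus> component 0 x) \<oplus> (y \<ominus> component 0 y)"
    using c by algebra
  then show ?thesis using xy by (simp add: H_def component_add)
qed

lemma H_mult: "x \<in> H \<Longrightarrow> y \<in> H \<Longrightarrow> x \<otimes> y \<in> H"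
proof -
  assume xy: "x \<in> H" "y \<in> H"
  then have c: "x \<in> carrier G" "y \<in> carrier G" "component 0 x \<in> carrier G" "component 0 y \<in> carrier G"
    by (auto simp: H_def)
  have "x \<otimes> y \<ominus> (component 0 x \<otimes> component 0 y) =
      x \<otimes> (y \<ominus> component 0 y) \<oplus> (x \<ominus> component 0 x) \<otimes> component 0 y"
    using c by algebra
  also have "\<dots> \<in> U"
    using xy c by (intro U.a_closed U.I_l_closed U.I_r_closed) (auto simp: H_def)
  finally show ?thesis using c by (simp add: H_def component_0_mult)
qed

lemma H_minus: "x \<in> H \<Longrightarrow> \<ominus> x \<in> H"
  using H_mult[of "\<ominus> \<one>" x] A_sub_H[OF A_minus[OF one_degree]] H_carrier[of x] by (simp add: l_minus)

sublocale S: cring S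
  by (rule subring_on_cring)
    (use H_carrier H_add H_mult H_minus A_sub_H one_degree A_zero in auto)

lemma decompose:
  assumes "x \<in> carrier G" shows "\<exists>h\<in>H. \<exists>v\<in>V. x = h \<oplus> v"
proof -
  obtain u v where uv: "u \<in> U" "v \<in> V" "x \<ominus> component 0 x = u \<oplus> v"
    using sum[OF minus_component_0[OF assms]] by blast
  have c: "u \<in> carrier G" "v \<in> carrier G" "component 0 x \<in> carrier G"
    using uv U.Icarr V.Icarr assms by auto
  have "x = component 0 x \<oplus> (x \<ominus> component 0 x)" using assms c by algebra
  also have "\<dots> = (component 0 x \<oplus> u) \<oplus> v" unfolding uv(3) using c by (simp add: a_assoc)
  finally show ?thesis
    using uv H_add[OF A_sub_H[OF component_mem[OF assms]] U_sub_H[OF uv(1)]] by blast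
qed

lemma S_ideal_imp_ideal:
  assumes J: "ideal J S" and JU: "J \<subseteq> U" shows "ideal J G"
proof (rule commutative_idealI)
  interpret J: ideal J S by fact
  show "J \<subseteq> carrier G" using JU U.Icarr by blast
  show "\<zero> \<in> J" using J.zero_closed by simp
  show "x \<oplus> y \<in> J" if "x \<in> J" "y \<in> J" for x y using J.a_closed[OF that] by simp
  show "r \<otimes> x \<in> J" if r: "r \<in> carrier G" and x: "x \<in> J" for r x
  proof -
    obtain h v where hv: "h \<in> H" "v \<in> V" "r = h \<oplus> v" using decompose[OF r] by blast
    have c: "h \<in> carrier G" "v \<in> carrier G" "x \<in> carrier G"
      using hv H_carrier V.Icarr U.Icarr JU x by auto
    have "v \<otimes> x = \<zero>" using orthogonal[of x v] hv x JU c m_comm[of x v] by auto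
    then have "r \<otimes> x = h \<otimes> x" unfolding hv(3) using c by (simp add: l_distr)
    then show ?thesis using J.I_l_closed[of x h] x hv by simp
  qed
qed

lemma ideal_imp_S_ideal:
  assumes J: "ideal J G" and JU: "J \<subseteq> U" shows "ideal J S"
proof (rule S.commutative_idealI)
  interpret J: ideal J G by fact
  show "J \<subseteq> carrier S" using JU U_sub_H by auto
qed (use ideal.axioms(1)[OF J] additive_subgroup.zero_closed additive_subgroup.a_closed
    ideal.I_l_closed[OF J] H_carrier in auto)

text \<open>If \<open>x y = 1\<close> in \<open>G\<close> and \<open>c\<close>, \<open>d\<close> are the degree-zero components of \<open>x\<close>, \<open>y\<close>, then \<open>c d = 1\<close> and
\<open>y - d = - (x - c) y d\<close>, which lies in \<open>U\<close>.\<close>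

lemma S_unit:
  assumes x: "x \<in> H" "x \<notin> U" shows "x \<in> Units S"
proof -
  have xc: "x \<in> carrier G" using x H_carrier by blast
  have "component 0 x \<noteq> \<zero>" using x xc by (auto simp: H_def minus_eq)
  then have "x \<in> Units G" using unit_if_component_0 xc by blast
  then obtain y where y: "y \<in> carrier G" "x \<otimes> y = \<one>" unfolding Units_def by blast
  have c: "component 0 x \<in> carrier G" "component 0 y \<in> carrier G" using xc y by auto
  have 1: "component 0 x \<otimes> component 0 y = \<one>"
    using component_0_mult[OF xc y(1)] y(2) component_0_one by simp
  have "y \<ominus> component 0 y = y \<otimes> (component 0 x \<otimes> component 0 y) \<ominus> (x \<otimes> y) \<otimes> component 0 y"
    unfolding 1 y(2) using c y by simp
  also have "\<dots> = \<ominus> ((x \<ominus> component 0 x) \<otimes> (y \<otimes> component 0 y))" using c xc y(1) by algebra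
  also have "\<dots> \<in> U" using x c y by (auto simp: H_def intro!: U.I_r_closed)
  finally have "y \<in> H" using y by (simp add: H_def)
  then show ?thesis using S.unit_memI[of x y] x y by simp
qed

lemma S_local: "\<exists>!M. maximalideal M S" and max_ideal_S: "max_ideal S = U"
proof -
  have "\<one> \<notin> U" using component_0_U component_0_one one_nonzero by auto
  then have 1: "ideal U S" "U \<noteq> carrier S"
    using ideal_imp_S_ideal[OF U_ideal] A_sub_H[OF one_degree] by auto
  have 2: "x \<in> Units S" if "x \<in> carrier S" "x \<notin> U" for x using S_unit that by simp
  show "\<exists>!M. maximalideal M S" "max_ideal S = U"
    using S.nonunits_unique_maximal[OF 1 2] by auto
qed

text \<open>A proper ideal of \<open>S\<close> lies in \<open>U\<close> and is therefore an ideal of \<open>G\<close>; so a chain that is not constantly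
\<open>H\<close> becomes a chain of ideals of \<open>G\<close>.\<close>

lemma S_dcc:
  assumes C: "\<And>n. ideal (C n) S" "\<And>n. C (Suc n) \<subseteq> C n"
  shows "\<exists>n. \<forall>m\<ge>n. C m = C n"
proof (cases "\<forall>n. C n = H")
  case False
  then obtain k where k: "C k \<noteq> H" by blast
  have anti: "C n \<subseteq> C m" if "m \<le> n" for m n
    using C(2) that by (rule lift_Suc_antimono_le)
  have "C k \<subseteq> U"
    using k S_unit ideal.unit_imp_carrier[OF C(1)] ideal.Icarr[OF C(1)] by (metis subsetI subring_on_simps(1))
  then have "ideal (C (k + n)) G" for n
    using S_ideal_imp_ideal[OF C(1)] anti[of k "k + n"] by auto
  then obtain n where n: "\<forall>m\<ge>n. C (k + m) = C (k + n)" using dcc[of "\<lambda>n. C (k + n)"] C(2) by auto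
  have "C m = C (k + n)" if "m \<ge> k + n" for m
    using n[rule_format, of "m - k"] that by auto
  then show ?thesis by blast
qed auto

lemma socle_le_U: "socle G \<subseteq> U"
proof (rule ideal_meets_socle[OF U_ideal _ generator])
  show "U \<noteq> {\<zero>}" using U_large socle_generator_nonzero ideal.axioms(1)[OF socle_ideal] additive_subgroup.zero_closed by blast
qed

text \<open>An element of \<open>U\<close> that is annihilated by \<open>U\<close> is also annihilated by \<open>V\<close>, hence by the whole maximal
ideal. A unit of \<open>S\<close> does not annihilate \<open>U\<close>, because \<open>U\<close> is not zero.\<close>

lemma socle_S: "socle S = socle G"
proof
  show "socle S \<subseteq> socle G"
  proof
    fix x assume "x \<in> socle S"
    then have x: "x \<in> H" "\<And>y. y \<in> U \<Longrightarrow> x \<otimes> y = \<zero>" by (auto simp: socle_def max_ideal_S)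
    have xc: "x \<in> carrier G" using x H_carrier by blast
    have xU: "x \<in> U"
    proof (rule ccontr)
      assume "x \<notin> U"
      then have "component 0 x \<noteq> \<zero>" using x xc by (auto simp: H_def minus_eq)
      then obtain z where z: "z \<in> carrier G" "z \<otimes> x = \<one>"
        using unit_if_component_0[OF xc] unfolding Units_def by blast
      have "y = \<zero>" if "y \<in> U" for y
      proof -
        have yc: "y \<in> carrier G" using that U.Icarr by blast
        have "y = (z \<otimes> x) \<otimes> y" using z yc by simp
        also have "\<dots> = z \<otimes> (x \<otimes> y)" by (rule m_assoc[OF z(1) xc yc])
        finally show ?thesis using x(2)[OF that] z by simp
      qed
      then show False using U_large additive_subgroup.zero_closed[OF ideal.axioms(1)[OF socle_ideal]] by blast
    qed
    have "x \<otimes> y = \<zero>" if y: "y \<in> degree_ge 1" for y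
    proof -
      obtain u v where uv: "u \<in> U" "v \<in> V" "y = u \<oplus> v" using sum y by blast
      have "x \<otimes> y = x \<otimes> u \<oplus> x \<otimes> v" unfolding uv(3) using xc uv U.Icarr V.Icarr by (simp add: r_distr)
      then show ?thesis using x(2) orthogonal[OF xU] uv by simp
    qed
    then show "x \<in> socle G" using xc by (simp add: socle_eq)
  qed
  show "socle G \<subseteq> socle S"
  proof
    fix x assume x: "x \<in> socle G"
    then have "x \<in> H" "\<forall>y\<in>U. x \<otimes> y = \<zero>"
      using socle_le_U U_sub_H U_le by (auto simp: socle_eq)
    then show "x \<in> socle S" by (simp add: socle_def[of S] max_ideal_S)
  qed
qed

lemma generator_S: "socle_generator S \<delta>"
proof -
  have d: "\<delta> \<in> socle G" "\<delta> \<in> carrier G" "\<delta> \<noteq> \<zero>" using socle_generator_nonzero[OF generator] by auto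
  have dH: "\<delta> \<in> H" using d socle_le_U U_sub_H by blast
  interpret soc: ideal "socle G" G by (rule socle_ideal)
  have "socle G = PIdl\<^bsub>S\<^esub> \<delta>"
  proof
    show "socle G \<subseteq> PIdl\<^bsub>S\<^esub> \<delta>"
      using socle_multiple[OF generator] A_sub_H by (fastforce simp: cgenideal_def)
    show "PIdl\<^bsub>S\<^esub> \<delta> \<subseteq> socle G"
      using d H_carrier by (auto simp: cgenideal_def intro: soc.I_l_closed)
  qed
  then show ?thesis unfolding socle_generator_def socle_S using d dH by simp
qed

lemma S_gorenstein: "gorenstein_artinian_local_ring S"
  by unfold_locales (use S_local S_dcc generator_S in auto)

lemma S_residue_map: "residue_map K S \<pi>"
proof -
  have "\<pi> \<in> ring_hom S K"
    by (rule ring_hom_memI) (use H_carrier in auto)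
  moreover have "\<exists>x\<in>H. c = \<pi> x" if "c \<in> carrier K" for c
    using A_sub_H[OF scalar_degree[OF that]] residue_scalar[OF that] by metis
  ultimately show ?thesis using H_carrier by (auto simp: residue_map_def image_iff)
qed

lemma square_U: "\<exists>x\<in>U. \<exists>y\<in>U. x \<otimes> y \<noteq> \<zero>"
proof (rule ccontr)
  assume no: "\<not> ?thesis"
  have "x \<in> socle G" if x: "x \<in> U" for x
  proof -
    have "x \<otimes> y = \<zero>" if y: "y \<in> degree_ge 1" for y
    proof -
      obtain u v where uv: "u \<in> U" "v \<in> V" "y = u \<oplus> v" using sum y by blast
      have "x \<otimes> y = x \<otimes> u \<oplus> x \<otimes> v" unfolding uv(3) using x uv U.Icarr V.Icarr by (simp add: r_distr)
      then show ?thesis using no x orthogonal[OF x] uv by simp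
    qed
    then show ?thesis using x U.Icarr by (simp add: socle_eq)
  qed
  then show False using U_large by blast
qed

lemma loewy_length_S: "loewy_length S \<ge> 2"
proof -
  let ?P = "\<lambda>n::nat. U [^]\<^bsub>ideals_set S\<^esub> n"
  have sub: "?P n \<subseteq> degree_ge n" for n
    by (rule S.ideal_power_subset)
      (use H_carrier U_le degree_ge_mult[of _ _ _ 1] degree_ge_add in \<open>auto simp: degree_ge_0\<close>)
  obtain N where N: "degree_ge N = {\<zero>}" using degree_ge_vanish by blast
  have id: "ideal (?P n) S" for n
    by (induction n)
      (auto simp: ideals_set_def intro: S.ideal_prod_is_ideal ideal_imp_S_ideal[OF U_ideal] S.oneideal[simplified])
  have PN: "?P n = {\<zero>}" if "N \<le> n" for n
    using sub[of n] additive_subgroup.zero_closed[OF ideal.axioms(1)[OF id[of n]]] degree_ge_antimono[OF that] N by auto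
  have fin: "finite {n. ?P n \<noteq> {\<zero>}}"
    by (rule finite_subset[of _ "{..N}"]) (use PN in \<open>auto simp: not_le intro: less_imp_le\<close>)
  obtain x y where xy: "x \<in> U" "y \<in> U" "x \<otimes> y \<noteq> \<zero>" using square_U by blast
  have P: "?P 0 = H" "?P (Suc n) = ideal_prod S (?P n) U" for n by (simp_all add: ideals_set_def)
  have "\<one> \<otimes>\<^bsub>S\<^esub> x \<in> ?P (Suc 0)"
    unfolding P by (rule ideal_prod.prod[OF _ xy(1)]) (use S.one_closed in simp)
  then have "\<one> \<otimes>\<^bsub>S\<^esub> x \<otimes>\<^bsub>S\<^esub> y \<in> ?P (Suc (Suc 0))"
    unfolding P(2)[of "Suc 0"] by (rule ideal_prod.prod[OF _ xy(2)])
  then have "?P 2 \<noteq> {\<zero>}" using xy U.Icarr by (auto simp: numeral_2_eq_2)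
  then show ?thesis
    unfolding loewy_length_def max_ideal_S using Max_ge[OF fin] by simp
qed

text \<open>An isomorphism \<open>g\<close> of \<open>G\<close> onto \<open>S\<close> maps the maximal ideal \<open>m\<close> onto \<open>U\<close>, and it maps ideals of \<open>G\<close>
inside \<open>m\<close> to ideals of \<open>S\<close> inside \<open>U\<close>, which are again ideals of \<open>G\<close>. So the iterated images of
\<open>m\<close> under \<open>g\<close> form a descending chain of ideals of \<open>G\<close>. It becomes stationary, and by injectivity of \<open>g\<close>
already its first step \<open>U \<subseteq> m\<close> is an equality. Then \<open>V\<close> is annihilated by all of \<open>m\<close>, against
\<open>V_large\<close>.\<close>

lemma S_not_iso: "\<not> S \<simeq> G"
proof
  assume "S \<simeq> G"
  then obtain h where h: "h \<in> ring_iso S G" unfolding is_ring_iso_def by blast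
  define g where "g = inv_into (carrier S) h"
  have g: "g \<in> ring_iso G S"
    unfolding g_def using ring_iso_set_sym[OF S.ring_axioms h] .
  note gE = ring_iso_memE[OF g, simplified]
  have inj: "inj_on g (carrier G)" using gE(5) by (simp add: bij_betw_def)
  have img: "g ` carrier G = H" using gE(5) by (simp add: bij_betw_def)
  have g_ideal: "ideal (g ` J) S" if "ideal J G" for J
  proof (rule S.commutative_idealI)
    interpret J: ideal J G by fact
    interpret g: ring_hom_cring G S g
      by (intro ring_hom_cring.intro ring_hom_cring_axioms.intro is_cring S.is_cring)
        (use g in \<open>simp add: ring_iso_def\<close>)
    show "g ` J \<subseteq> carrier S" using J.Icarr gE(1) by auto
    show "\<zero>\<^bsub>S\<^esub> \<in> g ` J" using imageI[OF J.zero_closed, of g] unfolding g.hom_zero .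
    show "x \<oplus>\<^bsub>S\<^esub> y \<in> g ` J" if "x \<in> g ` J" "y \<in> g ` J" for x y
    proof -
      have "x \<in> g ` J" "y \<in> g ` J" by (rule that)+
      then obtain a b where ab: "a \<in> J" "b \<in> J" "x = g a" "y = g b" by (elim imageE) (rule that)
      have "g (a \<oplus> b) \<in> g ` J" by (rule imageI) (rule J.a_closed[OF ab(1,2)])
      then show ?thesis
        unfolding ab(3,4) subring_on_simps gE(3)[OF J.Icarr[OF ab(1)] J.Icarr[OF ab(2)]] .
    qed
    show "r \<otimes>\<^bsub>S\<^esub> x \<in> g ` J" if "r \<in> carrier S" "x \<in> g ` J" for r x
    proof -
      have "r \<in> g ` carrier G" "x \<in> g ` J" using that img by simp_all
      then obtain s y where sy: "s \<in> carrier G" "r = g s" "y \<in> J" "x = g y"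
        by (elim imageE) (rule that)
      then have "r \<otimes>\<^bsub>S\<^esub> x = g (s \<otimes> y)" using gE(2)[OF sy(1) J.Icarr[OF sy(3)]] by simp
      then show ?thesis using J.I_l_closed[OF sy(3,1)] by blast
    qed
  qed
  have gm: "g ` degree_ge 1 = U"
  proof
    have "g ` degree_ge 1 \<noteq> H"
      using degree_ge_1_proper img inj degree_ge_closed
      by (metis inj_on_image_eq_iff subsetI order_refl)
    then show "g ` degree_ge 1 \<subseteq> U"
      using ideal.unit_imp_carrier[OF g_ideal[OF degree_ge_ideal[of 1]]] S_unit
        ideal.Icarr[OF g_ideal[OF degree_ge_ideal[of 1]]] by (metis subsetI subring_on_simps(1))
    show "U \<subseteq> g ` degree_ge 1"
    proof
      fix u assume u: "u \<in> U"
      then obtain x where x: "x \<in> carrier G" "u = g x" using img U_sub_H by blast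
      have "x \<in> degree_ge 1"
      proof (rule ccontr)
        assume "x \<notin> degree_ge 1"
        then obtain y where y: "y \<in> carrier G" "x \<otimes> y = \<one>"
          using not_degree_ge_1 x unfolding Units_def by blast
        have "g x \<otimes> g y = \<one>" using gE(2)[OF x(1) y(1)] y gE(4) by simp
        then have "\<one> \<in> U" using u x gE(1)[OF y(1)] H_carrier U.I_r_closed by metis
        then show False using component_0_U component_0_one one_nonzero by auto
      qed
      then show "u \<in> g ` degree_ge 1" using x by blast
    qed
  qed
  define J where "J n = (((`) g) ^^ n) (degree_ge 1)" for n
  have J_Suc: "J (Suc n) = g ` J n" for n by (simp add: J_def)
  have JJ: "ideal (J n) G \<and> J n \<subseteq> degree_ge 1" for n
  proof (induction n)
    case 0
    then show ?case by (simp add: J_def degree_ge_ideal)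
  next
    case (Suc n)
    then have "J (Suc n) \<subseteq> U" unfolding J_Suc using gm by blast
    then show ?case using S_ideal_imp_ideal g_ideal Suc U_le unfolding J_Suc by blast
  qed
  have J_anti: "J (Suc n) \<subseteq> J n" for n
  proof (induction n)
    case 0
    then show ?case using gm U_le by (simp add: J_def)
  qed (auto simp: J_Suc)
  obtain n where n: "J (Suc n) = J n" using dcc[of J] JJ J_anti by (metis le_SucI order_refl)
  have "J (Suc k) = J k \<Longrightarrow> J (Suc 0) = J 0" for k
  proof (induction k)
    case (Suc k)
    have "J k \<subseteq> carrier G" "J (Suc k) \<subseteq> carrier G" using JJ degree_ge_closed by blast+
    then have "J (Suc k) = J k" using Suc.prems inj_on_image_eq_iff[OF inj] unfolding J_Suc by metis
    then show ?case using Suc.IH by blast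
  qed
  then have "U = degree_ge 1" using n gm by (simp add: J_def)
  then have "v \<otimes> x = \<zero>" if "v \<in> V" "x \<in> degree_ge 1" for v x
    using orthogonal[of x v] that U.Icarr V.Icarr m_comm[of v x] by auto
  then have "V \<subseteq> socle G" using V.Icarr by (auto simp: socle_eq)
  then show False using V_large by blast
qed


text \<open>The map \<open>\<Phi>\<close> sends a pair \<open>(c + u, c + v)\<close> in the fibre product of \<open>k + U\<close> and \<open>k + V\<close> to
\<open>c + u + v\<close>. It is multiplicative because \<open>U V = 0\<close>. Its kernel consists of the pairs \<open>(u, - u)\<close> with \<open>u\<close> in
both \<open>U\<close> and \<open>V\<close>. Such a \<open>u\<close> is annihilated by \<open>U\<close> and by \<open>V\<close>, so it lies in the socle, and the kernel
is the ideal generated by \<open>(\<delta>, - \<delta>)\<close>. The single generator \<open>\<delta>\<close> of the socle of \<open>G\<close> serves both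
summands.\<close>

lemma decomposes: "decomposes_as_connected_sum K G"
proof -
  interpret W: orthogonal_splitting G A K scalar \<pi> V U \<delta> by (rule swapped)
  let ?I = "{1, 2} :: nat set"
  define R where "R i = (if i = 1 then S else W.S)" for i :: nat
  have R: "R 1 = S" "R 2 = W.S" "R (Suc 0) = S" by (auto simp: R_def)
  have two: "(1::nat) \<in> ?I" "(2::nat) \<in> ?I" by auto
  interpret FF: fibre_family ?I R K "\<lambda>_. \<pi>"
  proof (rule fibre_family.intro)
    show "cring K" by (rule residue_cring)
    show "cring (R i)" if "i \<in> ?I" for i using S.is_cring W.S.is_cring by (simp add: R_def)
    show "\<pi> \<in> ring_hom (R i) K" if "i \<in> ?I" for i
      using S_residue_map W.S_residue_map by (auto simp: R_def residue_map_def)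
  qed
  let ?F = "fibre_product ?I R (\<lambda>_. \<pi>)"
  let ?J = "connected_sum_ideal ?I R (\<lambda>_. \<pi>) (\<lambda>_. \<delta>)"
  define \<Phi> where "\<Phi> x = x 1 \<oplus> (x 2 \<ominus> component 0 (x 2))" for x :: "nat \<Rightarrow> 'a"
  have entries: "x 1 \<in> H" "x 2 \<in> W.H" "x 1 \<in> carrier G" "x 2 \<in> carrier G"
      "component 0 (x 1) = component 0 (x 2)"
      "x 1 \<ominus> component 0 (x 2) \<in> U" "x 2 \<ominus> component 0 (x 2) \<in> V" if x: "x \<in> carrier ?F" for x
  proof -
    show e: "x 1 \<in> H" "x 2 \<in> W.H"
      using FF.fibre_entry[OF x two(1)] FF.fibre_entry[OF x two(2)] by (simp_all add: R)
    then show c: "x 1 \<in> carrier G" "x 2 \<in> carrier G" using H_carrier W.H_carrier by auto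
    have "\<pi> (x 1) = \<pi> (x 2)" using x two unfolding FF.fibre_carrier_iff by blast
    then show "component 0 (x 1) = component 0 (x 2)" using residue_eq_iff c by blast
    then show "x 1 \<ominus> component 0 (x 2) \<in> U" "x 2 \<ominus> component 0 (x 2) \<in> V"
      using e by (auto simp: H_def W.H_def)
  qed
  have F_ops: "(x \<oplus>\<^bsub>?F\<^esub> y) 1 = x 1 \<oplus> y 1" "(x \<oplus>\<^bsub>?F\<^esub> y) 2 = x 2 \<oplus> y 2"
    "(x \<otimes>\<^bsub>?F\<^esub> y) 1 = x 1 \<otimes> y 1" "(x \<otimes>\<^bsub>?F\<^esub> y) 2 = x 2 \<otimes> y 2" for x y
    using FF.fibre_add[OF two(1)] FF.fibre_add[OF two(2)] FF.fibre_mult[OF two(1)] FF.fibre_mult[OF two(2)]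
    by (simp_all add: R)
  have F_memI: "x \<in> carrier ?F"
    if "x \<in> extensional ?I" "x 1 \<in> H" "x 2 \<in> W.H" "component 0 (x 1) = component 0 (x 2)" for x
  proof (rule FF.fibre_carrierI)
    have "\<pi> (x 1) = \<pi> (x 2)" using residue_eq_iff that H_carrier W.H_carrier by blast
    then show "\<pi> (x i) = \<pi> (x j)" if "i \<in> ?I" "j \<in> ?I" for i j using that by auto
  qed (use that R in auto)
  have hom: "\<Phi> \<in> ring_hom ?F G"
  proof (rule ring_hom_memI)
    fix x y assume x: "x \<in> carrier ?F" and y: "y \<in> carrier ?F"
    note ex = entries[OF x] and ey = entries[OF y]
    define c d where "c = component 0 (x 2)" and "d = component 0 (y 2)"
    have cc: "c \<in> carrier G" "d \<in> carrier G" using ex ey by (auto simp: c_def d_def)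
    show "\<Phi> x \<in> carrier G" using ex by (simp add: \<Phi>_def)
    show "\<Phi> (x \<oplus>\<^bsub>?F\<^esub> y) = \<Phi> x \<oplus> \<Phi> y"
      unfolding \<Phi>_def F_ops component_add[OF ex(4) ey(4)] c_def[symmetric] d_def[symmetric]
      using ex(3,4) ey(3,4) cc by algebra
    have 1: "(x 1 \<ominus> c) \<otimes> (y 2 \<ominus> d) = \<zero>" "(x 2 \<ominus> c) \<otimes> (y 1 \<ominus> d) = \<zero>"
      using orthogonal[OF ex(6) ey(7)] W.orthogonal[OF ex(7) ey(6)] by (auto simp: c_def d_def)
    (* With x 2 = c + v and y 2 = d + w, the product of the images differs from the image of the
       product by (x 1 - c) w and v (y 1 - d), which vanish by orthogonality. *)
    define v w where "v = x 2 \<ominus> c" and "w = y 2 \<ominus> d"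
    have vw: "v \<in> carrier G" "w \<in> carrier G" "x 2 = c \<oplus> v" "y 2 = d \<oplus> w"
    proof -
      show "v \<in> carrier G" "w \<in> carrier G" unfolding v_def w_def by (rule minus_closed[OF ex(4) cc(1)] minus_closed[OF ey(4) cc(2)])+
      show "x 2 = c \<oplus> v" unfolding v_def using ex(4) cc by algebra
      show "y 2 = d \<oplus> w" unfolding w_def using ey(4) cc by algebra
    qed
    have xy2: "x 2 \<otimes> y 2 \<ominus> c \<otimes> d = c \<otimes> w \<oplus> v \<otimes> d \<oplus> v \<otimes> w"
      unfolding vw(3,4) using vw(1,2) cc by algebra
    have "\<Phi> x \<otimes> \<Phi> y = x 1 \<otimes> y 1 \<oplus> x 1 \<otimes> w \<oplus> v \<otimes> y 1 \<oplus> v \<otimes> w"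
      unfolding \<Phi>_def c_def[symmetric] d_def[symmetric] v_def[symmetric] w_def[symmetric]
      using ex(3) ey(3) vw(1,2) by algebra
    also have "\<dots> = x 1 \<otimes> y 1 \<oplus> (c \<otimes> w \<oplus> v \<otimes> d \<oplus> v \<otimes> w)
        \<oplus> (x 1 \<ominus> c) \<otimes> w \<oplus> v \<otimes> (y 1 \<ominus> d)"
      using ex(3) ey(3) vw(1,2) cc by algebra
    also have "\<dots> = x 1 \<otimes> y 1 \<oplus> (x 2 \<otimes> y 2 \<ominus> c \<otimes> d)
        \<oplus> (x 1 \<ominus> c) \<otimes> (y 2 \<ominus> d) \<oplus> (x 2 \<ominus> c) \<otimes> (y 1 \<ominus> d)"
      unfolding xy2 v_def w_def ..
    also have "\<dots> = x 1 \<otimes> y 1 \<oplus> (x 2 \<otimes> y 2 \<ominus> c \<otimes> d)"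
      unfolding 1 using ex(3,4) ey(3,4) cc by simp
    also have "\<dots> = \<Phi> (x \<otimes>\<^bsub>?F\<^esub> y)"
      unfolding \<Phi>_def F_ops component_0_mult[OF ex(4) ey(4)] c_def d_def by simp
    finally show "\<Phi> (x \<otimes>\<^bsub>?F\<^esub> y) = \<Phi> x \<otimes> \<Phi> y" by simp
  next
    show "\<Phi> \<one>\<^bsub>?F\<^esub> = \<one>"
      using FF.fibre_one[OF two(1)] FF.fibre_one[OF two(2)]
      by (simp add: \<Phi>_def R component_0_one minus_eq r_neg)
  qed
  interpret \<Phi>: ring_hom_ring ?F G \<Phi>
    by (rule ring_hom_ringI2) (use FF.F.ring_axioms ring_axioms hom in auto)
  interpret \<Phi>c: ring_hom_cring ?F G \<Phi>
    by (intro ring_hom_cring.intro ring_hom_cring_axioms.intro FF.fibre_product_cring is_cring hom)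
  have surj: "\<Phi> ` carrier ?F = carrier G"
  proof
    show "carrier G \<subseteq> \<Phi> ` carrier ?F"
    proof
      fix y assume y: "y \<in> carrier G"
      obtain h v where hv: "h \<in> H" "v \<in> V" "y = h \<oplus> v" using decompose[OF y] by blast
      have c: "h \<in> carrier G" "v \<in> carrier G" "component 0 h \<in> carrier G" "component 0 v = \<zero>"
        using hv H_carrier V.Icarr W.component_0_U by auto
      have c0: "component 0 (component 0 h) = component 0 h"
        using component_homogeneous[OF component_mem[OF c(1)], of 0 0] by simp
      define x where "x = (\<lambda>i\<in>?I. if i = 1 then h else component 0 h \<oplus> v)"
      have "x \<in> carrier ?F"
      proof (rule F_memI)
        show "x 2 \<in> W.H"
          using W.H_add[OF W.A_sub_H[OF component_mem[OF c(1), of 0]] W.U_sub_H[OF hv(2)]] by (simp add: x_def)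
      qed (use hv c c0 in \<open>auto simp: x_def component_add\<close>)
      moreover have "\<Phi> x = h \<oplus> (component 0 h \<oplus> v \<ominus> component 0 h)"
        using c c0 by (simp add: \<Phi>_def x_def component_add)
      moreover have "\<dots> = y" unfolding hv(3) using c by algebra
      ultimately have xy: "x \<in> carrier ?F" "\<Phi> x = y" by simp_all
      have "\<Phi> x \<in> \<Phi> ` carrier ?F" using xy(1) by (rule imageI)
      then show "y \<in> \<Phi> ` carrier ?F" unfolding xy(2) .
    qed
  qed (use hom ring_hom_closed in blast)
  have d: "\<delta> \<in> socle G" "\<delta> \<in> carrier G" using socle_generator_nonzero[OF generator] by auto
  have dU: "\<delta> \<in> U" "\<delta> \<in> V" using d socle_le_U W.socle_le_U by auto
  have dF: "\<delta> \<in> carrier (R i)" "\<pi> \<delta> = \<zero>\<^bsub>K\<^esub>" if "i \<in> ?I" for i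
    using dU U_sub_H W.U_sub_H U_le d residue_zero_iff by (auto simp: R_def)
  have single: "single_entry ?I R i \<delta> \<in> carrier ?F" "\<Phi> (single_entry ?I R i \<delta>) = \<delta>" if "i \<in> ?I" for i
  proof -
    show "single_entry ?I R i \<delta> \<in> carrier ?F" using FF.single_entry_closed[OF that dF(1)[OF that] dF(2)[OF that]] .
    show "\<Phi> (single_entry ?I R i \<delta>) = \<delta>"
      using that d component_0_U[OF dU(1)] by (auto simp: \<Phi>_def single_entry_def R minus_eq)
  qed
  note J = FF.connected_sum_ideal_ideal[of "\<lambda>_. \<delta>", OF dF]
  have ker: "a_kernel ?F G \<Phi> = ?J"
  proof
    show "?J \<subseteq> a_kernel ?F G \<Phi>"
    proof (rule J(3)[OF _ _ \<Phi>.kernel_is_ideal])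
      show "single_entry ?I R i \<delta> \<ominus>\<^bsub>?F\<^esub> single_entry ?I R j \<delta> \<in> a_kernel ?F G \<Phi>" if "i \<in> ?I" "j \<in> ?I" for i j
      proof -
        note s = single[OF that(1)] single[OF that(2)]
        have "\<Phi> (single_entry ?I R i \<delta> \<ominus>\<^bsub>?F\<^esub> single_entry ?I R j \<delta>) = \<delta> \<oplus> \<ominus> \<delta>"
          unfolding a_minus_def \<Phi>c.hom_add[OF s(1) FF.F.a_inv_closed[OF s(3)]] \<Phi>c.hom_a_inv[OF s(3)] s(2,4) ..
        then show ?thesis
          using FF.F.minus_closed[OF s(1,3)] r_neg[OF d(2)] unfolding a_kernel_def' by simp
      qed
    qed
    show "a_kernel ?F G \<Phi> \<subseteq> ?J"
    proof
      fix x assume "x \<in> a_kernel ?F G \<Phi>"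
      then have x: "x \<in> carrier ?F" "\<Phi> x = \<zero>" unfolding a_kernel_def' by (simp_all only: mem_Collect_eq)
      note ex = entries[OF x(1)]
      have "component 0 (\<Phi> x) = component 0 (x 1) \<oplus> (component 0 (x 2) \<ominus> component 0 (component 0 (x 2)))"
        using ex by (simp add: \<Phi>_def component_add component_diff)
      also have "component 0 (component 0 (x 2)) = component 0 (x 2)"
        using component_homogeneous[OF component_mem[OF ex(4)], of 0 0] by simp
      finally have c0: "component 0 (x 2) = \<zero>" using ex x by (simp add: minus_eq r_neg)
      then have uv: "x 1 \<in> U" "x 2 \<in> V" "x 1 \<oplus> x 2 = \<zero>"
        using ex x by (auto simp: \<Phi>_def minus_eq)
      have x1: "x 1 = \<ominus> x 2" using uv ex by (simp add: sum_zero_eq_neg)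
      have "x 1 \<otimes> y = \<zero>" if y: "y \<in> degree_ge 1" for y
      proof -
        obtain u v where w: "u \<in> U" "v \<in> V" "y = u \<oplus> v" using sum y by blast
        have wc: "u \<in> carrier G" "v \<in> carrier G" using w U.Icarr V.Icarr by auto
        have "x 1 \<otimes> u = \<zero>" unfolding x1 using W.orthogonal[OF uv(2) w(1)] ex wc by (simp add: l_minus)
        moreover have "x 1 \<otimes> v = \<zero>" using orthogonal[OF uv(1) w(2)] .
        ultimately show ?thesis using w wc ex by (simp add: r_distr)
      qed
      then have "x 1 \<in> socle G" using ex by (simp add: socle_eq)
      then obtain s where s: "s \<in> A 0" "x 1 = s \<otimes> \<delta>" using socle_multiple[OF generator] by blast
      have sc: "s \<in> carrier G" using s A_carrier by blast
      define t where "t = (\<lambda>i\<in>?I. s)"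
      have t: "t \<in> carrier ?F"
        by (rule F_memI) (use s A_sub_H W.A_sub_H in \<open>auto simp: t_def\<close>)
      let ?g = "single_entry ?I R 1 \<delta> \<ominus>\<^bsub>?F\<^esub> single_entry ?I R 2 \<delta>"
      have gc: "?g \<in> carrier ?F" by (rule FF.F.minus_closed[OF single(1)[OF two(1)] single(1)[OF two(2)]])
      have g: "?g 1 = \<delta>" "?g 2 = \<ominus> \<delta>"
      proof -
        have "?g i = single_entry ?I R 1 \<delta> i \<ominus>\<^bsub>R i\<^esub> single_entry ?I R 2 \<delta> i" if "i \<in> ?I" for i
          using FF.fibre_minus[OF that single(1)[OF two(1)] single(1)[OF two(2)]] .
        note g = this[OF two(1)] this[OF two(2)]
        show "?g 1 = \<delta>"
          using g(1) dU U_sub_H S.minus_zero S.r_zero[of \<delta>] by (simp add: R single_entry_def a_minus_def)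
        interpret vv: ring_hom_cring W.S G "\<lambda>x. x"
          by (intro ring_hom_cring.intro ring_hom_cring_axioms.intro W.S.is_cring is_cring ring_hom_memI)
            (use W.H_carrier in auto)
        show "?g 2 = \<ominus> \<delta>"
          using g(2) dU W.U_sub_H vv.hom_a_inv[of \<delta>] d by (simp add: R single_entry_def a_minus_def)
      qed
      have "x = t \<otimes>\<^bsub>?F\<^esub> ?g"
      proof (rule FF.fibre_ext[OF x(1) FF.F.m_closed[OF t gc]])
        show "x i = (t \<otimes>\<^bsub>?F\<^esub> ?g) i" if "i \<in> ?I" for i
        proof -
          have "x 2 = \<ominus> x 1" using x1 ex by simp
          then have "x 2 = s \<otimes> (\<ominus> \<delta>)" using s sc d by (simp add: r_minus)
          then have "x 1 = (t \<otimes>\<^bsub>?F\<^esub> ?g) 1" "x 2 = (t \<otimes>\<^bsub>?F\<^esub> ?g) 2"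
            unfolding F_ops g using s by (simp_all add: t_def)
          then show ?thesis using that by blast
        qed
      qed
      then show "x \<in> ?J"
        using ideal.I_l_closed[OF J(1) J(2)[OF _ _ two] t] by auto
    qed
  qed
  have iso: "connected_sum ?I R (\<lambda>_. \<pi>) (\<lambda>_. \<delta>) \<simeq> G"
    unfolding connected_sum_def ker[symmetric] by (rule \<Phi>.FactRing_iso[OF surj])
  have "ring (connected_sum ?I R (\<lambda>_. \<pi>) (\<lambda>_. \<delta>))"
    unfolding connected_sum_def ker[symmetric] by (rule ideal.quotient_is_ring[OF \<Phi>.kernel_is_ideal])
  then have iso': "G \<simeq> connected_sum ?I R (\<lambda>_. \<pi>) (\<lambda>_. \<delta>)" using ring_iso_sym iso by blast
  have props: "gorenstein_artinian_local_ring (R i) \<and> residue_map K (R i) \<pi> \<and>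
      loewy_length (R i) \<ge> 2 \<and> socle_generator (R i) \<delta> \<and> \<not> R i \<simeq> G" if "i \<in> ?I" for i
  proof -
    have "R i = S \<or> R i = W.S" by (simp add: R_def)
    then show ?thesis
      using S_gorenstein S_residue_map loewy_length_S generator_S S_not_iso
        W.S_gorenstein W.S_residue_map W.loewy_length_S W.generator_S W.S_not_iso
      by (elim disjE) (simp_all only: simp_thms)
  qed
  show ?thesis
    unfolding decomposes_as_connected_sum_def
    by (rule exI[of _ R], rule exI[of _ "\<lambda>_. \<pi>"], rule exI[of _ "\<lambda>_. \<delta>"],
        rule conjI[OF ballI[OF props] iso'])
qed

end

lemma (in graded_residue_ring) indecomposable_imp_orthogonally:
  assumes \<delta>: "socle_generator G \<delta>" and ind: "\<not> decomposes_as_connected_sum K G"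
  shows "orthogonally_indecomposable G (degree_ge 1) (degree_ge 1)"
  unfolding orthogonally_indecomposable_def
proof (intro allI impI)
  fix U V assume *: "ideal U G" "ideal V G" "U \<subseteq> degree_ge 1" "V \<subseteq> degree_ge 1"
    "\<forall>u\<in>U. \<forall>v\<in>V. u \<otimes> v = \<zero>" "\<forall>x\<in>degree_ge 1. \<exists>u\<in>U. \<exists>v\<in>V. x = u \<oplus> v"
  have "U \<subseteq> socle G \<or> V \<subseteq> socle G"
  proof (rule ccontr)
    assume "\<not> ?thesis"
    then have "orthogonal_splitting G A K scalar \<pi> U V \<delta>"
      using * \<delta> by (intro orthogonal_splitting.intro orthogonal_splitting_axioms.intro
          graded_residue_ring_axioms) blast+
    then show False by (rule notE[OF ind orthogonal_splitting.decomposes])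
  qed
  then show "U \<subseteq> self_annihilator G (degree_ge 1) \<or> V \<subseteq> self_annihilator G (degree_ge 1)"
    using *(3,4) by (auto simp: self_annihilator_def socle_eq)
qed

section \<open>Graded decompositions as orthogonal sums\<close>

text \<open>A connected sum decomposition seen from \<open>Q\<close>. The map \<open>\<iota> i\<close> sends a constant of \<open>R i\<close> to the constant
tuple and an element of positive degree to the tuple with this single nonzero entry; so it embeds
\<open>R i\<close> as the subring \<open>k + M i\<close> of \<open>Q\<close>, and all socles have the same image.\<close>

locale graded_decomposition = graded_artinian_ring Q B
  for Q :: "('q, 'x) ring_scheme" (structure) and B :: "nat \<Rightarrow> 'q set" +
  fixes I :: "'i set" and R :: "'i \<Rightarrow> ('a, 'm) ring_scheme" and A :: "'i \<Rightarrow> nat \<Rightarrow> 'a set"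
    and \<iota> :: "'i \<Rightarrow> 'a \<Rightarrow> 'q" and \<delta> :: "'i \<Rightarrow> 'a" and d :: nat
  assumes index_finite: "finite I" and index_nonempty: "I \<noteq> {}"
    and factor: "i \<in> I \<Longrightarrow> graded_artinian_ring (R i) (A i)"
    and factor_generator: "i \<in> I \<Longrightarrow> socle_generator (R i) (\<delta> i)"
    and generator_degree: "i \<in> I \<Longrightarrow> \<delta> i \<in> A i d"
    and degree_pos: "0 < d"
    and embedding_hom: "i \<in> I \<Longrightarrow> \<iota> i \<in> ring_hom (R i) Q"
    and embedding_inj: "i \<in> I \<Longrightarrow> inj_on (\<iota> i) (carrier (R i))"
    and embedding_graded: "\<lbrakk>i \<in> I; r \<in> A i n\<rbrakk> \<Longrightarrow> \<iota> i r \<in> B n"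
    and embedding_degree_zero: "i \<in> I \<Longrightarrow> B 0 \<subseteq> \<iota> i ` A i 0"
    and embedding_orthogonal: "\<lbrakk>i \<in> I; j \<in> I; i \<noteq> j; r \<in> graded_artinian_ring.degree_ge (R i) (A i) 1;
      s \<in> graded_artinian_ring.degree_ge (R j) (A j) 1\<rbrakk> \<Longrightarrow> \<iota> i r \<otimes> \<iota> j s = \<zero>"
    and embedding_span: "x \<in> degree_ge 1 \<Longrightarrow>
      \<exists>m. (\<forall>i\<in>I. m i \<in> graded_artinian_ring.degree_ge (R i) (A i) 1) \<and>
        x = finsum Q (\<lambda>i. \<iota> i (m i)) I"
    and embedding_socle: "\<lbrakk>i \<in> I; j \<in> I\<rbrakk> \<Longrightarrow> \<iota> i (\<delta> i) = \<iota> j (\<delta> j)"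
    and factor_indecomposable: "i \<in> I \<Longrightarrow>
      orthogonally_indecomposable (R i) (graded_artinian_ring.degree_ge (R i) (A i) 1)
        (graded_artinian_ring.degree_ge (R i) (A i) 1)"
    and factor_cube: "i \<in> I \<Longrightarrow> \<exists>x\<in>graded_artinian_ring.degree_ge (R i) (A i) 1.
      \<exists>y\<in>graded_artinian_ring.degree_ge (R i) (A i) 1.
      \<exists>z\<in>graded_artinian_ring.degree_ge (R i) (A i) 1. x \<otimes>\<^bsub>R i\<^esub> y \<otimes>\<^bsub>R i\<^esub> z \<noteq> \<zero>\<^bsub>R i\<^esub>"
begin

abbreviation T where "T i \<equiv> graded_artinian_ring.degree_ge (R i) (A i) 1"

abbreviation comp where "comp i \<equiv> graded_artinian_ring.component (R i) (A i)"

definition M where "M i = \<iota> i ` T i"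

lemma embedding_hom_cring: "i \<in> I \<Longrightarrow> ring_hom_cring (R i) Q (\<iota> i)"
  by (intro ring_hom_cring.intro ring_hom_cring_axioms.intro is_cring embedding_hom
      graded_artinian_ring.axioms(1)[OF factor])

lemma T_carrier: "\<lbrakk>i \<in> I; r \<in> T i\<rbrakk> \<Longrightarrow> r \<in> carrier (R i)"
  using graded_artinian_ring.degree_ge_closed[OF factor] by blast

lemma embedding_closed: "\<lbrakk>i \<in> I; r \<in> carrier (R i)\<rbrakk> \<Longrightarrow> \<iota> i r \<in> carrier Q"
  using embedding_hom ring_hom_closed by metis

lemma M_carrier: "\<lbrakk>i \<in> I; x \<in> M i\<rbrakk> \<Longrightarrow> x \<in> carrier Q"
  using T_carrier embedding_closed by (auto simp: M_def)

lemma embedding_component: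
  assumes i: "i \<in> I" and r: "r \<in> carrier (R i)"
  shows "component n (\<iota> i r) = \<iota> i (comp i n r)"
proof -
  interpret Ri: graded_artinian_ring "R i" "A i" by (rule factor[OF i])
  interpret h: ring_hom_cring "R i" Q "\<iota> i" by (rule embedding_hom_cring[OF i])
  let ?S = "{n. Ri.component n r \<noteq> \<zero>\<^bsub>R i\<^esub>}"
  show ?thesis
  proof (rule component_eqI[where S = ?S])
    have "\<iota> i r = \<iota> i (finsum (R i) (\<lambda>n. Ri.component n r) ?S)" using Ri.component_sum[OF r] by simp
    also have "\<dots> = finsum Q (\<iota> i \<circ> (\<lambda>n. Ri.component n r)) ?S"
      by (rule h.hom_finsum) (use r in auto)
    finally show "\<iota> i r = finsum Q (\<lambda>n. \<iota> i (Ri.component n r)) ?S" by (simp add: comp_def)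
  qed (use Ri.component_finite[OF r] Ri.component_mem[OF r] embedding_graded[OF i] in auto)
qed

lemma M_le: "i \<in> I \<Longrightarrow> M i \<subseteq> degree_ge 1"
proof
  fix x assume i: "i \<in> I" and x: "x \<in> M i"
  interpret Ri: graded_artinian_ring "R i" "A i" by (rule factor[OF i])
  interpret h: ring_hom_cring "R i" Q "\<iota> i" by (rule embedding_hom_cring[OF i])
  obtain r where r: "r \<in> T i" "x = \<iota> i r" using x by (auto simp: M_def)
  have rc: "r \<in> carrier (R i)" using T_carrier[OF i r(1)] .
  have "component 0 x = \<zero>"
    using embedding_component[OF i rc, of 0] r by (simp add: Ri.degree_ge_def)
  then show "x \<in> degree_ge 1" using rc r by (simp add: degree_ge_def)
qed

lemma embedding_in_M:
  assumes i: "i \<in> I" and r: "r \<in> carrier (R i)" and x: "\<iota> i r \<in> degree_ge 1"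
  shows "r \<in> T i"
proof -
  interpret Ri: graded_artinian_ring "R i" "A i" by (rule factor[OF i])
  interpret h: ring_hom_cring "R i" Q "\<iota> i" by (rule embedding_hom_cring[OF i])
  have "\<iota> i (comp i 0 r) = \<iota> i \<zero>\<^bsub>R i\<^esub>"
    using embedding_component[OF i r, of 0] x by (simp add: degree_ge_def)
  then have "comp i 0 r = \<zero>\<^bsub>R i\<^esub>" using inj_onD[OF embedding_inj[OF i]] r by simp
  then show ?thesis using r by (simp add: Ri.degree_ge_def)
qed

lemma span_mult:
  assumes i: "i \<in> I" and r: "r \<in> T i" and m: "\<And>j. j \<in> I \<Longrightarrow> m j \<in> T j"
  shows "\<iota> i r \<otimes> finsum Q (\<lambda>j. \<iota> j (m j)) I = \<iota> i (r \<otimes>\<^bsub>R i\<^esub> m i)"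
proof -
  interpret h: ring_hom_cring "R i" Q "\<iota> i" by (rule embedding_hom_cring[OF i])
  have rc: "r \<in> carrier (R i)" "\<iota> i r \<in> carrier Q" using T_carrier[OF i r] by auto
  have mc: "\<iota> j (m j) \<in> carrier Q" "m j \<in> carrier (R j)" if "j \<in> I" for j
    using m[OF that] that T_carrier embedding_closed by auto
  have "\<iota> i r \<otimes> finsum Q (\<lambda>j. \<iota> j (m j)) I = finsum Q (\<lambda>j. \<iota> i r \<otimes> \<iota> j (m j)) I"
    by (rule finsum_rdistr[OF index_finite rc(2)]) (use mc in auto)
  also have "\<dots> = finsum Q (\<lambda>j. if i = j then \<iota> i r \<otimes> \<iota> j (m j) else \<zero>) I"
    by (rule finsum_cong)
      (use embedding_orthogonal[OF i _ _ r m] rc mc in \<open>auto simp: simp_implies_def\<close>)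
  also have "\<dots> = \<iota> i r \<otimes> \<iota> i (m i)"
    by (rule finsum_singleton) (use i index_finite rc mc in auto)
  finally show ?thesis using rc mc[OF i] by simp
qed

text \<open>An element of \<open>Q\<close> is a constant, which is in the image of \<open>\<iota> i\<close>, plus a sum of elements of the \<open>M j\<close>,
of which only the one for \<open>j = i\<close> acts on \<open>M i\<close>.\<close>

lemma M_ideal: "i \<in> I \<Longrightarrow> ideal (M i) Q"
proof (rule commutative_idealI)
  assume i: "i \<in> I"
  interpret Ri: graded_artinian_ring "R i" "A i" by (rule factor[OF i])
  interpret h: ring_hom_cring "R i" Q "\<iota> i" by (rule embedding_hom_cring[OF i])
  note T_ideal = Ri.degree_ge_ideal[of 1]
  show "M i \<subseteq> carrier Q" using M_carrier i by blast
  have "\<zero>\<^bsub>R i\<^esub> \<in> T i" by (rule additive_subgroup.zero_closed[OF Ri.degree_ge_subgroup])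
  then show "\<zero> \<in> M i" unfolding M_def using h.hom_zero by force
  show "x \<oplus> y \<in> M i" if xy: "x \<in> M i" "y \<in> M i" for x y
  proof -
    obtain r s where rs: "r \<in> T i" "s \<in> T i" "x = \<iota> i r" "y = \<iota> i s" using xy unfolding M_def by blast
    have "x \<oplus> y = \<iota> i (r \<oplus>\<^bsub>R i\<^esub> s)" using rs T_carrier[OF i] by simp
    then show ?thesis unfolding M_def using Ri.degree_ge_add[OF rs(1,2)] by blast
  qed
  show "q \<otimes> x \<in> M i" if qx: "q \<in> carrier Q" "x \<in> M i" for q x
  proof -
    obtain r where r: "r \<in> T i" "x = \<iota> i r" using qx unfolding M_def by blast
    have rc: "r \<in> carrier (R i)" using T_carrier[OF i r(1)] .
    obtain a where a: "a \<in> A i 0" "component 0 q = \<iota> i a"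
      using embedding_degree_zero[OF i] component_mem[OF qx(1), of 0] by blast
    have ac: "a \<in> carrier (R i)" using a Ri.A_carrier by blast
    obtain m where m: "\<And>j. j \<in> I \<Longrightarrow> m j \<in> T j" "q \<ominus> component 0 q = finsum Q (\<lambda>j. \<iota> j (m j)) I"
      using embedding_span[OF minus_component_0[OF qx(1)]] by blast
    have mc: "m i \<in> carrier (R i)" using T_carrier[OF i m(1)[OF i]] .
    have qc: "component 0 q \<in> carrier Q" "x \<in> carrier Q" using qx r rc by auto
    have "q \<otimes> x = component 0 q \<otimes> x \<oplus> x \<otimes> (q \<ominus> component 0 q)" using qx(1) qc by algebra
    also have "x \<otimes> (q \<ominus> component 0 q) = \<iota> i (r \<otimes>\<^bsub>R i\<^esub> m i)"
      unfolding m(2) r(2) by (rule span_mult[OF i r(1) m(1)])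
    also have "component 0 q \<otimes> x = \<iota> i a \<otimes> \<iota> i r" unfolding a(2) r(2) ..
    also have "\<iota> i a \<otimes> \<iota> i r \<oplus> \<iota> i (r \<otimes>\<^bsub>R i\<^esub> m i) = \<iota> i (a \<otimes>\<^bsub>R i\<^esub> r \<oplus>\<^bsub>R i\<^esub> r \<otimes>\<^bsub>R i\<^esub> m i)" using rc ac mc by simp
    finally show ?thesis
      unfolding M_def
      using Ri.degree_ge_add ideal.I_l_closed[OF T_ideal r(1) ac] ideal.I_r_closed[OF T_ideal r(1) mc] by blast
  qed
qed

lemma socle_in_T: "i \<in> I \<Longrightarrow> socle (R i) \<subseteq> T i"
  by (rule graded_artinian_ring.socle_le_degree_ge_1[OF factor factor_generator factor_cube])

lemma self_annihilator_embedding_iff: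
  assumes i: "i \<in> I" and r: "r \<in> T i"
  shows "\<iota> i r \<in> self_annihilator Q (degree_ge 1) \<longleftrightarrow> r \<in> socle (R i)"
proof -
  interpret Ri: graded_artinian_ring "R i" "A i" by (rule factor[OF i])
  interpret h: ring_hom_cring "R i" Q "\<iota> i" by (rule embedding_hom_cring[OF i])
  have rM: "\<iota> i r \<in> M i" using r by (simp add: M_def)
  have rc: "r \<in> carrier (R i)" using T_carrier[OF i r] .
  show ?thesis
  proof
    assume a: "\<iota> i r \<in> self_annihilator Q (degree_ge 1)"
    have "r \<otimes>\<^bsub>R i\<^esub> s = \<zero>\<^bsub>R i\<^esub>" if s: "s \<in> T i" for s
    proof -
      have sc: "s \<in> carrier (R i)" using T_carrier[OF i s] .
      have "\<iota> i s \<in> degree_ge 1" using M_le[OF i] s unfolding M_def by blast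
      then have "\<iota> i r \<otimes> \<iota> i s = \<zero>" using a by (simp add: self_annihilator_def)
      then have "\<iota> i (r \<otimes>\<^bsub>R i\<^esub> s) = \<iota> i \<zero>\<^bsub>R i\<^esub>" using rc sc by simp
      then show ?thesis using inj_onD[OF embedding_inj[OF i]] rc sc by blast
    qed
    then show "r \<in> socle (R i)" using rc by (simp add: Ri.socle_eq)
  next
    assume a: "r \<in> socle (R i)"
    have "\<iota> i r \<otimes> y = \<zero>" if y: "y \<in> degree_ge 1" for y
    proof -
      obtain m where m: "\<And>j. j \<in> I \<Longrightarrow> m j \<in> T j" "y = finsum Q (\<lambda>j. \<iota> j (m j)) I"
        using embedding_span[OF y] by blast
      have "r \<otimes>\<^bsub>R i\<^esub> m i = \<zero>\<^bsub>R i\<^esub>" using a m(1)[OF i] by (simp add: Ri.socle_eq)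
      then show ?thesis using span_mult[where m = m, OF i r m(1)] unfolding m(2) by simp
    qed
    then show "\<iota> i r \<in> self_annihilator Q (degree_ge 1)"
      using M_le[OF i] rM by (auto simp: self_annihilator_def)
  qed
qed

text \<open>If \<open>z\<close> annihilates the maximal ideal, then each component of \<open>z\<close> lies in the image of the socle of its
summand, and these images agree: the generators \<open>\<delta> j\<close> are identified, and the constants of
all summands have the same image.\<close>

lemma self_annihilator_eq:
  assumes i: "i \<in> I" shows "self_annihilator Q (degree_ge 1) = \<iota> i ` socle (R i)"
proof
  interpret Ri: graded_artinian_ring "R i" "A i" by (rule factor[OF i])
  interpret h: ring_hom_cring "R i" Q "\<iota> i" by (rule embedding_hom_cring[OF i])
  interpret soc: ideal "socle (R i)" "R i" by (rule Ri.socle_ideal)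
  show "\<iota> i ` socle (R i) \<subseteq> self_annihilator Q (degree_ge 1)"
    using self_annihilator_embedding_iff[OF i] socle_in_T[OF i] by blast
  show "self_annihilator Q (degree_ge 1) \<subseteq> \<iota> i ` socle (R i)"
  proof
    fix z assume z: "z \<in> self_annihilator Q (degree_ge 1)"
    then have zN: "z \<in> degree_ge 1" by (simp add: self_annihilator_def)
    obtain m where m: "\<And>j. j \<in> I \<Longrightarrow> m j \<in> T j" "z = finsum Q (\<lambda>j. \<iota> j (m j)) I"
      using embedding_span[OF zN] by blast
    have entry: "\<iota> j (m j) \<in> \<iota> i ` socle (R i)" if j: "j \<in> I" for j
    proof -
      interpret Rj: graded_artinian_ring "R j" "A j" by (rule factor[OF j])
      interpret hj: ring_hom_cring "R j" Q "\<iota> j" by (rule embedding_hom_cring[OF j])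
      have mc: "m j \<in> carrier (R j)" using T_carrier[OF j m(1)[OF j]] .
      have "m j \<otimes>\<^bsub>R j\<^esub> s = \<zero>\<^bsub>R j\<^esub>" if s: "s \<in> T j" for s
      proof -
        have sc: "s \<in> carrier (R j)" using T_carrier[OF j s] .
        have sN: "\<iota> j s \<in> degree_ge 1" using M_le[OF j] s unfolding M_def by blast
        then have "\<zero> = z \<otimes> \<iota> j s" using z by (simp add: self_annihilator_def)
        also have "\<dots> = \<iota> j s \<otimes> z" using sN zN degree_ge_closed m_comm by blast
        also have "\<dots> = \<iota> j (s \<otimes>\<^bsub>R j\<^esub> m j)" unfolding m(2) by (rule span_mult[OF j s m(1)])
        finally have "\<iota> j (s \<otimes>\<^bsub>R j\<^esub> m j) = \<iota> j \<zero>\<^bsub>R j\<^esub>" by simp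
        then have "s \<otimes>\<^bsub>R j\<^esub> m j = \<zero>\<^bsub>R j\<^esub>" using inj_onD[OF embedding_inj[OF j]] mc sc by blast
        then show ?thesis using Rj.m_comm[OF mc sc] by simp
      qed
      then have "m j \<in> socle (R j)" using mc by (simp add: Rj.socle_eq)
      then obtain a where a: "a \<in> A j 0" "m j = a \<otimes>\<^bsub>R j\<^esub> \<delta> j"
        using Rj.socle_multiple[OF factor_generator[OF j]] by blast
      have "\<iota> j a \<in> B 0" using embedding_graded[OF j a(1)] .
      then obtain b where b: "b \<in> A i 0" "\<iota> j a = \<iota> i b" using embedding_degree_zero[OF i] by blast
      have bc: "b \<in> carrier (R i)" using b Ri.A_carrier by blast
      have di: "\<delta> i \<in> socle (R i)" "\<delta> i \<in> carrier (R i)"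
        using Ri.socle_generator_nonzero[OF factor_generator[OF i]] by auto
      have "\<iota> j (m j) = \<iota> j a \<otimes> \<iota> j (\<delta> j)"
        using a Rj.A_carrier Rj.socle_generator_nonzero[OF factor_generator[OF j]] by simp
      also have "\<dots> = \<iota> i (b \<otimes>\<^bsub>R i\<^esub> \<delta> i)" unfolding b(2) embedding_socle[OF j i] using bc di by simp
      finally show ?thesis using soc.I_l_closed[OF di(1) bc] by blast
    qed
    have sub: "additive_subgroup (\<iota> i ` socle (R i)) Q"
      using ring_hom_ring.img_is_add_subgroup[OF ring_hom_ringI2[OF Ri.ring_axioms ring_axioms h.homh] soc.a_subgroup]
      by (simp add: additive_subgroup_def)
    show "z \<in> \<iota> i ` socle (R i)"
      unfolding m(2) by (rule additive_subgroup.finsum_closed_subgroup[OF sub is_abelian_group entry])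
  qed
qed

text \<open>The component of degree \<open>d\<close> of a sum of elements of the \<open>M j\<close> comes from the components of degree \<open>d\<close>
in the summands, and these are the socles of the summands.\<close>

lemma self_annihilator_degree: "self_annihilator Q (degree_ge 1) = B d"
proof -
  obtain i where i: "i \<in> I" using index_nonempty by blast
  have soc: "socle (R j) = A j d" if "j \<in> I" for j
    by (rule graded_artinian_ring.top_degree(1)[OF factor[OF that] factor_generator[OF that] generator_degree[OF that]])
  show ?thesis
  proof
    show "self_annihilator Q (degree_ge 1) \<subseteq> B d"
      unfolding self_annihilator_eq[OF i] soc[OF i] using embedding_graded[OF i] by blast
    show "B d \<subseteq> self_annihilator Q (degree_ge 1)"
    proof
      fix x assume x: "x \<in> B d"
      have xN: "x \<in> degree_ge 1" using homogeneous_degree_ge[OF x] degree_pos by simp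
      obtain m where m: "\<And>j. j \<in> I \<Longrightarrow> m j \<in> T j" "x = finsum Q (\<lambda>j. \<iota> j (m j)) I"
        using embedding_span[OF xN] by blast
      have fin: "component d (finsum Q (\<lambda>j. \<iota> j (m j)) S) = finsum Q (\<lambda>j. \<iota> j (comp j d (m j))) S"
        if "finite S" "S \<subseteq> I" for S
        using that
      proof (induction S rule: finite_induct)
        case (insert j S)
        have c: "\<iota> k (m k) \<in> carrier Q" "\<iota> k (comp k d (m k)) \<in> carrier Q" if "k \<in> I" for k
          using embedding_closed[OF that] T_carrier[OF that m(1)[OF that]]
            graded_artinian_ring.component_closed[OF factor[OF that]] by auto
        have 1: "finsum Q (\<lambda>j. \<iota> j (m j)) (insert j S) = \<iota> j (m j) \<oplus> finsum Q (\<lambda>j. \<iota> j (m j)) S"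
          by (rule finsum_insert) (use insert c in auto)
        have 2: "finsum Q (\<lambda>j. \<iota> j (comp j d (m j))) (insert j S) =
            \<iota> j (comp j d (m j)) \<oplus> finsum Q (\<lambda>j. \<iota> j (comp j d (m j))) S"
          by (rule finsum_insert) (use insert c in auto)
        have "finsum Q (\<lambda>j. \<iota> j (m j)) S \<in> carrier Q" using insert c by (intro finsum_closed) auto
        then show ?case
          unfolding 1 2 using insert c embedding_component[OF _ T_carrier[OF _ m(1)], of j d]
          by (simp add: component_add)
      qed simp
      have eq: "x = finsum Q (\<lambda>j. \<iota> j (comp j d (m j))) I"
        using fin[OF index_finite] component_homogeneous[OF x, of d] m(2) by simp
      have entry: "\<iota> j (comp j d (m j)) \<in> self_annihilator Q (degree_ge 1)" if j: "j \<in> I" for j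
      proof -
        interpret Rj: graded_artinian_ring "R j" "A j" by (rule factor[OF j])
        have "comp j d (m j) \<in> socle (R j)"
          unfolding soc[OF j] using Rj.component_mem T_carrier[OF j m(1)[OF j]] by blast
        then show ?thesis using self_annihilator_eq[OF j] by blast
      qed
      have sub: "additive_subgroup (self_annihilator Q (degree_ge 1)) Q"
      proof -
        have "ideal {x \<in> degree_ge 1. \<forall>z\<in>degree_ge 1. x \<otimes> z = \<zero>} Q"
          by (rule annihilated_ideal[OF degree_ge_ideal]) (rule degree_ge_closed)
        then show ?thesis unfolding self_annihilator_def by (rule ideal.axioms(1))
      qed
      show "x \<in> self_annihilator Q (degree_ge 1)"
        unfolding eq by (rule additive_subgroup.finsum_closed_subgroup[OF sub is_abelian_group entry])
    qed
  qed
qed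

text \<open>Ideals of \<open>Q\<close> inside \<open>M i\<close> pull back along \<open>\<iota> i\<close> to ideals of \<open>R i\<close>.\<close>

lemma M_indecomposable:
  assumes i: "i \<in> I" shows "orthogonally_indecomposable Q (degree_ge 1) (M i)"
  unfolding orthogonally_indecomposable_def
proof (intro allI impI)
  interpret Ri: graded_artinian_ring "R i" "A i" by (rule factor[OF i])
  interpret h: ring_hom_cring "R i" Q "\<iota> i" by (rule embedding_hom_cring[OF i])
  fix U V
  assume U: "ideal U Q" "U \<subseteq> M i" and V: "ideal V Q" "V \<subseteq> M i"
    and orth: "\<forall>u\<in>U. \<forall>v\<in>V. u \<otimes> v = \<zero>" and sum: "\<forall>x\<in>M i. \<exists>u\<in>U. \<exists>v\<in>V. x = u \<oplus> v"
  define pre where "pre W = {r \<in> T i. \<iota> i r \<in> W}" for W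
  have pre_ideal: "ideal (pre W) (R i)" if W: "ideal W Q" for W
  proof (rule Ri.commutative_idealI)
    show "pre W \<subseteq> carrier (R i)" using T_carrier[OF i] by (auto simp: pre_def)
    show "\<zero>\<^bsub>R i\<^esub> \<in> pre W"
      using additive_subgroup.zero_closed[OF ideal.axioms(1)[OF W]]
        additive_subgroup.zero_closed[OF Ri.degree_ge_subgroup] by (simp add: pre_def)
    show "x \<oplus>\<^bsub>R i\<^esub> y \<in> pre W" if "x \<in> pre W" "y \<in> pre W" for x y
      using that T_carrier[OF i] additive_subgroup.a_closed[OF ideal.axioms(1)[OF W]] Ri.degree_ge_add
      by (simp add: pre_def)
    show "r \<otimes>\<^bsub>R i\<^esub> x \<in> pre W" if "r \<in> carrier (R i)" "x \<in> pre W" for r x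
      using that T_carrier[OF i] ideal.I_l_closed[OF W] ideal.I_l_closed[OF Ri.degree_ge_ideal]
      by (simp add: pre_def)
  qed
  have lift: "\<exists>r\<in>pre W. u = \<iota> i r" if "W \<subseteq> M i" "u \<in> W" for W u
    using that unfolding M_def pre_def by blast
  have "pre U \<subseteq> self_annihilator (R i) (T i) \<or> pre V \<subseteq> self_annihilator (R i) (T i)"
    using factor_indecomposable[OF i] pre_ideal[OF U(1)] pre_ideal[OF V(1)]
  proof (rule orthogonally_indecomposableD)
    show "pre U \<subseteq> T i" "pre V \<subseteq> T i" by (auto simp: pre_def)
    show "u \<otimes>\<^bsub>R i\<^esub> v = \<zero>\<^bsub>R i\<^esub>" if uv: "u \<in> pre U" "v \<in> pre V" for u v
    proof -
      have c: "u \<in> carrier (R i)" "v \<in> carrier (R i)" using uv T_carrier[OF i] by (auto simp: pre_def)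
      have "\<iota> i (u \<otimes>\<^bsub>R i\<^esub> v) = \<iota> i \<zero>\<^bsub>R i\<^esub>" using uv orth c by (simp add: pre_def)
      then show ?thesis using inj_onD[OF embedding_inj[OF i]] c by blast
    qed
    show "\<exists>u\<in>pre U. \<exists>v\<in>pre V. r = u \<oplus>\<^bsub>R i\<^esub> v" if r: "r \<in> T i" for r
    proof -
      obtain x y where xy: "x \<in> U" "y \<in> V" "\<iota> i r = x \<oplus> y" using sum r unfolding M_def by blast
      obtain u v where uv: "u \<in> pre U" "v \<in> pre V" "x = \<iota> i u" "y = \<iota> i v"
        using lift[OF U(2) xy(1)] lift[OF V(2) xy(2)] by blast
      have c: "u \<in> carrier (R i)" "v \<in> carrier (R i)" using uv T_carrier[OF i] by (auto simp: pre_def)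
      have "\<iota> i r = \<iota> i (u \<oplus>\<^bsub>R i\<^esub> v)" using xy uv c by simp
      then have "r = u \<oplus>\<^bsub>R i\<^esub> v" using inj_onD[OF embedding_inj[OF i]] c T_carrier[OF i r] by blast
      then show ?thesis using uv by blast
    qed
  qed
  moreover have "W \<subseteq> self_annihilator Q (degree_ge 1)"
    if W: "W \<subseteq> M i" "pre W \<subseteq> self_annihilator (R i) (T i)" for W
  proof
    fix w assume "w \<in> W"
    then obtain r where r: "r \<in> pre W" "w = \<iota> i r" using lift[OF W(1)] by blast
    then have "r \<in> T i" "r \<in> socle (R i)"
      using W(2) T_carrier[OF i] by (auto simp: pre_def self_annihilator_def Ri.socle_eq)
    then show "w \<in> self_annihilator Q (degree_ge 1)" using self_annihilator_embedding_iff[OF i] r by blast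
  qed
  ultimately show "U \<subseteq> self_annihilator Q (degree_ge 1) \<or> V \<subseteq> self_annihilator Q (degree_ge 1)"
    using U V by blast
qed

sublocale rigid: rigid_orthogonal_sum Q "degree_ge 1" I M
proof (intro rigid_orthogonal_sum.intro orthogonal_sum.intro orthogonal_sum_axioms.intro
    rigid_orthogonal_sum_axioms.intro)
  show "x \<otimes> y = \<zero>" if "i \<in> I" "j \<in> I" "i \<noteq> j" "x \<in> M i" "y \<in> M j" for i j x y
    using embedding_orthogonal[OF that(1-3)] that(4,5) by (auto simp: M_def)
  show "\<exists>m. (\<forall>i\<in>I. m i \<in> M i) \<and> x = finsum Q m I" if x: "x \<in> degree_ge 1" for x
  proof -
    obtain m where m: "\<forall>i\<in>I. m i \<in> T i" "x = finsum Q (\<lambda>i. \<iota> i (m i)) I"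
      using embedding_span[OF x] by blast
    then show ?thesis unfolding M_def by (intro exI[of _ "\<lambda>i. \<iota> i (m i)"]) auto
  qed
  show "\<exists>x\<in>M i. \<exists>y\<in>M i. \<exists>z\<in>M i. x \<otimes> y \<otimes> z \<noteq> \<zero>" if i: "i \<in> I" for i
  proof -
    interpret Ri: graded_artinian_ring "R i" "A i" by (rule factor[OF i])
    interpret h: ring_hom_cring "R i" Q "\<iota> i" by (rule embedding_hom_cring[OF i])
    obtain x y z where xyz: "x \<in> T i" "y \<in> T i" "z \<in> T i" "x \<otimes>\<^bsub>R i\<^esub> y \<otimes>\<^bsub>R i\<^esub> z \<noteq> \<zero>\<^bsub>R i\<^esub>"
      using factor_cube[OF i] by blast
    have c: "x \<in> carrier (R i)" "y \<in> carrier (R i)" "z \<in> carrier (R i)" using xyz T_carrier[OF i] by auto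
    have "\<iota> i (x \<otimes>\<^bsub>R i\<^esub> y \<otimes>\<^bsub>R i\<^esub> z) \<noteq> \<iota> i \<zero>\<^bsub>R i\<^esub>"
      using inj_onD[OF embedding_inj[OF i], of "x \<otimes>\<^bsub>R i\<^esub> y \<otimes>\<^bsub>R i\<^esub> z" "\<zero>\<^bsub>R i\<^esub>"] xyz(4) c by auto
    then have "\<iota> i x \<otimes> \<iota> i y \<otimes> \<iota> i z \<noteq> \<zero>" using c by simp
    then show ?thesis using xyz unfolding M_def by blast
  qed
  show "self_annihilator Q (degree_ge 1) \<subseteq> M i" if "i \<in> I" for i
    unfolding self_annihilator_eq[OF that] M_def using socle_in_T[OF that] by blast
  show "\<exists>r\<in>carrier Q. w = r \<otimes> z" if z: "z \<in> self_annihilator Q (degree_ge 1)" "z \<noteq> \<zero>"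
    and w: "w \<in> self_annihilator Q (degree_ge 1)" for z w
  proof -
    obtain i where i: "i \<in> I" using index_nonempty by blast
    interpret Ri: graded_artinian_ring "R i" "A i" by (rule factor[OF i])
    interpret h: ring_hom_cring "R i" Q "\<iota> i" by (rule embedding_hom_cring[OF i])
    obtain r s where rs: "r \<in> socle (R i)" "s \<in> socle (R i)" "z = \<iota> i r" "w = \<iota> i s"
      using z w unfolding self_annihilator_eq[OF i] by blast
    have "r \<noteq> \<zero>\<^bsub>R i\<^esub>" using z rs by auto
    then obtain c where c: "c \<in> A i 0" "s = c \<otimes>\<^bsub>R i\<^esub> r"
      using Ri.socle_line[OF factor_generator[OF i] rs(1) _ rs(2)] by blast
    have "c \<in> carrier (R i)" "r \<in> carrier (R i)" using c rs Ri.A_carrier by (auto simp: socle_def)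
    then show ?thesis using rs c by (intro bexI[of _ "\<iota> i c"]) auto
  qed
qed (rule is_cring degree_ge_ideal index_finite M_ideal M_le M_indecomposable; assumption?)+

end

section \<open>Isomorphism of matched summands\<close>

text \<open>An isomorphism presented by its graph. Compatibility of the graph with components in both variables,
together with uniqueness, makes the map and its inverse graded.\<close>

lemma graded_ring_isomorphic_by_relation:
  assumes R: "graded_artinian_ring R A" and S: "graded_artinian_ring S C"
    and total: "\<And>r. r \<in> carrier R \<Longrightarrow> \<exists>s\<in>carrier S. P r s"
    and surj: "\<And>s. s \<in> carrier S \<Longrightarrow> \<exists>r\<in>carrier R. P r s"
    and right_unique: "\<And>r s s'. \<lbrakk>r \<in> carrier R; s \<in> carrier S; s' \<in> carrier S; P r s; P r s'\<rbrakk> \<Longrightarrow> s = s'"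
    and left_unique: "\<And>r r' s. \<lbrakk>r \<in> carrier R; r' \<in> carrier R; s \<in> carrier S; P r s; P r' s\<rbrakk> \<Longrightarrow> r = r'"
    and add: "\<And>r r' s s'. \<lbrakk>r \<in> carrier R; r' \<in> carrier R; s \<in> carrier S; s' \<in> carrier S; P r s; P r' s'\<rbrakk>
      \<Longrightarrow> P (r \<oplus>\<^bsub>R\<^esub> r') (s \<oplus>\<^bsub>S\<^esub> s')"
    and mult: "\<And>r r' s s'. \<lbrakk>r \<in> carrier R; r' \<in> carrier R; s \<in> carrier S; s' \<in> carrier S; P r s; P r' s'\<rbrakk>
      \<Longrightarrow> P (r \<otimes>\<^bsub>R\<^esub> r') (s \<otimes>\<^bsub>S\<^esub> s')"
    and one: "P \<one>\<^bsub>R\<^esub> \<one>\<^bsub>S\<^esub>"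
    and component: "\<And>r s n. \<lbrakk>r \<in> carrier R; s \<in> carrier S; P r s\<rbrakk> \<Longrightarrow>
      P (graded_artinian_ring.component R A n r) (graded_artinian_ring.component S C n s)"
  shows "graded_ring_isomorphic R A S C"
proof -
  interpret R: graded_artinian_ring R A by (rule R)
  interpret S: graded_artinian_ring S C by (rule S)
  define h where "h r = (SOME s. s \<in> carrier S \<and> P r s)" for r
  have h: "h r \<in> carrier S" "P r (h r)" if "r \<in> carrier R" for r
    using someI_ex[of "\<lambda>s. s \<in> carrier S \<and> P r s"] total[OF that] unfolding h_def by blast+
  have h_eq: "h r = s" if "r \<in> carrier R" "s \<in> carrier S" "P r s" for r s
    using right_unique h that by blast
  have "h \<in> ring_iso R S"
  proof (rule ring_iso_memI)
    show "h (r \<otimes>\<^bsub>R\<^esub> r') = h r \<otimes>\<^bsub>S\<^esub> h r'" "h (r \<oplus>\<^bsub>R\<^esub> r') = h r \<oplus>\<^bsub>S\<^esub> h r'"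
      if "r \<in> carrier R" "r' \<in> carrier R" for r r'
      using that h by (auto intro!: h_eq add mult)
    show "h \<one>\<^bsub>R\<^esub> = \<one>\<^bsub>S\<^esub>" using one by (intro h_eq) auto
    have "r = r'" if "r \<in> carrier R" "r' \<in> carrier R" "h r = h r'" for r r'
      using left_unique[OF that(1,2) h(1)[OF that(1)] h(2)[OF that(1)]] h(2)[OF that(2)] that(3) by simp
    moreover have "\<exists>r\<in>carrier R. s = h r" if "s \<in> carrier S" for s
      using surj[OF that] h_eq that by blast
    ultimately show "bij_betw h (carrier R) (carrier S)"
      unfolding bij_betw_def inj_on_def using h(1) by blast
  qed (rule h(1))
  moreover have "h ` A n = C n" for n
  proof
    show "h ` A n \<subseteq> C n"
    proof
      fix s assume "s \<in> h ` A n"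
      then obtain r where r: "r \<in> A n" "s = h r" by blast
      have rc: "r \<in> carrier R" using r R.A_carrier by blast
      have "P (R.component n r) (S.component n s)" using component[OF rc] h rc r by simp
      then have "S.component n s = s"
        using right_unique[OF rc, of "S.component n s" s] h rc r R.component_homogeneous[OF r(1), of n] by simp
      then show "s \<in> C n" using S.component_mem[of s n] h rc r by simp
    qed
    show "C n \<subseteq> h ` A n"
    proof
      fix s assume s: "s \<in> C n"
      have sc: "s \<in> carrier S" using s S.A_carrier by blast
      obtain r where r: "r \<in> carrier R" "P r s" using surj[OF sc] by blast
      have "P (R.component n r) s" using component[OF r(1) sc r(2), of n] S.component_homogeneous[OF s, of n] by simp
      then have "h (R.component n r) = s" using h_eq r sc by simp
      then show "s \<in> h ` A n" using R.component_mem[OF r(1)] by blast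
    qed
  qed
  ultimately show ?thesis unfolding graded_ring_isomorphic_def by blast
qed

locale two_graded_decompositions = graded_artinian_ring Q B +
  D: graded_decomposition Q B I R A \<iota> \<delta> d + E: graded_decomposition Q B J S C \<kappa> \<epsilon> e
  for Q :: "('q, 'x) ring_scheme" (structure) and B :: "nat \<Rightarrow> 'q set"
    and I :: "'i set" and R :: "'i \<Rightarrow> ('a, 'm) ring_scheme"
    and A :: "'i \<Rightarrow> nat \<Rightarrow> 'a set" and \<iota> :: "'i \<Rightarrow> 'a \<Rightarrow> 'q" and \<delta> :: "'i \<Rightarrow> 'a" and d :: nat
    and J :: "'j set" and S :: "'j \<Rightarrow> ('b, 'n) ring_scheme"
    and C :: "'j \<Rightarrow> nat \<Rightarrow> 'b set" and \<kappa> :: "'j \<Rightarrow> 'b \<Rightarrow> 'q" and \<epsilon> :: "'j \<Rightarrow> 'b" and e :: nat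
begin

text \<open>The graph of the isomorphism relates \<open>r\<close> and \<open>s\<close> when the difference of their images in \<open>Q\<close> lies in
the set \<open>W\<close> of those elements of the maximal ideal that annihilate \<open>L = E.M j\<close> and have no component of
top degree \<open>d\<close>. Annihilating \<open>L\<close> means that the component in \<open>L\<close> is zero modulo the socle \<open>Z\<close>, and the
degree condition removes the ambiguity by \<open>Z = B d\<close>: both \<open>L\<close> and \<open>D.M i\<close> meet \<open>W\<close> only in zero, and \<open>W\<close> is
homogeneous and stable under constants.

The relation is multiplicative because matched pairs \<open>(x, y)\<close> and \<open>(x', y')\<close> have \<open>x x' = y y'\<close>, so
that \<open>(a + x)(a' + x') - (a + y)(a' + y') = a (x' - y') + a' (x - y)\<close>.\<close>

lemma matched_factors_isomorphic:
  assumes i: "i \<in> I" and j: "j \<in> J"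
    and right: "\<And>x. x \<in> D.M i \<Longrightarrow> \<exists>y\<in>E.M j. \<forall>z\<in>E.M j. x \<otimes> z = y \<otimes> z"
    and left: "\<And>y. y \<in> E.M j \<Longrightarrow> \<exists>x\<in>D.M i. \<forall>z\<in>E.M j. x \<otimes> z = y \<otimes> z"
    and isometry: "\<And>x x' y y'. \<lbrakk>x \<in> D.M i; x' \<in> D.M i; y \<in> E.M j; y' \<in> E.M j;
      \<forall>z\<in>E.M j. x \<otimes> z = y \<otimes> z; \<forall>z\<in>E.M j. x' \<otimes> z = y' \<otimes> z\<rbrakk> \<Longrightarrow> x \<otimes> x' = y \<otimes> y'"
  shows "graded_ring_isomorphic (R i) (A i) (S j) (C j)"
proof -
  interpret Ri: graded_artinian_ring "R i" "A i" by (rule D.factor[OF i])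
  interpret Sj: graded_artinian_ring "S j" "C j" by (rule E.factor[OF j])
  interpret f: ring_hom_cring "R i" Q "\<iota> i" by (rule D.embedding_hom_cring[OF i])
  interpret g: ring_hom_cring "S j" Q "\<kappa> j" by (rule E.embedding_hom_cring[OF j])
  let ?N = "degree_ge 1"
  define Z where "Z = self_annihilator Q ?N"
  have Z: "Z = B d" unfolding Z_def by (rule D.self_annihilator_degree)
  have Z_kill: "z \<otimes> n = \<zero>" if "z \<in> Z" "n \<in> ?N" for z n
    using that by (simp add: Z_def self_annihilator_def)
  have LN: "y \<in> ?N" if "y \<in> E.M j" for y using E.M_le[OF j] that by blast
  have MN: "x \<in> ?N" if "x \<in> D.M i" for x using D.M_le[OF i] that by blast
  have LC: "y \<in> carrier Q" if "y \<in> E.M j" for y using E.M_carrier[OF j that] .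
  have MC: "x \<in> carrier Q" if "x \<in> D.M i" for x using D.M_carrier[OF i that] .
  have N_sub: "additive_subgroup ?N Q" by (rule degree_ge_subgroup)
  have ZM: "Z \<subseteq> D.M i" unfolding Z_def by (rule D.rigid.annihilator_le[OF i])
  have ZL: "Z \<subseteq> E.M j" unfolding Z_def by (rule E.rigid.annihilator_le[OF j])
  define W where "W = {u \<in> ?N. component d u = \<zero> \<and> (\<forall>z\<in>E.M j. u \<otimes> z = \<zero>)}"
  have WC: "u \<in> carrier Q" if "u \<in> W" for u using that unfolding W_def by (blast intro: degree_ge_closed)
  have W_add: "u \<oplus> v \<in> W" if "u \<in> W" "v \<in> W" for u v
    using that WC[OF that(1)] WC[OF that(2)] LC degree_ge_add[of u 1 v]
    by (simp add: W_def component_add l_distr)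
  have W_minus: "\<ominus> u \<in> W" if "u \<in> W" for u
  proof -
    have "\<ominus> u \<in> ?N" using that additive_subgroup.a_inv_closed[OF N_sub]
      by (simp add: W_def)
    then show ?thesis using that WC[OF that] LC by (simp add: W_def component_minus l_minus)
  qed
  have W_diff: "u \<ominus> v \<in> W" if "u \<in> W" "v \<in> W" for u v
    using that W_add W_minus by (simp add: a_minus_def)
  have W_mult: "c \<otimes> u \<in> W" if c: "c \<in> B 0" and u: "u \<in> W" for c u
  proof -
    have cc: "c \<in> carrier Q" "u \<in> carrier Q" using c A_carrier WC[OF u] by auto
    have "component d (u \<otimes> c) = \<zero>"
      using component_mult_homogeneous[OF cc(2) c, of d] u cc by (simp add: W_def)
    moreover have "c \<otimes> u \<in> ?N" using u ideal.I_l_closed[OF degree_ge_ideal _ cc(1)] by (simp add: W_def)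
    ultimately show ?thesis using u cc LC by (simp add: W_def m_comm[of c u] m_assoc) (simp add: m_lcomm[of u c] LC)
  qed
  have W_component: "component n u \<in> W" if u: "u \<in> W" for n u
  proof -
    have uc: "u \<in> carrier Q" using WC[OF u] .
    have comp2: "component k (component n u) = (if k = n then component n u else \<zero>)" for k
      using component_homogeneous[OF component_mem[OF uc, of n], of k] .
    have kill: "component n u \<otimes> z = \<zero>" if z: "z \<in> E.M j" for z
    proof -
      obtain t where t: "t \<in> E.T j" "z = \<kappa> j t" using z unfolding E.M_def by blast
      have tc: "t \<in> carrier (S j)" using E.T_carrier[OF j t(1)] .
      have zc: "z \<in> carrier Q" using LC[OF z] .
      have "component n u \<otimes> component k z = \<zero>" for k
      proof -
        have "component k z \<in> E.M j"
        proof -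
          have "\<kappa> j (Sj.component k t) \<in> ?N"
            unfolding E.embedding_component[OF j tc, symmetric] t(2)[symmetric]
            using LN[OF z] component_homogeneous[OF component_mem[OF zc, of k], of 0] zc
            by (auto simp: degree_ge_def)
          then have "Sj.component k t \<in> E.T j" using E.embedding_in_M[OF j Sj.component_closed[OF tc]] by blast
          then show ?thesis unfolding E.M_def t(2) E.embedding_component[OF j tc] by blast
        qed
        then have "u \<otimes> component k z = \<zero>" using u by (simp add: W_def)
        then have "component (n + k) (u \<otimes> component k z) = \<zero>" by simp
        then show ?thesis using component_mult_homogeneous[OF uc component_mem[OF zc, of k], of "n + k"] by simp
      qed
      then have "finsum Q (\<lambda>k. component n u \<otimes> component k z) {k. component k z \<noteq> \<zero>} = \<zero>"
        by (simp add: finsum_zero)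
      moreover have "component n u \<otimes> finsum Q (\<lambda>k. component k z) {k. component k z \<noteq> \<zero>} =
          finsum Q (\<lambda>k. component n u \<otimes> component k z) {k. component k z \<noteq> \<zero>}"
        by (rule finsum_rdistr[OF component_finite[OF zc]]) (use uc zc in auto)
      ultimately show ?thesis using component_sum[OF zc] by simp
    qed
    have "component 0 u = \<zero>" "component d u = \<zero>" using u by (auto simp: W_def degree_ge_def)
    then show ?thesis using comp2 kill uc by (auto simp: W_def degree_ge_def)
  qed
  have Z_W: "x = \<zero>" if "x \<in> Z" "component d x = \<zero>" for x
    using component_homogeneous[of x d d] that unfolding Z by simp
  have L_W: "y = \<zero>" if "y \<in> E.M j" "y \<in> W" for y
  proof -
    have "y \<otimes> z = \<zero>" if z: "k \<in> J" "z \<in> E.M k" for k z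
    proof (cases "k = j")
      case True
      then show ?thesis using \<open>y \<in> W\<close> z by (simp add: W_def)
    next
      case False
      then show ?thesis using E.rigid.part_orthogonal[OF j z(1) _ \<open>y \<in> E.M j\<close> z(2)] by simp
    qed
    then have "y \<in> Z" unfolding Z_def by (rule E.rigid.self_annihilatorI[OF LN[OF \<open>y \<in> E.M j\<close>]])
    then show ?thesis using Z_W \<open>y \<in> W\<close> by (simp add: W_def)
  qed
  have M_W: "x = \<zero>" if x: "x \<in> D.M i" "x \<in> W" for x
  proof -
    have zero: "\<zero> \<in> E.M j" by (rule additive_subgroup.zero_closed[OF ideal.axioms(1)[OF E.M_ideal[OF j]]])
    have "x \<otimes> z = \<zero>" if z: "k \<in> I" "z \<in> D.M k" for k z
    proof (cases "k = i")
      case True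
      obtain y where y: "y \<in> E.M j" "\<forall>w\<in>E.M j. z \<otimes> w = y \<otimes> w" using right z True by blast
      have "x \<otimes> z = \<zero> \<otimes> y"
        by (rule isometry[OF x(1) _ zero y(1) _ y(2)]) (use z True x LC in \<open>auto simp: W_def\<close>)
      then show ?thesis using LC[OF y(1)] by simp
    next
      case False
      then show ?thesis using D.rigid.part_orthogonal[OF i z(1) _ x(1) z(2)] by simp
    qed
    then have "x \<in> Z" unfolding Z_def by (rule D.rigid.self_annihilatorI[OF MN[OF x(1)]])
    then show ?thesis using Z_W x by (simp add: W_def)
  qed
  (* A matched pair is corrected by the component of degree d of its difference; it lies in Z and
     hence in both ideals, so it can be absorbed on either side. *)
  have adjust: "\<exists>w\<in>Z. x \<ominus> y \<ominus> w \<in> W" if x: "x \<in> D.M i" and y: "y \<in> E.M j" and xy: "\<forall>z\<in>E.M j. x \<otimes> z = y \<otimes> z" for x y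
  proof -
    have c: "x \<in> carrier Q" "y \<in> carrier Q" using MC[OF x] LC[OF y] by auto
    define w where "w = component d (x \<ominus> y)"
    have w: "w \<in> Z" unfolding Z w_def using component_mem c by simp
    have wc: "w \<in> carrier Q" using w A_carrier unfolding Z by blast
    have "w \<in> ?N" using w by (simp add: Z_def self_annihilator_def)
    then have "x \<ominus> y \<ominus> w \<in> ?N"
      using MN[OF x] LN[OF y] ideal.diff_closed[OF degree_ge_ideal] by simp
    moreover have "component d (x \<ominus> y \<ominus> w) = \<zero>"
    proof -
      have 1: "component d w = w" using component_homogeneous[of w d d] w unfolding Z by simp
      have 2: "component d (x \<ominus> y) = w" by (simp only: w_def)
      show ?thesis
        unfolding component_diff[OF minus_closed[OF c] wc] 1 2 using wc by (simp add: minus_eq r_neg)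
    qed
    moreover have "(x \<ominus> y \<ominus> w) \<otimes> z = \<zero>" if z: "z \<in> E.M j" for z
    proof -
      have zc: "z \<in> carrier Q" using LC[OF z] .
      have "(x \<ominus> y \<ominus> w) \<otimes> z = x \<otimes> z \<ominus> y \<otimes> z \<ominus> w \<otimes> z" using c wc zc by algebra
      also have "\<dots> = \<zero>" using xy z Z_kill[OF w LN[OF z]] c zc by (simp add: minus_eq r_neg)
      finally show ?thesis .
    qed
    ultimately show ?thesis using w by (auto simp: W_def)
  qed
  have split_R: "\<exists>r0\<in>A i 0. \<exists>r1\<in>Ri.degree_ge 1. r = r0 \<oplus>\<^bsub>R i\<^esub> r1" if r: "r \<in> carrier (R i)" for r
  proof (intro bexI)
    have c: "Ri.component 0 r \<in> carrier (R i)" using r by simp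
    show "r = Ri.component 0 r \<oplus>\<^bsub>R i\<^esub> (r \<ominus>\<^bsub>R i\<^esub> Ri.component 0 r)" using r c by algebra
  qed (use Ri.minus_component_0[OF r] Ri.component_mem[OF r] in auto)
  have split_S: "\<exists>s0\<in>C j 0. \<exists>s1\<in>Sj.degree_ge 1. s = s0 \<oplus>\<^bsub>S j\<^esub> s1" if s: "s \<in> carrier (S j)" for s
  proof (intro bexI)
    have c: "Sj.component 0 s \<in> carrier (S j)" using s by simp
    show "s = Sj.component 0 s \<oplus>\<^bsub>S j\<^esub> (s \<ominus>\<^bsub>S j\<^esub> Sj.component 0 s)" using s c by algebra
  qed (use Sj.minus_component_0[OF s] Sj.component_mem[OF s] in auto)
  show ?thesis
  proof (rule graded_ring_isomorphic_by_relation[where P = "\<lambda>r s. \<iota> i r \<ominus> \<kappa> j s \<in> W"])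
    show "graded_artinian_ring (R i) (A i)" "graded_artinian_ring (S j) (C j)"
      by (rule D.factor[OF i] E.factor[OF j])+
    show "\<exists>s\<in>carrier (S j). \<iota> i r \<ominus> \<kappa> j s \<in> W" if r: "r \<in> carrier (R i)" for r
    proof -
      obtain r0 r1 where rr: "r0 \<in> A i 0" "r1 \<in> Ri.degree_ge 1" "r = r0 \<oplus>\<^bsub>R i\<^esub> r1" using split_R[OF r] by blast
      obtain s0 where s0: "s0 \<in> C j 0" "\<iota> i r0 = \<kappa> j s0"
        using E.embedding_degree_zero[OF j] D.embedding_graded[OF i rr(1)] by blast
      have x: "\<iota> i r1 \<in> D.M i" using rr(2) by (simp add: D.M_def)
      obtain y where y: "y \<in> E.M j" "\<forall>z\<in>E.M j. \<iota> i r1 \<otimes> z = y \<otimes> z" using right[OF x] by blast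
      obtain w where w: "w \<in> Z" "\<iota> i r1 \<ominus> y \<ominus> w \<in> W" using adjust[OF x y] by blast
      obtain s1 t where st: "s1 \<in> Sj.degree_ge 1" "y = \<kappa> j s1" "t \<in> Sj.degree_ge 1" "w = \<kappa> j t"
        using y(1) w(1) ZL unfolding E.M_def by blast
      have c: "r0 \<in> carrier (R i)" "r1 \<in> carrier (R i)" "s0 \<in> carrier (S j)" "s1 \<in> carrier (S j)" "t \<in> carrier (S j)"
        using rr s0 st Ri.A_carrier Sj.A_carrier Ri.degree_ge_closed Sj.degree_ge_closed by blast+
      have e: "\<iota> i r = \<kappa> j s0 \<oplus> \<iota> i r1" "\<kappa> j (s0 \<oplus>\<^bsub>S j\<^esub> s1 \<oplus>\<^bsub>S j\<^esub> t) = \<kappa> j s0 \<oplus> y \<oplus> w"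
        using rr(3) s0(2) st c by simp_all
      have qc: "\<kappa> j s0 \<in> carrier Q" "\<iota> i r1 \<in> carrier Q" "y \<in> carrier Q" "w \<in> carrier Q"
        using c st by auto
      have "\<iota> i r \<ominus> \<kappa> j (s0 \<oplus>\<^bsub>S j\<^esub> s1 \<oplus>\<^bsub>S j\<^esub> t) = \<iota> i r1 \<ominus> y \<ominus> w"
        unfolding e using qc by algebra
      then show ?thesis using w(2) c by (intro bexI[of _ "s0 \<oplus>\<^bsub>S j\<^esub> s1 \<oplus>\<^bsub>S j\<^esub> t"]) auto
    qed
    show "\<exists>r\<in>carrier (R i). \<iota> i r \<ominus> \<kappa> j s \<in> W" if s: "s \<in> carrier (S j)" for s
    proof -
      obtain s0 s1 where ss: "s0 \<in> C j 0" "s1 \<in> Sj.degree_ge 1" "s = s0 \<oplus>\<^bsub>S j\<^esub> s1" using split_S[OF s] by blast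
      obtain r0 where r0: "r0 \<in> A i 0" "\<kappa> j s0 = \<iota> i r0"
        using D.embedding_degree_zero[OF i] E.embedding_graded[OF j ss(1)] by blast
      have y: "\<kappa> j s1 \<in> E.M j" using ss(2) by (simp add: E.M_def)
      obtain x where x: "x \<in> D.M i" "\<forall>z\<in>E.M j. x \<otimes> z = \<kappa> j s1 \<otimes> z" using left[OF y] by blast
      obtain w where w: "w \<in> Z" "x \<ominus> \<kappa> j s1 \<ominus> w \<in> W" using adjust[OF x(1) y x(2)] by blast
      obtain r1 t where rt: "r1 \<in> Ri.degree_ge 1" "x = \<iota> i r1" "t \<in> Ri.degree_ge 1" "w = \<iota> i t"
        using x(1) w(1) ZM unfolding D.M_def by blast
      have c: "r0 \<in> carrier (R i)" "r1 \<in> carrier (R i)" "s0 \<in> carrier (S j)" "s1 \<in> carrier (S j)" "t \<in> carrier (R i)"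
        using ss r0 rt Ri.A_carrier Sj.A_carrier Ri.degree_ge_closed Sj.degree_ge_closed by blast+
      have e: "\<kappa> j s = \<iota> i r0 \<oplus> \<kappa> j s1" "\<iota> i (r0 \<oplus>\<^bsub>R i\<^esub> r1 \<oplus>\<^bsub>R i\<^esub> (\<ominus>\<^bsub>R i\<^esub> t)) = \<iota> i r0 \<oplus> x \<oplus> \<ominus> w"
        using ss(3) r0(2) rt c by simp_all
      have qc: "\<iota> i r0 \<in> carrier Q" "\<kappa> j s1 \<in> carrier Q" "x \<in> carrier Q" "w \<in> carrier Q"
        using c rt by auto
      have "\<iota> i (r0 \<oplus>\<^bsub>R i\<^esub> r1 \<oplus>\<^bsub>R i\<^esub> (\<ominus>\<^bsub>R i\<^esub> t)) \<ominus> \<kappa> j s = x \<ominus> \<kappa> j s1 \<ominus> w"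
        unfolding e using qc by algebra
      then show ?thesis using w(2) c by (intro bexI[of _ "r0 \<oplus>\<^bsub>R i\<^esub> r1 \<oplus>\<^bsub>R i\<^esub> (\<ominus>\<^bsub>R i\<^esub> t)"]) auto
    qed
  next
    fix r s s' assume h: "r \<in> carrier (R i)" "s \<in> carrier (S j)" "s' \<in> carrier (S j)"
      "\<iota> i r \<ominus> \<kappa> j s \<in> W" "\<iota> i r \<ominus> \<kappa> j s' \<in> W"
    have c: "\<iota> i r \<in> carrier Q" "\<kappa> j s \<in> carrier Q" "\<kappa> j s' \<in> carrier Q" using h by auto
    have "(\<iota> i r \<ominus> \<kappa> j s') \<ominus> (\<iota> i r \<ominus> \<kappa> j s) = \<kappa> j s \<ominus> \<kappa> j s'" using c by algebra
    then have W: "\<kappa> j s \<ominus> \<kappa> j s' \<in> W" using W_diff[OF h(5,4)] by simp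
    have e: "\<kappa> j (s \<ominus>\<^bsub>S j\<^esub> s') = \<kappa> j s \<ominus> \<kappa> j s'" using h by (simp add: a_minus_def)
    have "\<kappa> j (s \<ominus>\<^bsub>S j\<^esub> s') \<in> ?N" unfolding e using W by (simp add: W_def)
    then have "s \<ominus>\<^bsub>S j\<^esub> s' \<in> E.T j" using E.embedding_in_M[OF j] h by simp
    then have "\<kappa> j s \<ominus> \<kappa> j s' = \<zero>" using L_W[OF _ W] unfolding E.M_def e[symmetric] by blast
    then show "s = s'" using diff_eq_zero_iff[OF c(2,3)] inj_onD[OF E.embedding_inj[OF j]] h by blast
  next
    fix r r' s assume h: "r \<in> carrier (R i)" "r' \<in> carrier (R i)" "s \<in> carrier (S j)"
      "\<iota> i r \<ominus> \<kappa> j s \<in> W" "\<iota> i r' \<ominus> \<kappa> j s \<in> W"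
    have c: "\<iota> i r \<in> carrier Q" "\<iota> i r' \<in> carrier Q" "\<kappa> j s \<in> carrier Q" using h by auto
    have "(\<iota> i r \<ominus> \<kappa> j s) \<ominus> (\<iota> i r' \<ominus> \<kappa> j s) = \<iota> i r \<ominus> \<iota> i r'" using c by algebra
    then have W: "\<iota> i r \<ominus> \<iota> i r' \<in> W" using W_diff[OF h(4,5)] by simp
    have e: "\<iota> i (r \<ominus>\<^bsub>R i\<^esub> r') = \<iota> i r \<ominus> \<iota> i r'" using h by (simp add: a_minus_def)
    have "\<iota> i (r \<ominus>\<^bsub>R i\<^esub> r') \<in> ?N" unfolding e using W by (simp add: W_def)
    then have "r \<ominus>\<^bsub>R i\<^esub> r' \<in> D.T i" using D.embedding_in_M[OF i] h by simp
    then have "\<iota> i r \<ominus> \<iota> i r' = \<zero>" using M_W[OF _ W] unfolding D.M_def e[symmetric] by blast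
    then show "r = r'" using diff_eq_zero_iff[OF c(1,2)] inj_onD[OF D.embedding_inj[OF i]] h by blast
  next
    fix r r' s s' assume h: "r \<in> carrier (R i)" "r' \<in> carrier (R i)" "s \<in> carrier (S j)" "s' \<in> carrier (S j)"
      "\<iota> i r \<ominus> \<kappa> j s \<in> W" "\<iota> i r' \<ominus> \<kappa> j s' \<in> W"
    have c: "\<iota> i r \<in> carrier Q" "\<iota> i r' \<in> carrier Q" "\<kappa> j s \<in> carrier Q" "\<kappa> j s' \<in> carrier Q" using h by auto
    have "\<iota> i (r \<oplus>\<^bsub>R i\<^esub> r') \<ominus> \<kappa> j (s \<oplus>\<^bsub>S j\<^esub> s') = (\<iota> i r \<oplus> \<iota> i r') \<ominus> (\<kappa> j s \<oplus> \<kappa> j s')" using h by simp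
    also have "\<dots> = (\<iota> i r \<ominus> \<kappa> j s) \<oplus> (\<iota> i r' \<ominus> \<kappa> j s')" using c by algebra
    finally show "\<iota> i (r \<oplus>\<^bsub>R i\<^esub> r') \<ominus> \<kappa> j (s \<oplus>\<^bsub>S j\<^esub> s') \<in> W" using W_add h by simp
    obtain r0 r1 where rr: "r0 \<in> A i 0" "r1 \<in> Ri.degree_ge 1" "r = r0 \<oplus>\<^bsub>R i\<^esub> r1" using split_R[OF h(1)] by blast
    have parts: "\<exists>a\<in>B 0. \<exists>x\<in>D.M i. \<exists>y\<in>E.M j. \<iota> i r = a \<oplus> x \<and> \<kappa> j s = a \<oplus> y \<and> x \<ominus> y \<in> W \<and> (\<forall>z\<in>E.M j. x \<otimes> z = y \<otimes> z)"
      if rs: "r \<in> carrier (R i)" "s \<in> carrier (S j)" "\<iota> i r \<ominus> \<kappa> j s \<in> W" for r s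
    proof -
      have qc: "\<iota> i r \<in> carrier Q" "\<kappa> j s \<in> carrier Q" using rs by auto
      let ?a = "component 0 (\<iota> i r)"
      have "component 0 (\<iota> i r \<ominus> \<kappa> j s) = \<zero>" using rs(3) by (simp add: W_def degree_ge_def)
      then have "?a \<ominus> component 0 (\<kappa> j s) = \<zero>" using component_diff[OF qc] by simp
      then have a: "?a = component 0 (\<kappa> j s)"
        using diff_eq_zero_iff[OF component_closed[OF qc(1), of 0] component_closed[OF qc(2), of 0]] by blast
      have ac: "?a \<in> carrier Q" using qc by simp
      define x y where "x = \<iota> i r \<ominus> ?a" and "y = \<kappa> j s \<ominus> ?a"
      have "x = \<iota> i (r \<ominus>\<^bsub>R i\<^esub> Ri.component 0 r)"
        unfolding x_def D.embedding_component[OF i rs(1)] using rs by (simp add: a_minus_def)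
      then have x: "x \<in> D.M i" using Ri.minus_component_0[OF rs(1)] by (simp add: D.M_def)
      have "y = \<kappa> j (s \<ominus>\<^bsub>S j\<^esub> Sj.component 0 s)"
        unfolding y_def a E.embedding_component[OF j rs(2)] using rs by (simp add: a_minus_def)
      then have y: "y \<in> E.M j" using Sj.minus_component_0[OF rs(2)] by (simp add: E.M_def)
      have "x \<ominus> y = \<iota> i r \<ominus> \<kappa> j s" unfolding x_def y_def using qc ac by algebra
      then have xyW: "x \<ominus> y \<in> W" using rs(3) by simp
      have xz: "x \<otimes> z = y \<otimes> z" if z: "z \<in> E.M j" for z
      proof -
        have zc: "x \<in> carrier Q" "y \<in> carrier Q" "z \<in> carrier Q" using MC[OF x] LC[OF y] LC[OF z] by auto
        have "x \<otimes> z \<ominus> y \<otimes> z = (x \<ominus> y) \<otimes> z" using zc by algebra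
        also have "\<dots> = \<zero>" using xyW z by (simp add: W_def)
        finally show ?thesis using diff_eq_zero_iff[of "x \<otimes> z" "y \<otimes> z"] zc by simp
      qed
      have e: "\<iota> i r = ?a \<oplus> x" "\<kappa> j s = ?a \<oplus> y"
      proof -
        show "\<iota> i r = ?a \<oplus> x" unfolding x_def using qc(1) ac by algebra
        show "\<kappa> j s = ?a \<oplus> y" unfolding y_def using qc(2) ac by algebra
      qed
      show ?thesis
        by (rule bexI[OF _ component_mem[OF qc(1)]], rule bexI[OF _ x], rule bexI[OF _ y])
          (use e xyW xz in blast)
    qed
    obtain a x y where p: "a \<in> B 0" "x \<in> D.M i" "y \<in> E.M j" "\<iota> i r = a \<oplus> x" "\<kappa> j s = a \<oplus> y"
      "x \<ominus> y \<in> W" "\<forall>z\<in>E.M j. x \<otimes> z = y \<otimes> z" using parts[OF h(1,3,5)] by blast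
    obtain a' x' y' where p': "a' \<in> B 0" "x' \<in> D.M i" "y' \<in> E.M j" "\<iota> i r' = a' \<oplus> x'" "\<kappa> j s' = a' \<oplus> y'"
      "x' \<ominus> y' \<in> W" "\<forall>z\<in>E.M j. x' \<otimes> z = y' \<otimes> z" using parts[OF h(2,4,6)] by blast
    have iso: "x \<otimes> x' = y \<otimes> y'" by (rule isometry[OF p(2) p'(2) p(3) p'(3) p(7) p'(7)])
    have pc: "a \<in> carrier Q" "a' \<in> carrier Q" "x \<in> carrier Q" "x' \<in> carrier Q" "y \<in> carrier Q" "y' \<in> carrier Q"
      using A_carrier[OF p(1)] A_carrier[OF p'(1)] MC[OF p(2)] MC[OF p'(2)] LC[OF p(3)] LC[OF p'(3)] by auto
    have "\<iota> i (r \<otimes>\<^bsub>R i\<^esub> r') \<ominus> \<kappa> j (s \<otimes>\<^bsub>S j\<^esub> s') = (a \<oplus> x) \<otimes> (a' \<oplus> x') \<ominus> (a \<oplus> y) \<otimes> (a' \<oplus> y')"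
      using h p(4,5) p'(4,5) by simp
    also have "\<dots> = (a \<otimes> (x' \<ominus> y') \<oplus> a' \<otimes> (x \<ominus> y)) \<oplus> (x \<otimes> x' \<ominus> y \<otimes> y')"
      using pc by algebra
    also have "\<dots> = a \<otimes> (x' \<ominus> y') \<oplus> a' \<otimes> (x \<ominus> y)" unfolding iso using pc by (simp add: minus_eq r_neg)
    finally show "\<iota> i (r \<otimes>\<^bsub>R i\<^esub> r') \<ominus> \<kappa> j (s \<otimes>\<^bsub>S j\<^esub> s') \<in> W"
      using W_add[OF W_mult[OF p(1) p'(6)] W_mult[OF p'(1) p(6)]] by simp
  next
    have "\<zero> \<in> W" using LC by (simp add: W_def degree_ge_def)
    then show "\<iota> i \<one>\<^bsub>R i\<^esub> \<ominus> \<kappa> j \<one>\<^bsub>S j\<^esub> \<in> W" by (simp add: minus_eq r_neg)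
  next
    fix r s n assume h: "r \<in> carrier (R i)" "s \<in> carrier (S j)" "\<iota> i r \<ominus> \<kappa> j s \<in> W"
    have "component n (\<iota> i r \<ominus> \<kappa> j s) = \<iota> i (Ri.component n r) \<ominus> \<kappa> j (Sj.component n s)"
      using component_diff[of "\<iota> i r" "\<kappa> j s" n] h D.embedding_component[OF i h(1)] E.embedding_component[OF j h(2)] by simp
    then show "\<iota> i (Ri.component n r) \<ominus> \<kappa> j (Sj.component n s) \<in> W" using W_component[OF h(3), of n] by simp
  qed
qed

theorem matching_isomorphic:
  "\<exists>\<sigma>. bij_betw \<sigma> I J \<and> (\<forall>i\<in>I. graded_ring_isomorphic (R i) (A i) (S (\<sigma> i)) (C (\<sigma> i)))"
proof -
  interpret two_orthogonal_sums Q "degree_ge 1" I D.M J E.M ..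
  obtain \<sigma> where \<sigma>: "bij_betw \<sigma> I J" and m: "\<And>i. i \<in> I \<Longrightarrow>
    (\<forall>x\<in>D.M i. \<exists>y\<in>E.M (\<sigma> i). \<forall>z\<in>E.M (\<sigma> i). x \<otimes> z = y \<otimes> z) \<and>
    (\<forall>y\<in>E.M (\<sigma> i). \<exists>x\<in>D.M i. \<forall>z\<in>E.M (\<sigma> i). x \<otimes> z = y \<otimes> z) \<and>
    (\<forall>x\<in>D.M i. \<forall>x'\<in>D.M i. \<forall>y\<in>E.M (\<sigma> i). \<forall>y'\<in>E.M (\<sigma> i). (\<forall>z\<in>E.M (\<sigma> i). x \<otimes> z = y \<otimes> z) \<longrightarrow>
      (\<forall>z\<in>E.M (\<sigma> i). x' \<otimes> z = y' \<otimes> z) \<longrightarrow> x \<otimes> x' = y \<otimes> y')"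
    using matching by blast
  have "graded_ring_isomorphic (R i) (A i) (S (\<sigma> i)) (C (\<sigma> i))" if i: "i \<in> I" for i
    by (rule matched_factors_isomorphic[OF i bij_betwE[OF \<sigma>, rule_format, OF i]]) (use m[OF i] in blast)+
  then show ?thesis using \<sigma> by blast
qed

end

section \<open>The summands inside a connected sum\<close>

text \<open>The data of a graded connected sum with indecomposable summands, with the chosen socle generators of
common degree \<open>d\<close>.\<close>

locale graded_connected_sum =
  fixes K :: "('k, 'l) ring_scheme" and I :: "'i set" and R :: "'i \<Rightarrow> ('k, 'a, 'm) module_scheme"
    and A :: "'i \<Rightarrow> nat \<Rightarrow> 'a set" and \<delta> :: "'i \<Rightarrow> 'a" and d :: nat
  assumes base_cring: "cring K"
    and index_finite: "finite I" and index_nonempty: "I \<noteq> {}"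
    and factor_algebra: "i \<in> I \<Longrightarrow> graded_gorenstein_artinian_algebra K (R i) (A i)"
    and factor_generator: "i \<in> I \<Longrightarrow> socle_generator (R i) (\<delta> i)"
    and generator_degree: "i \<in> I \<Longrightarrow> \<delta> i \<in> A i d"
    and factor_length: "i \<in> I \<Longrightarrow> loewy_length (R i) \<ge> 3"
    and factor_indecomposable: "i \<in> I \<Longrightarrow> \<not> decomposes_as_connected_sum K (R i)"
begin

abbreviation \<pi> where "\<pi> \<equiv> \<lambda>i. algebra_residue K (R i)"

abbreviation sc where "sc i \<equiv> \<lambda>c. c \<odot>\<^bsub>R i\<^esub> \<one>\<^bsub>R i\<^esub>"

abbreviation T where "T i \<equiv> graded_artinian_ring.degree_ge (R i) (A i) 1"

lemma factor: "i \<in> I \<Longrightarrow> graded_residue_ring (R i) (A i) K (sc i) (\<pi> i)"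
  using graded_gorenstein_imp_residue_ring[OF factor_algebra] .

lemma factor_graded: "i \<in> I \<Longrightarrow> graded_artinian_ring (R i) (A i)"
  using graded_residue_ring.axioms(1)[OF factor] .

sublocale fibre_family I R K \<pi>
proof (rule fibre_family.intro)
  show "cring (R i)" if "i \<in> I" for i using graded_artinian_ring.axioms(1)[OF factor_graded[OF that]] .
  show "\<pi> i \<in> ring_hom (R i) K" if "i \<in> I" for i using graded_residue_ring.residue_hom[OF factor[OF that]] .
qed (rule base_cring)

abbreviation J where "J \<equiv> connected_sum_ideal I R \<pi> \<delta>"

lemma generator_props:
  assumes i: "i \<in> I"
  shows "\<delta> i \<in> carrier (R i)" "\<delta> i \<in> socle (R i)" "\<delta> i \<noteq> \<zero>\<^bsub>R i\<^esub>" "\<delta> i \<in> T i" "\<pi> i (\<delta> i) = \<zero>\<^bsub>K\<^esub>" "0 < d"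
proof -
  interpret Ri: graded_residue_ring "R i" "A i" K "sc i" "\<pi> i" by (rule factor[OF i])
  show g: "\<delta> i \<in> carrier (R i)" "\<delta> i \<in> socle (R i)" "\<delta> i \<noteq> \<zero>\<^bsub>R i\<^esub>"
    using Ri.socle_generator_nonzero[OF factor_generator[OF i]] by auto
  have "socle (R i) \<subseteq> T i"
    by (rule Ri.socle_le_degree_ge_1[OF factor_generator[OF i] Ri.cube_nonzero[OF factor_length[OF i]]])
  then show t: "\<delta> i \<in> T i" using g by blast
  then show "\<pi> i (\<delta> i) = \<zero>\<^bsub>K\<^esub>" using Ri.residue_zero_iff[OF g(1)] by simp
  have "d \<noteq> 0"
  proof
    assume "d = 0"
    then have "Ri.component 0 (\<delta> i) = \<delta> i"
      using Ri.component_homogeneous[OF generator_degree[OF i], of 0] by simp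
    then show False using t g by (simp add: Ri.degree_ge_def)
  qed
  then show "0 < d" by simp
qed

lemma J_ideal: "ideal J F"
  by (rule connected_sum_ideal_ideal(1)) (use generator_props in auto)

text \<open>The embedding of \<open>R i\<close> in the fibre product: the other entries are the constants with the same
residue.\<close>

definition \<theta> where "\<theta> i r = (\<lambda>j\<in>I. if j = i then r else sc j (\<pi> i r))"

lemma scalar_zero: "j \<in> I \<Longrightarrow> sc j \<zero>\<^bsub>K\<^esub> = \<zero>\<^bsub>R j\<^esub>"
  using ring_hom_zero[OF graded_residue_ring.scalar_hom[OF factor] cring.axioms(1)[OF base_cring]
      cring.axioms(1)[OF factor_cring]] by simp

lemma \<theta>_closed:
  assumes i: "i \<in> I" and r: "r \<in> carrier (R i)" shows "\<theta> i r \<in> carrier F"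
proof (rule fibre_carrierI)
  interpret Ri: graded_residue_ring "R i" "A i" K "sc i" "\<pi> i" by (rule factor[OF i])
  have val: "\<pi> j (\<theta> i r j) = \<pi> i r \<and> \<theta> i r j \<in> carrier (R j)" if j: "j \<in> I" for j
  proof -
    interpret Rj: graded_residue_ring "R j" "A j" K "sc j" "\<pi> j" by (rule factor[OF j])
    show ?thesis
      using j r Rj.residue_scalar[OF Ri.residue.hom_closed[OF r]] Rj.scalar.hom_closed[OF Ri.residue.hom_closed[OF r]]
      by (auto simp: \<theta>_def)
  qed
  show "\<theta> i r j \<in> carrier (R j)" if "j \<in> I" for j using val that by blast
  show "\<pi> j (\<theta> i r j) = \<pi> k (\<theta> i r k)" if "j \<in> I" "k \<in> I" for j k
    using val[OF that(1)] val[OF that(2)] by simp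
qed (simp add: \<theta>_def)

lemma \<theta>_hom: "i \<in> I \<Longrightarrow> \<theta> i \<in> ring_hom (R i) F"
proof (rule ring_hom_memI)
  assume i: "i \<in> I"
  interpret Ri: graded_residue_ring "R i" "A i" K "sc i" "\<pi> i" by (rule factor[OF i])
  fix r s assume rs: "r \<in> carrier (R i)" "s \<in> carrier (R i)"
  have sc_hom: "sc j (\<pi> i (r \<otimes>\<^bsub>R i\<^esub> s)) = sc j (\<pi> i r) \<otimes>\<^bsub>R j\<^esub> sc j (\<pi> i s)"
    "sc j (\<pi> i (r \<oplus>\<^bsub>R i\<^esub> s)) = sc j (\<pi> i r) \<oplus>\<^bsub>R j\<^esub> sc j (\<pi> i s)" if j: "j \<in> I" for j
  proof -
    interpret Rj: graded_residue_ring "R j" "A j" K "sc j" "\<pi> j" by (rule factor[OF j])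
    note h = Rj.scalar.hom_mult[of "\<pi> i r" "\<pi> i s"] Rj.scalar.hom_add[of "\<pi> i r" "\<pi> i s"]
    show "sc j (\<pi> i (r \<otimes>\<^bsub>R i\<^esub> s)) = sc j (\<pi> i r) \<otimes>\<^bsub>R j\<^esub> sc j (\<pi> i s)"
      "sc j (\<pi> i (r \<oplus>\<^bsub>R i\<^esub> s)) = sc j (\<pi> i r) \<oplus>\<^bsub>R j\<^esub> sc j (\<pi> i s)"
      using h rs by simp_all
  qed
  note c = \<theta>_closed[OF i rs(1)] \<theta>_closed[OF i rs(2)]
  show "\<theta> i (r \<otimes>\<^bsub>R i\<^esub> s) = \<theta> i r \<otimes>\<^bsub>F\<^esub> \<theta> i s"
    by (rule fibre_ext[OF \<theta>_closed[OF i Ri.m_closed[OF rs]] fibre_mult_closed[OF c]])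
      (use sc_hom in \<open>auto simp: fibre_mult \<theta>_def\<close>)
  show "\<theta> i (r \<oplus>\<^bsub>R i\<^esub> s) = \<theta> i r \<oplus>\<^bsub>F\<^esub> \<theta> i s"
    by (rule fibre_ext[OF \<theta>_closed[OF i Ri.a_closed[OF rs]] fibre_add_closed[OF c]])
      (use sc_hom in \<open>auto simp: fibre_add \<theta>_def\<close>)
next
  assume i: "i \<in> I"
  interpret Ri: graded_residue_ring "R i" "A i" K "sc i" "\<pi> i" by (rule factor[OF i])
  have "sc j \<one>\<^bsub>K\<^esub> = \<one>\<^bsub>R j\<^esub>" if "j \<in> I" for j
    using ring_hom_one[OF graded_residue_ring.scalar_hom[OF factor[OF that]]] .
  then show "\<theta> i \<one>\<^bsub>R i\<^esub> = \<one>\<^bsub>F\<^esub>"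
    by (intro fibre_ext[OF \<theta>_closed[OF i Ri.one_closed] fibre_one_closed]) (auto simp: fibre_one \<theta>_def)
qed (rule \<theta>_closed)

lemma \<theta>_single: "\<lbrakk>i \<in> I; r \<in> T i\<rbrakk> \<Longrightarrow> \<theta> i r = single_entry I R i r"
proof -
  assume i: "i \<in> I" and r: "r \<in> T i"
  interpret Ri: graded_residue_ring "R i" "A i" K "sc i" "\<pi> i" by (rule factor[OF i])
  have "\<pi> i r = \<zero>\<^bsub>K\<^esub>" using Ri.residue_zero_iff[OF Ri.degree_ge_closed[OF r]] r by simp
  then show ?thesis using scalar_zero by (auto simp: \<theta>_def single_entry_def)
qed

text \<open>The ideal generated by the differences of the socle generators, in coordinates: the tuples of socle
elements whose coefficients add up to zero.\<close>

definition null_tuples where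
  "null_tuples = {t \<in> carrier F. \<exists>c \<in> I \<rightarrow> carrier K. finsum K c I = \<zero>\<^bsub>K\<^esub> \<and>
    (\<forall>i\<in>I. t i = sc i (c i) \<otimes>\<^bsub>R i\<^esub> \<delta> i)}"

lemma J_le_null_tuples: "J \<subseteq> null_tuples"
proof (rule connected_sum_ideal_ideal(3))
  interpret K: cring K by (rule base_cring)
  show "\<delta> i \<in> carrier (R i)" "\<pi> i (\<delta> i) = \<zero>\<^bsub>K\<^esub>" if "i \<in> I" for i
    using generator_props[OF that] by auto
  show "ideal null_tuples F"
  proof (rule F.commutative_idealI)
    show "null_tuples \<subseteq> carrier F" by (auto simp: null_tuples_def)
    have "finsum K (\<lambda>_. \<zero>\<^bsub>K\<^esub>) I = \<zero>\<^bsub>K\<^esub>" by simp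
    moreover have "\<zero>\<^bsub>F\<^esub> i = sc i \<zero>\<^bsub>K\<^esub> \<otimes>\<^bsub>R i\<^esub> \<delta> i" if i: "i \<in> I" for i
    proof -
      interpret Ri: cring "R i" by (rule factor_cring[OF i])
      show ?thesis using scalar_zero[OF i] generator_props(1)[OF i] fibre_zero[OF i] by simp
    qed
    ultimately show "\<zero>\<^bsub>F\<^esub> \<in> null_tuples"
      unfolding null_tuples_def by (auto intro!: bexI[of _ "\<lambda>_. \<zero>\<^bsub>K\<^esub>"])
  next
    fix t u assume "t \<in> null_tuples" "u \<in> null_tuples"
    then obtain b c where t: "t \<in> carrier F" "b \<in> I \<rightarrow> carrier K" "finsum K b I = \<zero>\<^bsub>K\<^esub>"
        "\<And>i. i \<in> I \<Longrightarrow> t i = sc i (b i) \<otimes>\<^bsub>R i\<^esub> \<delta> i"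
      and u: "u \<in> carrier F" "c \<in> I \<rightarrow> carrier K" "finsum K c I = \<zero>\<^bsub>K\<^esub>"
        "\<And>i. i \<in> I \<Longrightarrow> u i = sc i (c i) \<otimes>\<^bsub>R i\<^esub> \<delta> i"
      unfolding null_tuples_def by blast
    have "finsum K (\<lambda>i. b i \<oplus>\<^bsub>K\<^esub> c i) I = \<zero>\<^bsub>K\<^esub>" using K.finsum_addf[OF t(2) u(2)] t(3) u(3) by simp
    moreover have "(t \<oplus>\<^bsub>F\<^esub> u) i = sc i (b i \<oplus>\<^bsub>K\<^esub> c i) \<otimes>\<^bsub>R i\<^esub> \<delta> i" if i: "i \<in> I" for i
    proof -
      interpret Ri: graded_residue_ring "R i" "A i" K "sc i" "\<pi> i" by (rule factor[OF i])
      have bc: "b i \<in> carrier K" "c i \<in> carrier K" using t u i by auto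
      have "sc i (b i \<oplus>\<^bsub>K\<^esub> c i) \<otimes>\<^bsub>R i\<^esub> \<delta> i = (sc i (b i) \<oplus>\<^bsub>R i\<^esub> sc i (c i)) \<otimes>\<^bsub>R i\<^esub> \<delta> i"
        unfolding Ri.scalar.hom_add[OF bc] ..
      also have "\<dots> = sc i (b i) \<otimes>\<^bsub>R i\<^esub> \<delta> i \<oplus>\<^bsub>R i\<^esub> sc i (c i) \<otimes>\<^bsub>R i\<^esub> \<delta> i"
        by (rule Ri.l_distr[OF Ri.scalar.hom_closed[OF bc(1)] Ri.scalar.hom_closed[OF bc(2)] generator_props(1)[OF i]])
      finally show ?thesis unfolding fibre_add[OF i] t(4)[OF i] u(4)[OF i] by simp
    qed
    moreover have "(\<lambda>i. b i \<oplus>\<^bsub>K\<^esub> c i) \<in> I \<rightarrow> carrier K" using t(2) u(2) by auto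
    ultimately show "t \<oplus>\<^bsub>F\<^esub> u \<in> null_tuples"
      unfolding null_tuples_def using F.a_closed[OF t(1) u(1)] by blast
  next
    fix r t assume r: "r \<in> carrier F" and "t \<in> null_tuples"
    then obtain c where t: "t \<in> carrier F" "c \<in> I \<rightarrow> carrier K" "finsum K c I = \<zero>\<^bsub>K\<^esub>"
        "\<And>i. i \<in> I \<Longrightarrow> t i = sc i (c i) \<otimes>\<^bsub>R i\<^esub> \<delta> i"
      unfolding null_tuples_def by blast
    obtain i0 where i0: "i0 \<in> I" using index_nonempty by blast
    define k where "k = \<pi> i0 (r i0)"
    have k: "\<pi> i (r i) = k" if "i \<in> I" for i using r that i0 unfolding k_def fibre_carrier_iff by blast
    have kc: "k \<in> carrier K"
      unfolding k_def using ring_hom_closed[OF factor_hom[OF i0] fibre_entry[OF r i0]] .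
    have "finsum K (\<lambda>i. k \<otimes>\<^bsub>K\<^esub> c i) I = k \<otimes>\<^bsub>K\<^esub> finsum K c I"
      by (rule K.finsum_rdistr[symmetric]) (use index_finite kc t in auto)
    then have "finsum K (\<lambda>i. k \<otimes>\<^bsub>K\<^esub> c i) I = \<zero>\<^bsub>K\<^esub>" using t(3) kc by simp
    moreover have "(r \<otimes>\<^bsub>F\<^esub> t) i = sc i (k \<otimes>\<^bsub>K\<^esub> c i) \<otimes>\<^bsub>R i\<^esub> \<delta> i" if i: "i \<in> I" for i
    proof -
      interpret Ri: graded_residue_ring "R i" "A i" K "sc i" "\<pi> i" by (rule factor[OF i])
      note g = generator_props[OF i]
      have ci: "c i \<in> carrier K" using t i by auto
      have c: "r i \<in> carrier (R i)" "sc i (c i) \<in> carrier (R i)" "sc i k \<in> carrier (R i)"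
        using fibre_entry[OF r i] Ri.scalar.hom_closed[OF ci] Ri.scalar.hom_closed[OF kc] by auto
      have e: "sc i k = Ri.component 0 (r i)" using Ri.scalar_residue[OF c(1)] k[OF i] by simp
      have n: "r i \<ominus>\<^bsub>R i\<^esub> sc i k \<in> T i" unfolding e using Ri.minus_component_0[OF c(1)] .
      have "\<delta> i \<otimes>\<^bsub>R i\<^esub> (r i \<ominus>\<^bsub>R i\<^esub> sc i k) = \<zero>\<^bsub>R i\<^esub>" using g(2) n by (simp only: Ri.socle_eq mem_Collect_eq)
      moreover have "r i \<otimes>\<^bsub>R i\<^esub> (sc i (c i) \<otimes>\<^bsub>R i\<^esub> \<delta> i) = sc i (c i) \<otimes>\<^bsub>R i\<^esub> (\<delta> i \<otimes>\<^bsub>R i\<^esub> (r i \<ominus>\<^bsub>R i\<^esub> sc i k))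
          \<oplus>\<^bsub>R i\<^esub> (sc i k \<otimes>\<^bsub>R i\<^esub> sc i (c i)) \<otimes>\<^bsub>R i\<^esub> \<delta> i"
        using c g(1) by algebra
      moreover have "sc i (k \<otimes>\<^bsub>K\<^esub> c i) = sc i k \<otimes>\<^bsub>R i\<^esub> sc i (c i)" by (rule Ri.scalar.hom_mult[OF kc ci])
      ultimately show ?thesis unfolding fibre_mult[OF i] t(4)[OF i] using c g(1) by simp
    qed
    moreover have "(\<lambda>i. k \<otimes>\<^bsub>K\<^esub> c i) \<in> I \<rightarrow> carrier K" using t(2) kc by auto
    ultimately show "r \<otimes>\<^bsub>F\<^esub> t \<in> null_tuples"
      unfolding null_tuples_def using F.m_closed[OF r t(1)] by blast
  qed
  fix i j assume ij: "i \<in> I" "j \<in> I"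
  let ?g = "single_entry I R i (\<delta> i) \<ominus>\<^bsub>F\<^esub> single_entry I R j (\<delta> j)"
  have s: "single_entry I R i (\<delta> i) \<in> carrier F" if "i \<in> I" for i
    using single_entry_closed[OF that generator_props(1,5)[OF that]] .
  (* The coefficients of the difference of two generators. They are written as a sum so that the case
     i = j, where they cancel, is included. *)
  define c where "c l = (if i = l then \<one>\<^bsub>K\<^esub> else \<zero>\<^bsub>K\<^esub>) \<oplus>\<^bsub>K\<^esub> (if j = l then \<ominus>\<^bsub>K\<^esub> \<one>\<^bsub>K\<^esub> else \<zero>\<^bsub>K\<^esub>)" for l
  have "finsum K c I = finsum K (\<lambda>l. if i = l then \<one>\<^bsub>K\<^esub> else \<zero>\<^bsub>K\<^esub>) I
      \<oplus>\<^bsub>K\<^esub> finsum K (\<lambda>l. if j = l then \<ominus>\<^bsub>K\<^esub> \<one>\<^bsub>K\<^esub> else \<zero>\<^bsub>K\<^esub>) I"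
    unfolding c_def by (rule K.finsum_addf) auto
  also have "finsum K (\<lambda>l. if i = l then \<one>\<^bsub>K\<^esub> else \<zero>\<^bsub>K\<^esub>) I = \<one>\<^bsub>K\<^esub>"
    using K.finsum_singleton[OF ij(1) index_finite, of "\<lambda>_. \<one>\<^bsub>K\<^esub>"] by simp
  also have "finsum K (\<lambda>l. if j = l then \<ominus>\<^bsub>K\<^esub> \<one>\<^bsub>K\<^esub> else \<zero>\<^bsub>K\<^esub>) I = \<ominus>\<^bsub>K\<^esub> \<one>\<^bsub>K\<^esub>"
    using K.finsum_singleton[OF ij(2) index_finite, of "\<lambda>_. \<ominus>\<^bsub>K\<^esub> \<one>\<^bsub>K\<^esub>"] by simp
  also have "\<one>\<^bsub>K\<^esub> \<oplus>\<^bsub>K\<^esub> \<ominus>\<^bsub>K\<^esub> \<one>\<^bsub>K\<^esub> = \<zero>\<^bsub>K\<^esub>" by (simp add: K.r_neg)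
  finally have "finsum K c I = \<zero>\<^bsub>K\<^esub>" .
  moreover have "?g l = sc l (c l) \<otimes>\<^bsub>R l\<^esub> \<delta> l" if l: "l \<in> I" for l
  proof -
    interpret Rl: graded_residue_ring "R l" "A l" K "sc l" "\<pi> l" by (rule factor[OF l])
    note g = generator_props(1)[OF l]
    have e: "?g l = single_entry I R i (\<delta> i) l \<ominus>\<^bsub>R l\<^esub> single_entry I R j (\<delta> j) l"
      by (rule fibre_minus[OF l s[OF ij(1)] s[OF ij(2)]])
    have sums: "sc l (c l) = (if i = l then \<one>\<^bsub>R l\<^esub> else \<zero>\<^bsub>R l\<^esub>) \<oplus>\<^bsub>R l\<^esub> (if j = l then \<ominus>\<^bsub>R l\<^esub> \<one>\<^bsub>R l\<^esub> else \<zero>\<^bsub>R l\<^esub>)"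
      using Rl.scalar.hom_one Rl.scalar.hom_zero Rl.scalar.hom_a_inv[of "\<one>\<^bsub>K\<^esub>"]
        Rl.scalar.hom_add[of "if i = l then \<one>\<^bsub>K\<^esub> else \<zero>\<^bsub>K\<^esub>" "if j = l then \<ominus>\<^bsub>K\<^esub> \<one>\<^bsub>K\<^esub> else \<zero>\<^bsub>K\<^esub>"]
      unfolding c_def by (auto split: if_splits)
    have "single_entry I R i (\<delta> i) l = (if i = l then \<delta> l else \<zero>\<^bsub>R l\<^esub>)"
      "single_entry I R j (\<delta> j) l = (if j = l then \<delta> l else \<zero>\<^bsub>R l\<^esub>)"
      using l by (auto simp: single_entry_def)
    then show ?thesis
      unfolding e sums using g
      by (cases "i = l"; cases "j = l") (simp_all add: Rl.l_distr Rl.l_minus a_minus_def Rl.r_neg)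
  qed
  moreover have "c \<in> I \<rightarrow> carrier K" by (auto simp: c_def)
  ultimately show "?g \<in> null_tuples"
    unfolding null_tuples_def using F.minus_closed[OF s[OF ij(1)] s[OF ij(2)]] by blast
qed

text \<open>A tuple in the image of \<open>\<theta> i\<close> has a constant in every entry other than \<open>i\<close>. If it is a null tuple, these
entries are both constant and in the socle, so their coefficients are zero; the coefficient at \<open>i\<close> is
then zero as well because the sum is. With a single summand only the last step occurs.\<close>

lemma \<theta>_in_J_imp_zero:
  assumes i: "i \<in> I" and r: "r \<in> carrier (R i)" and J: "\<theta> i r \<in> J"
  shows "r = \<zero>\<^bsub>R i\<^esub>"
proof -
  interpret K: cring K by (rule base_cring)
  interpret Ri: graded_residue_ring "R i" "A i" K "sc i" "\<pi> i" by (rule factor[OF i])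
  obtain c where c: "c \<in> I \<rightarrow> carrier K" "finsum K c I = \<zero>\<^bsub>K\<^esub>"
    "\<And>j. j \<in> I \<Longrightarrow> \<theta> i r j = sc j (c j) \<otimes>\<^bsub>R j\<^esub> \<delta> j"
    using J J_le_null_tuples unfolding null_tuples_def by blast
  have ri: "r = sc i (c i) \<otimes>\<^bsub>R i\<^esub> \<delta> i" using c(3)[OF i] i by (simp add: \<theta>_def)
  have ci: "c i \<in> carrier K" using c(1) i by auto
  have pr: "\<pi> i r = \<zero>\<^bsub>K\<^esub>"
    unfolding ri using Ri.residue.hom_mult[OF Ri.scalar.hom_closed[OF ci] generator_props(1)[OF i]]
      generator_props(5)[OF i] Ri.residue.hom_closed[OF Ri.scalar.hom_closed[OF ci]] by simp
  have zero: "c j = \<zero>\<^bsub>K\<^esub>" if j: "j \<in> I" "j \<noteq> i" for j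
  proof (rule ccontr)
    assume nz: "c j \<noteq> \<zero>\<^bsub>K\<^esub>"
    interpret Rj: graded_residue_ring "R j" "A j" K "sc j" "\<pi> j" by (rule factor[OF j(1)])
    have cj: "c j \<in> carrier K" using c(1) j by auto
    have "sc j (c j) \<noteq> \<zero>\<^bsub>R j\<^esub>"
      using Rj.residue_scalar[OF cj] nz Rj.residue.hom_zero by auto
    then obtain y where y: "y \<in> A j 0" "sc j (c j) \<otimes>\<^bsub>R j\<^esub> y = \<one>\<^bsub>R j\<^esub>"
      using Rj.degree_zero_field[OF Rj.scalar_degree[OF cj]] by blast
    have yc: "y \<in> carrier (R j)" "sc j (c j) \<in> carrier (R j)" "\<delta> j \<in> carrier (R j)"
      using y Rj.A_carrier Rj.scalar.hom_closed[OF cj] generator_props(1)[OF j(1)] by auto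
    have "sc j (c j) \<otimes>\<^bsub>R j\<^esub> \<delta> j = \<zero>\<^bsub>R j\<^esub>"
      using c(3)[OF j(1)] j pr scalar_zero[OF j(1)] by (simp add: \<theta>_def)
    then have "y \<otimes>\<^bsub>R j\<^esub> (sc j (c j) \<otimes>\<^bsub>R j\<^esub> \<delta> j) = \<zero>\<^bsub>R j\<^esub>" using yc by simp
    moreover have "y \<otimes>\<^bsub>R j\<^esub> (sc j (c j) \<otimes>\<^bsub>R j\<^esub> \<delta> j) = (sc j (c j) \<otimes>\<^bsub>R j\<^esub> y) \<otimes>\<^bsub>R j\<^esub> \<delta> j"
      using yc by algebra
    ultimately show False using y(2) yc generator_props(3)[OF j(1)] by simp
  qed
  have "finsum K c I = finsum K (\<lambda>j. if i = j then c j else \<zero>\<^bsub>K\<^esub>) I"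
    by (rule K.finsum_cong) (use zero c(1) in \<open>auto simp: simp_implies_def\<close>)
  also have "\<dots> = c i" by (rule K.finsum_singleton[OF i index_finite c(1)])
  finally have "c i = \<zero>\<^bsub>K\<^esub>" using c(2) by simp
  then show ?thesis unfolding ri using scalar_zero[OF i] generator_props(1)[OF i] by simp
qed

lemma \<theta>_homogeneous:
  assumes i: "i \<in> I" and r: "r \<in> A i n" and j: "j \<in> I"
  shows "\<theta> i r j \<in> A j n"
proof -
  interpret Ri: graded_residue_ring "R i" "A i" K "sc i" "\<pi> i" by (rule factor[OF i])
  interpret Rj: graded_residue_ring "R j" "A j" K "sc j" "\<pi> j" by (rule factor[OF j])
  have rc: "r \<in> carrier (R i)" using r by (rule Ri.A_carrier)
  show ?thesis
  proof (cases "n = 0 \<or> j = i")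
    case True
    then show ?thesis
      using r j Rj.scalar_degree[OF Ri.residue.hom_closed[OF rc]] by (auto simp: \<theta>_def)
  next
    case False
    then have "r \<in> T i" using Ri.homogeneous_degree_ge[OF r, of 1] by simp
    then show ?thesis using \<theta>_single[OF i] False j Rj.A_zero by (simp add: single_entry_def)
  qed
qed

lemma tuple_sum:
  assumes t: "t \<in> carrier F" and T: "\<And>i. i \<in> I \<Longrightarrow> t i \<in> T i"
  shows "t = finsum F (\<lambda>i. \<theta> i (t i)) I"
proof (rule fibre_ext[OF t])
  have c: "\<theta> i (t i) \<in> carrier F" if "i \<in> I" for i using \<theta>_closed[OF that fibre_entry[OF t that]] .
  then show "finsum F (\<lambda>i. \<theta> i (t i)) I \<in> carrier F" by (intro F.finsum_closed) auto
  fix j assume j: "j \<in> I"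
  interpret Rj: graded_residue_ring "R j" "A j" K "sc j" "\<pi> j" by (rule factor[OF j])
  interpret p: ring_hom_cring F "R j" "\<lambda>x. x j" by (rule projection_hom_cring[OF j])
  have "finsum F (\<lambda>i. \<theta> i (t i)) I j = finsum (R j) ((\<lambda>x. x j) \<circ> (\<lambda>i. \<theta> i (t i))) I"
    by (rule p.hom_finsum) (use c in auto)
  also have "\<dots> = finsum (R j) (\<lambda>i. if j = i then t j else \<zero>\<^bsub>R j\<^esub>) I"
    by (rule Rj.finsum_cong)
      (use fibre_entry[OF t j] \<theta>_single[OF _ T] j in \<open>auto simp: simp_implies_def single_entry_def\<close>)
  also have "\<dots> = t j"
    by (rule Rj.finsum_singleton[OF j index_finite]) (use fibre_entry[OF t j] in auto)
  finally show "t j = finsum F (\<lambda>i. \<theta> i (t i)) I j" by simp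
qed

lemma degree_zero_tuple:
  assumes t: "t \<in> carrier F" "\<And>j. j \<in> I \<Longrightarrow> t j \<in> A j 0" and i: "i \<in> I"
  shows "t = \<theta> i (t i)"
proof (rule fibre_ext[OF t(1) \<theta>_closed[OF i fibre_entry[OF t(1) i]]])
  fix j assume j: "j \<in> I"
  interpret Rj: graded_residue_ring "R j" "A j" K "sc j" "\<pi> j" by (rule factor[OF j])
  have "\<pi> j (t j) = \<pi> i (t i)" using t(1) i j unfolding fibre_carrier_iff by blast
  then have "sc j (\<pi> i (t i)) = t j"
    using Rj.scalar_residue[OF fibre_entry[OF t(1) j]] Rj.component_homogeneous[OF t(2)[OF j], of 0] by simp
  then show "t j = \<theta> i (t i) j" using j by (simp add: \<theta>_def)
qed

text \<open>The embedding \<open>\<iota> i\<close> is \<open>\<theta> i\<close> followed by the quotient map and the given isomorphism. For the spanning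
property an element of positive degree is first cut into homogeneous components, because the grading of the
connected sum lifts homogeneous elements to homogeneous tuples, and these have all entries in the maximal
ideals.\<close>

theorem decomposition:
  assumes Q: "graded_artinian_ring Q B"
    and iso: "graded_ring_isomorphic Q B (connected_sum I R \<pi> \<delta>) (connected_sum_component I R A \<pi> \<delta>)"
  shows "\<exists>\<iota>. graded_decomposition Q B I R A \<iota> \<delta> d"
proof -
  interpret Q: graded_artinian_ring Q B by (rule Q)
  interpret J: ideal J F by (rule J_ideal)
  let ?CS = "connected_sum I R \<pi> \<delta>"
  interpret CS: cring ?CS unfolding connected_sum_def by (rule J.quotient_is_cring[OF fibre_product_cring])
  define q where "q x = J +>\<^bsub>F\<^esub> x" for x
  have q_hom: "q \<in> ring_hom F ?CS"
    using J.rcos_ring_hom unfolding connected_sum_def q_def[abs_def] .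
  interpret q: ring_hom_cring F ?CS q
    by (intro ring_hom_cring.intro ring_hom_cring_axioms.intro fibre_product_cring CS.is_cring q_hom)
  have q_zero: "q x = \<zero>\<^bsub>?CS\<^esub> \<longleftrightarrow> x \<in> J" if x: "x \<in> carrier F" for x
  proof -
    have "\<zero>\<^bsub>?CS\<^esub> = J" by (simp add: connected_sum_def FactRing_def)
    then show ?thesis
      unfolding q_def using J.rcos_const_imp_mem[OF x] F.a_rcos_zero[OF J_ideal] by auto
  qed
  obtain h where h: "h \<in> ring_iso Q ?CS" "\<And>n. h ` B n = connected_sum_component I R A \<pi> \<delta> n"
    using iso unfolding graded_ring_isomorphic_def by blast
  define g where "g = inv_into (carrier Q) h"
  have g_iso: "g \<in> ring_iso ?CS Q" unfolding g_def by (rule ring_iso_set_sym[OF Q.ring_axioms h(1)])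
  have g_hom: "g \<in> ring_hom ?CS Q" using g_iso by (simp add: ring_iso_def)
  have h_inj: "inj_on h (carrier Q)" and h_surj: "h ` carrier Q = carrier ?CS"
    using ring_iso_memE(5)[OF h(1)] by (auto simp: bij_betw_def)
  have gh: "g (h x) = x" if "x \<in> carrier Q" for x unfolding g_def by (rule inv_into_f_f[OF h_inj that])
  have hg: "h (g y) = y" if "y \<in> carrier ?CS" for y
    unfolding g_def using that h_surj by (simp add: f_inv_into_f)
  interpret g: ring_hom_cring ?CS Q g
    by (intro ring_hom_cring.intro ring_hom_cring_axioms.intro CS.is_cring Q.is_cring g_hom)
  define \<phi> where "\<phi> x = g (q x)" for x
  have \<phi>_hom: "\<phi> \<in> ring_hom F Q" unfolding \<phi>_def[abs_def] using ring_hom_trans[OF q_hom g_hom] by (simp add: comp_def)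
  interpret \<phi>: ring_hom_cring F Q \<phi>
    by (intro ring_hom_cring.intro ring_hom_cring_axioms.intro fibre_product_cring Q.is_cring \<phi>_hom)
  have \<phi>_zero: "\<phi> x = \<zero>\<^bsub>Q\<^esub> \<longleftrightarrow> x \<in> J" if x: "x \<in> carrier F" for x
  proof -
    have "g (q x) = \<zero>\<^bsub>Q\<^esub> \<longleftrightarrow> q x = \<zero>\<^bsub>?CS\<^esub>"
      using hg[OF q.hom_closed[OF x]] hg[OF CS.zero_closed] g.hom_zero by metis
    then show ?thesis unfolding \<phi>_def using q_zero[OF x] by simp
  qed
  have \<phi>_graded: "\<phi> t \<in> B n" if t: "t \<in> carrier F" "\<And>i. i \<in> I \<Longrightarrow> t i \<in> A i n" for t n
  proof -
    have "q t \<in> connected_sum_component I R A \<pi> \<delta> n"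
      unfolding connected_sum_component_def q_def using t by blast
    then obtain x where x: "x \<in> B n" "q t = h x" using h(2)[of n] by blast
    then show ?thesis unfolding \<phi>_def using gh Q.A_carrier by simp
  qed
  have \<phi>_lift: "\<exists>t\<in>carrier F. (\<forall>i\<in>I. t i \<in> A i n) \<and> x = \<phi> t" if x: "x \<in> B n" for x n
  proof -
    have "h x \<in> connected_sum_component I R A \<pi> \<delta> n" using h(2)[of n] x by blast
    then obtain t where t: "t \<in> carrier F" "\<forall>i\<in>I. t i \<in> A i n" "h x = q t"
      unfolding connected_sum_component_def q_def by blast
    then have "x = \<phi> t" unfolding \<phi>_def using gh[OF Q.A_carrier[OF x]] by simp
    then show ?thesis using t by blast
  qed
  define \<iota> where "\<iota> i r = \<phi> (\<theta> i r)" for i r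
  have \<iota>_hom: "\<iota> i \<in> ring_hom (R i) Q" if "i \<in> I" for i
    unfolding \<iota>_def[abs_def] using ring_hom_trans[OF \<theta>_hom[OF that] \<phi>_hom] by (simp add: comp_def)
  (* Closure of this set under sums lets the homogeneous components be treated one at a time. *)
  define Span where "Span = {x. \<exists>m. (\<forall>i\<in>I. m i \<in> T i) \<and> x = finsum Q (\<lambda>i. \<iota> i (m i)) I}"
  have T_closed: "r \<in> carrier (R i)" if "i \<in> I" "r \<in> T i" for i r
    using graded_artinian_ring.degree_ge_closed[OF factor_graded[OF that(1)] that(2)] .
  have \<iota>_closed: "\<iota> i r \<in> carrier Q" if "i \<in> I" "r \<in> T i" for i r
    using ring_hom_closed[OF \<iota>_hom[OF that(1)] T_closed[OF that]] .
  have Span_sum: "finsum Q f S \<in> Span" if "finite S" "\<And>n. n \<in> S \<Longrightarrow> f n \<in> Span" for f and S :: "nat set"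
    using that
  proof (induction S rule: finite_induct)
    case empty
    have "\<iota> i \<zero>\<^bsub>R i\<^esub> = \<zero>\<^bsub>Q\<^esub>" "\<zero>\<^bsub>R i\<^esub> \<in> T i" if "i \<in> I" for i
      using ring_hom_zero[OF \<iota>_hom[OF that] cring.axioms(1)[OF factor_cring[OF that]] Q.ring_axioms]
        additive_subgroup.zero_closed[OF graded_artinian_ring.degree_ge_subgroup[OF factor_graded[OF that]]] by auto
    then have "finsum Q (\<lambda>i. \<iota> i \<zero>\<^bsub>R i\<^esub>) I = \<zero>\<^bsub>Q\<^esub>" "\<forall>i\<in>I. \<zero>\<^bsub>R i\<^esub> \<in> T i"
      by (auto intro: Q.add.finprod_one_eqI)
    then show ?case unfolding Span_def by (auto intro!: exI[of _ "\<lambda>i. \<zero>\<^bsub>R i\<^esub>"])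
  next
    case (insert n S)
    obtain m where m: "\<forall>i\<in>I. m i \<in> T i" "f n = finsum Q (\<lambda>i. \<iota> i (m i)) I"
      using insert unfolding Span_def by blast
    obtain m' where m': "\<forall>i\<in>I. m' i \<in> T i" "finsum Q f S = finsum Q (\<lambda>i. \<iota> i (m' i)) I"
      using insert unfolding Span_def by blast
    have Span_carrier: "x \<in> carrier Q" if "x \<in> Span" for x
      using that \<iota>_closed unfolding Span_def by (auto intro!: Q.finsum_closed)
    have "finsum Q f (insert n S) = f n \<oplus>\<^bsub>Q\<^esub> finsum Q f S"
      by (rule Q.finsum_insert) (use insert Span_carrier in auto)
    also have "\<dots> = finsum Q (\<lambda>i. \<iota> i (m i) \<oplus>\<^bsub>Q\<^esub> \<iota> i (m' i)) I"
      unfolding m(2) m'(2) by (rule Q.finsum_addf[symmetric]) (use m m' \<iota>_closed in auto)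
    also have "\<dots> = finsum Q (\<lambda>i. \<iota> i (m i \<oplus>\<^bsub>R i\<^esub> m' i)) I"
      by (rule Q.finsum_cong)
        (use m(1) m'(1) ring_hom_add[OF \<iota>_hom] \<iota>_closed T_closed in \<open>auto simp: simp_implies_def\<close>)
    finally have "finsum Q f (insert n S) = finsum Q (\<lambda>i. \<iota> i (m i \<oplus>\<^bsub>R i\<^esub> m' i)) I" .
    moreover have "\<forall>i\<in>I. m i \<oplus>\<^bsub>R i\<^esub> m' i \<in> T i"
      using m(1) m'(1) graded_artinian_ring.degree_ge_add[OF factor_graded] by simp
    ultimately show ?case unfolding Span_def by (intro CollectI exI conjI)
  qed
  have "graded_decomposition Q B I R A \<iota> \<delta> d"
  proof (intro graded_decomposition.intro graded_decomposition_axioms.intro)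
    show "0 < d" using generator_props(6) index_nonempty by blast
    show "inj_on (\<iota> i) (carrier (R i))" if i: "i \<in> I" for i
    proof (rule inj_onI)
      fix r s assume rs: "r \<in> carrier (R i)" "s \<in> carrier (R i)" "\<iota> i r = \<iota> i s"
      interpret Ri: graded_residue_ring "R i" "A i" K "sc i" "\<pi> i" by (rule factor[OF i])
      interpret c: ring_hom_cring "R i" Q "\<iota> i"
        by (intro ring_hom_cring.intro ring_hom_cring_axioms.intro Ri.is_cring Q.is_cring \<iota>_hom[OF i])
      have "\<iota> i (r \<ominus>\<^bsub>R i\<^esub> s) = \<zero>\<^bsub>Q\<^esub>" using rs by (simp add: a_minus_def Q.r_neg)
      then have "\<theta> i (r \<ominus>\<^bsub>R i\<^esub> s) \<in> J"
        unfolding \<iota>_def using \<phi>_zero[OF \<theta>_closed[OF i Ri.minus_closed[OF rs(1,2)]]] by simp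
      then have "r \<ominus>\<^bsub>R i\<^esub> s = \<zero>\<^bsub>R i\<^esub>" using \<theta>_in_J_imp_zero[OF i] rs by simp
      then show "r = s" using Ri.diff_eq_zero_iff[OF rs(1,2)] by simp
    qed
    show "\<iota> i r \<in> B n" if "i \<in> I" "r \<in> A i n" for i r n
      unfolding \<iota>_def
      by (rule \<phi>_graded[OF \<theta>_closed[OF that(1) graded_artinian_ring.A_carrier[OF factor_graded[OF that(1)] that(2)]]
            \<theta>_homogeneous[OF that]])
    show "B 0 \<subseteq> \<iota> i ` A i 0" if i: "i \<in> I" for i
    proof
      fix x assume "x \<in> B 0"
      then obtain t where t: "t \<in> carrier F" "\<forall>j\<in>I. t j \<in> A j 0" "x = \<phi> t" using \<phi>_lift by blast
      then have "t = \<theta> i (t i)" using degree_zero_tuple[OF t(1) _ i] by blast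
      then have "x = \<iota> i (t i)" unfolding \<iota>_def using t(3) by simp
      then show "x \<in> \<iota> i ` A i 0" using t(2) i by blast
    qed
    show "\<iota> i r \<otimes>\<^bsub>Q\<^esub> \<iota> j s = \<zero>\<^bsub>Q\<^esub>" if ij: "i \<in> I" "j \<in> I" "i \<noteq> j" and rs: "r \<in> T i" "s \<in> T j" for i j r s
    proof -
      have c: "\<theta> i r \<in> carrier F" "\<theta> j s \<in> carrier F"
        using \<theta>_closed[OF ij(1) T_closed[OF ij(1) rs(1)]] \<theta>_closed[OF ij(2) T_closed[OF ij(2) rs(2)]] by auto
      have "\<theta> i r \<otimes>\<^bsub>F\<^esub> \<theta> j s = \<zero>\<^bsub>F\<^esub>"
      proof (rule fibre_ext[OF F.m_closed[OF c] F.zero_closed])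
        fix l assume l: "l \<in> I"
        interpret Rl: cring "R l" by (rule factor_cring[OF l])
        have "\<theta> i r l = \<zero>\<^bsub>R l\<^esub> \<or> \<theta> j s l = \<zero>\<^bsub>R l\<^esub>"
          using \<theta>_single[OF ij(1) rs(1)] \<theta>_single[OF ij(2) rs(2)] l ij(3) by (simp add: single_entry_def)
        then show "(\<theta> i r \<otimes>\<^bsub>F\<^esub> \<theta> j s) l = \<zero>\<^bsub>F\<^esub> l"
          unfolding fibre_mult[OF l] fibre_zero[OF l]
          using fibre_entry[OF c(1) l] fibre_entry[OF c(2) l] by (elim disjE) simp_all
      qed
      then show ?thesis unfolding \<iota>_def using \<phi>.hom_mult[OF c] \<phi>.hom_zero by simp
    qed
    show "\<exists>m. (\<forall>i\<in>I. m i \<in> T i) \<and> x = finsum Q (\<lambda>i. \<iota> i (m i)) I" if x: "x \<in> Q.degree_ge 1" for x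
    proof -
      have xc: "x \<in> carrier Q" using x by (rule Q.degree_ge_closed)
      have "Q.component n x \<in> Span" if nz: "Q.component n x \<noteq> \<zero>\<^bsub>Q\<^esub>" for n
      proof -
        have n: "1 \<le> n" using nz x by (cases n) (auto simp: Q.degree_ge_def)
        obtain t where t: "t \<in> carrier F" "\<forall>i\<in>I. t i \<in> A i n" "Q.component n x = \<phi> t"
          using \<phi>_lift[OF Q.component_mem[OF xc, of n]] by blast
        have tT: "t i \<in> T i" if "i \<in> I" for i
          using graded_artinian_ring.homogeneous_degree_ge[OF factor_graded[OF that] _ n] t(2) that by blast
        have tc: "\<theta> i (t i) \<in> carrier F" if "i \<in> I" for i using \<theta>_closed[OF that fibre_entry[OF t(1) that]] .
        have "\<phi> t = \<phi> (finsum F (\<lambda>i. \<theta> i (t i)) I)" using tuple_sum[OF t(1) tT] by simp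
        also have "\<dots> = finsum Q (\<phi> \<circ> (\<lambda>i. \<theta> i (t i))) I" by (rule \<phi>.hom_finsum) (use tc in auto)
        finally have "\<phi> t = finsum Q (\<lambda>i. \<iota> i (t i)) I" by (simp add: comp_def \<iota>_def)
        then show ?thesis unfolding Span_def t(3) using tT by blast
      qed
      then have "finsum Q (\<lambda>n. Q.component n x) {n. Q.component n x \<noteq> \<zero>\<^bsub>Q\<^esub>} \<in> Span"
        by (intro Span_sum Q.component_finite[OF xc]) auto
      then have "x \<in> Span" using Q.component_sum[OF xc] by simp
      then show ?thesis unfolding Span_def by blast
    qed
    show "\<iota> i (\<delta> i) = \<iota> j (\<delta> j)" if ij: "i \<in> I" "j \<in> I" for i j
    proof -
      note gi = generator_props[OF ij(1)] and gj = generator_props[OF ij(2)]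
      have c: "\<theta> i (\<delta> i) \<in> carrier F" "\<theta> j (\<delta> j) \<in> carrier F"
        using \<theta>_closed[OF ij(1) gi(1)] \<theta>_closed[OF ij(2) gj(1)] by auto
      have "\<theta> i (\<delta> i) \<ominus>\<^bsub>F\<^esub> \<theta> j (\<delta> j) \<in> J"
        unfolding \<theta>_single[OF ij(1) gi(4)] \<theta>_single[OF ij(2) gj(4)]
        by (rule connected_sum_ideal_ideal(2)[OF _ _ ij]) (use generator_props in auto)
      then have "\<phi> (\<theta> i (\<delta> i) \<ominus>\<^bsub>F\<^esub> \<theta> j (\<delta> j)) = \<zero>\<^bsub>Q\<^esub>" using \<phi>_zero[OF F.minus_closed[OF c]] by simp
      then have "\<phi> (\<theta> i (\<delta> i)) \<ominus>\<^bsub>Q\<^esub> \<phi> (\<theta> j (\<delta> j)) = \<zero>\<^bsub>Q\<^esub>" using c by (simp add: a_minus_def)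
      then show ?thesis unfolding \<iota>_def using Q.diff_eq_zero_iff[OF \<phi>.hom_closed[OF c(1)] \<phi>.hom_closed[OF c(2)]] by simp
    qed
    show "orthogonally_indecomposable (R i) (T i) (T i)" if "i \<in> I" for i
      by (rule graded_residue_ring.indecomposable_imp_orthogonally[OF factor[OF that] factor_generator[OF that]
            factor_indecomposable[OF that]])
    show "\<exists>x\<in>T i. \<exists>y\<in>T i. \<exists>z\<in>T i. x \<otimes>\<^bsub>R i\<^esub> y \<otimes>\<^bsub>R i\<^esub> z \<noteq> \<zero>\<^bsub>R i\<^esub>" if "i \<in> I" for i
      by (rule graded_artinian_ring.cube_nonzero[OF factor_graded[OF that] factor_length[OF that]])
  qed (rule Q index_finite index_nonempty factor_graded factor_generator generator_degree \<iota>_hom; assumption?)+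
  then show ?thesis by blast
qed

end

lemma isomorphic_connected_sum_decomposition:
  assumes K: "field K" and Q: "graded_artinian_ring Q B" and I: "finite I" "I \<noteq> {}"
    and R: "\<And>i. i \<in> I \<Longrightarrow> graded_gorenstein_artinian_algebra K (R i) (A i)"
      "\<And>i. i \<in> I \<Longrightarrow> \<not> decomposes_as_connected_sum K (R i)"
      "\<And>i. i \<in> I \<Longrightarrow> loewy_length (R i) \<ge> 3"
    and iso: "isomorphic_to_graded_connected_sum K Q B I R A"
  shows "\<exists>\<iota> \<delta> d. graded_decomposition Q B I R A \<iota> \<delta> d"
proof -
  obtain \<delta> d where \<delta>: "\<And>i. i \<in> I \<Longrightarrow> socle_generator (R i) (\<delta> i) \<and> \<delta> i \<in> A i d"
    and h: "graded_ring_isomorphic Q B (connected_sum I R (\<lambda>i. algebra_residue K (R i)) \<delta>)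
      (connected_sum_component I R A (\<lambda>i. algebra_residue K (R i)) \<delta>)"
    using iso unfolding isomorphic_to_graded_connected_sum_def Let_def by blast
  interpret graded_connected_sum K I R A \<delta> d
    by (rule graded_connected_sum.intro)
      (use \<delta> R I domain.axioms(1)[OF field.axioms(1)[OF K]] in auto)
  show ?thesis using decomposition[OF Q h] by blast
qed

section \<open>Uniqueness of the decomposition\<close>

theorem theorem5p8:
  fixes K :: "('k, 'l) ring_scheme"
    and Q :: "('k, 'q) module" and gQ :: "nat \<Rightarrow> 'q set"
    and R :: "nat \<Rightarrow> ('k, 'a) module" and gR :: "nat \<Rightarrow> nat \<Rightarrow> 'a set"
    and S :: "nat \<Rightarrow> ('k, 'b) module" and gS :: "nat \<Rightarrow> nat \<Rightarrow> 'b set"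
    and p q :: nat
  assumes "field K"
    and "graded_gorenstein_artinian_algebra K Q gQ"
    and "loewy_length Q \<ge> 3"
    and "p \<ge> 1" and "q \<ge> 1"
    and "\<And>i. i \<in> {1..p} \<Longrightarrow> graded_gorenstein_artinian_algebra K (R i) (gR i)"
    and "\<And>i. i \<in> {1..p} \<Longrightarrow> \<not> decomposes_as_connected_sum K (R i)"
    and "\<And>i. i \<in> {1..p} \<Longrightarrow> loewy_length (R i) \<ge> 3"
    and "\<And>j. j \<in> {1..q} \<Longrightarrow> graded_gorenstein_artinian_algebra K (S j) (gS j)"
    and "\<And>j. j \<in> {1..q} \<Longrightarrow> \<not> decomposes_as_connected_sum K (S j)"
    and "\<And>j. j \<in> {1..q} \<Longrightarrow> loewy_length (S j) \<ge> 3"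
    and "isomorphic_to_graded_connected_sum K Q gQ {1..p} R gR"
    and "isomorphic_to_graded_connected_sum K Q gQ {1..q} S gS"
  shows "p = q \<and>
    (\<exists>\<sigma>. \<sigma> permutes {1..p} \<and>
      (\<forall>i\<in>{1..p}. graded_ring_isomorphic (S i) (gS i) (R (\<sigma> i)) (gR (\<sigma> i))))"
proof -
  have Q: "graded_artinian_ring Q gQ"
    by (rule graded_residue_ring.axioms(1)[OF graded_gorenstein_imp_residue_ring[OF assms(2)]])
  obtain \<iota> \<delta> d where D: "graded_decomposition Q gQ {1..p} R gR \<iota> \<delta> d"
    using isomorphic_connected_sum_decomposition[OF assms(1) Q _ _ assms(6-8) assms(12)] assms(4) by auto
  obtain \<kappa> \<epsilon> e where E: "graded_decomposition Q gQ {1..q} S gS \<kappa> \<epsilon> e"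
    using isomorphic_connected_sum_decomposition[OF assms(1) Q _ _ assms(9-11) assms(13)] assms(5) by auto
  (* The second family is matched with the first one, the direction in which the permutation is stated. *)
  interpret two_graded_decompositions Q gQ "{1..q}" S gS \<kappa> \<epsilon> e "{1..p}" R gR \<iota> \<delta> d
    by (intro two_graded_decompositions.intro Q D E)
  obtain \<sigma> where \<sigma>: "bij_betw \<sigma> {1..q} {1..p}"
    "\<And>i. i \<in> {1..q} \<Longrightarrow> graded_ring_isomorphic (S i) (gS i) (R (\<sigma> i)) (gR (\<sigma> i))"
    using matching_isomorphic by blast
  have pq: "p = q" using bij_betw_same_card[OF \<sigma>(1)] by simp
  (* The matching is a bijection of {1..p}; a permutation has to fix all other numbers. *)
  define \<tau> where "\<tau> i = (if i \<in> {1..p} then \<sigma> i else i)" for i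
  have "bij_betw \<tau> {1..p} {1..p}"
    using \<sigma>(1) pq by (subst bij_betw_cong[of _ _ \<sigma>]) (auto simp: \<tau>_def)
  then have "\<tau> permutes {1..p}" by (rule bij_imp_permutes) (auto simp: \<tau>_def)
  moreover have "graded_ring_isomorphic (S i) (gS i) (R (\<tau> i)) (gR (\<tau> i))" if "i \<in> {1..p}" for i
    using \<sigma>(2)[of i] that pq by (simp add: \<tau>_def)
  ultimately show ?thesis using pq by blast
qed

end
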